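(* Fix $Ek>0$ and let $(\boldsymbol u,\boldsymbol B,P,T)$ be a smooth solution of the viscous inertialess model (see context). Suppose that the magnetic flux is exact. Let $0<\gamma<1$. If at some instant of time the magnetic field is nontrivial and dynamo action occurs, i.e. $\frac{\mathrm d}{\mathrm dt}\left(\frac12\int_V|\boldsymbol B|^2\,\mathrm dV\right)\ge 0$, then at that instant it is necessary that $$ Ra_\nu\,\|\nabla^2T\|_{L^2}\ \ge\ \frac{A_2}{2C_{\mathrm P,2}^2}\,Pe\,Ek^{-2+\gamma}\left(-1+\sqrt{1+\frac{4C_{\mathrm P,2}^2\,Ek^{1-\gamma}}{A_2^2\,Rm}}\right). $$
   Context: Domain: $V=[0,L_x]\times[0,L_y]\times[0,1]$ with $L_x,L_y>0$; all fields are periodic in $x$ and $y$. $S_-=\{z=0\}$, $S_+=\{z=1\}$, $\boldsymbol n_\pm=\pm\boldsymbol e_z$. $L^2$ norms are over $V$; $\nabla^2$ is the Laplacian. Viscous inertialess model, with positive parameters $Ek,\Lambda,Ra,Rm,Pe$ and heat source $Q=Q(\boldsymbol x)$: velocity $\boldsymbol u$, pressure $P$, magnetic field $\boldsymbol B$, temperature $T$ satisfy $$\boldsymbol e_z\times\boldsymbol u+\nabla P-Ek\nabla^2\boldsymbol u=\Lambda(\nabla\times\boldsymbol B)\times\boldsymbol B+Ra\,T\boldsymbol e_z,\quad\nabla\cdot\boldsymbol u=0,$$ $$\partial_t\boldsymbol B-\nabla\times(\boldsymbol u\times\boldsymbol B)=\tfrac1{Rm}\nabla^2\boldsymbol B,\quad\nabla\cdot\boldsymbol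 B=0,\quad \partial_tT+\nabla\cdot(\boldsymbol uT)=\tfrac1{Pe}\nabla^2T+\tfrac{Q}{Pe},$$ with boundary conditions on $S_\pm$: $\boldsymbol u\cdot\boldsymbol n_\pm=0$ (no penetration), $(\nabla\times\boldsymbol u)\times\boldsymbol n_\pm=0$ (stress-free), $\boldsymbol B\times\boldsymbol n_\pm=0$ (ferromagnetic), $T=T_\pm$ with $T_\pm$ constants (isothermal). Magnetic flux is exact if $\int_{S_\pm}\boldsymbol n_\pm\cdot\boldsymbol B\,\mathrm dS_\pm=0$. The classical Rayleigh number $Ra_\nu$ is related to the other parameters by $Ra_\nu\,Ek=Ra\,Pe$. Constants: $\lambda_1=\min\{\pi,2\pi/L_x,2\pi/L_y\}$, $C_{\mathrm P}=1/\lambda_1$, $b_2=2/\pi$, $C_{\mathrm P,2}=C_{\mathrm P}+b_2$, $C_{\mathrm L}=\left(\frac{3\pi}{32}\max\{\frac{L_x}{L_y},\frac{L_y}{L_x}\}\right)^{1/4}$ (the constant in the two-dimensional Ladyzhenskaya inequality $\|g\|_{L^4_{x,y}}\le C_{\mathrm L}\|g\|_{L^2_{x,y}}^{1/2}\|\nabla_{x,y}g\|_{L^2_{x,y}}^{1/2}$ for periodic mean-zero $g$), $C_1=C_{\mathrm L}^2C_{\mathrm P}$, $C_2=\left(\frac1{6\pi}+\frac{C_{\mathrm P}}2\right)\frac1{L_xL_yC_{\mathrm L}^2}$, $A_2=C_1\max\{3,C_2\}$. *)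

theory Defs
  imports "HOL-Analysis.Analysis"
begin

text \<open>
  Fields are functions on the horizontally unbounded layer with periodicity imposed separately,
  so that the box \<open>[0,Lx] \<times> [0,Ly] \<times> [0,1]\<close> is one period cell. Values of fields outside the
  layer (or outside the time interval) play no role.
\<close>

definition slab :: "(real^3) set" where
  "slab = {x. 0 \<le> x $ 3 \<and> x $ 3 \<le> 1}"

definition cell :: "real \<Rightarrow> real \<Rightarrow> (real^3) set" where
  "cell Lx Ly = cbox 0 (vector [Lx, Ly, 1])"

definition e_z :: "real^3" where
  "e_z = axis 3 1"

definition periodic_xy :: "real \<Rightarrow> real \<Rightarrow> (real^3 \<Rightarrow> 'b) \<Rightarrow> bool" where
  "periodic_xy Lx Ly f \<longleftrightarrow>
     (\<forall>x\<in>slab. f (x + Lx *\<^sub>R axis 1 1) = f x \<and> f (x + Ly *\<^sub>R axis 2 1) = f x)"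

text \<open>
  Derivatives are taken within \<open>S\<close>. On a convex set with nonempty interior they are unique, so
  this is smoothness up to the boundary of \<open>S\<close>.
\<close>

primrec C_k_on :: "nat \<Rightarrow> 'a::euclidean_space set \<Rightarrow> ('a \<Rightarrow> 'b::real_normed_vector) \<Rightarrow> bool" where
  "C_k_on 0 S f \<longleftrightarrow> continuous_on S f"
| "C_k_on (Suc k) S f \<longleftrightarrow>
     (\<exists>f'. (\<forall>x\<in>S. (f has_derivative f' x) (at x within S)) \<and> (\<forall>v. C_k_on k S (\<lambda>x. f' x v)))"

definition smooth_on :: "'a::euclidean_space set \<Rightarrow> ('a \<Rightarrow> 'b::real_normed_vector) \<Rightarrow> bool" where
  "smooth_on S f \<longleftrightarrow> (\<forall>k. C_k_on k S f)"

text \<open>Spatial derivatives are one-sided in \<open>z\<close> on the two boundary planes.\<close>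

definition pderiv_at :: "3 \<Rightarrow> (real^3 \<Rightarrow> 'b::real_normed_vector) \<Rightarrow> real^3 \<Rightarrow> 'b" where
  "pderiv_at i f x = frechet_derivative f (at x within slab) (axis i 1)"

definition gradient :: "(real^3 \<Rightarrow> real) \<Rightarrow> real^3 \<Rightarrow> real^3" where
  "gradient f x = (\<chi> i. pderiv_at i f x)"

definition divergence :: "(real^3 \<Rightarrow> real^3) \<Rightarrow> real^3 \<Rightarrow> real" where
  "divergence F x = (\<Sum>i\<in>UNIV. pderiv_at i (\<lambda>y. F y $ i) x)"

definition curl :: "(real^3 \<Rightarrow> real^3) \<Rightarrow> real^3 \<Rightarrow> real^3" where
  "curl F x = vector
     [pderiv_at 2 (\<lambda>y. F y $ 3) x - pderiv_at 3 (\<lambda>y. F y $ 2) x,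
      pderiv_at 3 (\<lambda>y. F y $ 1) x - pderiv_at 1 (\<lambda>y. F y $ 3) x,
      pderiv_at 1 (\<lambda>y. F y $ 2) x - pderiv_at 2 (\<lambda>y. F y $ 1) x]"

definition laplacian :: "(real^3 \<Rightarrow> 'b::real_normed_vector) \<Rightarrow> real^3 \<Rightarrow> 'b" where
  "laplacian f x = (\<Sum>i\<in>UNIV. pderiv_at i (pderiv_at i f) x)"

definition time_deriv ::
    "real set \<Rightarrow> (real \<Rightarrow> real^3 \<Rightarrow> 'b::real_normed_vector) \<Rightarrow> real \<Rightarrow> real^3 \<Rightarrow> 'b" where
  "time_deriv J f t x = vector_derivative (\<lambda>s. f s x) (at t within J)"

definition L2_norm_cell :: "real \<Rightarrow> real \<Rightarrow> (real^3 \<Rightarrow> 'b::real_normed_vector) \<Rightarrow> real" where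
  "L2_norm_cell Lx Ly f = sqrt (integral (cell Lx Ly) (\<lambda>x. (norm (f x))\<^sup>2))"

definition magnetic_energy :: "real \<Rightarrow> real \<Rightarrow> (real^3 \<Rightarrow> real^3) \<Rightarrow> real" where
  "magnetic_energy Lx Ly b = 1 / 2 * integral (cell Lx Ly) (\<lambda>x. (norm (b x))\<^sup>2)"

definition exact_flux :: "real \<Rightarrow> real \<Rightarrow> (real^3 \<Rightarrow> real^3) \<Rightarrow> bool" where
  "exact_flux Lx Ly b \<longleftrightarrow>
     integral (cbox (0, 0) (Lx, Ly)) (\<lambda>(x, y). e_z \<bullet> b (vector [x, y, 1])) = 0 \<and>
     integral (cbox (0, 0) (Lx, Ly)) (\<lambda>(x, y). (- e_z) \<bullet> b (vector [x, y, 0])) = 0"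

definition boundary_conditions ::
    "real \<Rightarrow> real \<Rightarrow> (real^3 \<Rightarrow> real^3) \<Rightarrow> (real^3 \<Rightarrow> real^3) \<Rightarrow> (real^3 \<Rightarrow> real) \<Rightarrow> bool" where
  "boundary_conditions Tminus Tplus v b \<theta> \<longleftrightarrow>
     (\<forall>(c, n, T0) \<in> {(0, - e_z, Tminus), (1, e_z, Tplus)}. \<forall>x. x $ 3 = c \<longrightarrow>
        v x \<bullet> n = 0 \<and>
        cross3 (curl v x) n = 0 \<and>
        cross3 (b x) n = 0 \<and>
        \<theta> x = T0)"

text \<open>
  \<open>J\<close> is the time interval of existence; at an endpoint belonging to \<open>J\<close>, time derivatives
  are one-sided. By smoothness it makes no difference that the equations are imposed only for
  \<open>0 < z < 1\<close>.
\<close>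

definition viscous_inertialess_solution ::
  "real \<Rightarrow> real \<Rightarrow> real \<Rightarrow> real \<Rightarrow> real \<Rightarrow> real \<Rightarrow> real \<Rightarrow> (real^3 \<Rightarrow> real) \<Rightarrow> real \<Rightarrow> real \<Rightarrow> real set \<Rightarrow>
   (real \<Rightarrow> real^3 \<Rightarrow> real^3) \<Rightarrow> (real \<Rightarrow> real^3 \<Rightarrow> real^3) \<Rightarrow>
   (real \<Rightarrow> real^3 \<Rightarrow> real) \<Rightarrow> (real \<Rightarrow> real^3 \<Rightarrow> real) \<Rightarrow> bool" where
  "viscous_inertialess_solution Lx Ly Ek \<Lambda> Ra Rm Pe Q Tminus Tplus J u B P T \<longleftrightarrow>
     is_interval J \<and> interior J \<noteq> {} \<and>
     smooth_on (J \<times> slab) (\<lambda>(t, x). u t x) \<and>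
     smooth_on (J \<times> slab) (\<lambda>(t, x). B t x) \<and>
     smooth_on (J \<times> slab) (\<lambda>(t, x). P t x) \<and>
     smooth_on (J \<times> slab) (\<lambda>(t, x). T t x) \<and>
     periodic_xy Lx Ly Q \<and>
     (\<forall>t\<in>J.
        periodic_xy Lx Ly (u t) \<and> periodic_xy Lx Ly (B t) \<and>
        periodic_xy Lx Ly (P t) \<and> periodic_xy Lx Ly (T t) \<and>
        boundary_conditions Tminus Tplus (u t) (B t) (T t) \<and>
        (\<forall>x. 0 < x $ 3 \<and> x $ 3 < 1 \<longrightarrow>
           cross3 e_z (u t x) + gradient (P t) x - Ek *\<^sub>R laplacian (u t) x =
             \<Lambda> *\<^sub>R cross3 (curl (B t) x) (B t x) + (Ra * T t x) *\<^sub>R e_z \<and>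
           divergence (u t) x = 0 \<and>
           time_deriv J B t x - curl (\<lambda>y. cross3 (u t y) (B t y)) x =
             (1 / Rm) *\<^sub>R laplacian (B t) x \<and>
           divergence (B t) x = 0 \<and>
           time_deriv J T t x + divergence (\<lambda>y. T t y *\<^sub>R u t y) x =
             1 / Pe * laplacian (T t) x + Q x / Pe))"

definition lambda_1 :: "real \<Rightarrow> real \<Rightarrow> real" where
  "lambda_1 Lx Ly = Min {pi, 2 * pi / Lx, 2 * pi / Ly}"

definition C_P :: "real \<Rightarrow> real \<Rightarrow> real" where
  "C_P Lx Ly = 1 / lambda_1 Lx Ly"

definition b_2 :: real where
  "b_2 = 2 / pi"

definition C_P2 :: "real \<Rightarrow> real \<Rightarrow> real" where
  "C_P2 Lx Ly = C_P Lx Ly + b_2"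

text \<open>
  The constant of the two-dimensional Ladyzhenskaya inequality
  \<open>\<parallel>g\<parallel>\<^bsub>L4\<^esub> \<le> C \<parallel>g\<parallel>\<^bsub>L2\<^esub>^(1/2) \<parallel>\<nabla>g\<parallel>\<^bsub>L2\<^esub>^(1/2)\<close> for mean-zero periodic functions.
\<close>

definition C_L :: "real \<Rightarrow> real \<Rightarrow> real" where
  "C_L Lx Ly = (3 * pi / 32 * max (Lx / Ly) (Ly / Lx)) powr (1 / 4)"

definition C_1 :: "real \<Rightarrow> real \<Rightarrow> real" where
  "C_1 Lx Ly = (C_L Lx Ly)\<^sup>2 * C_P Lx Ly"

definition C_2 :: "real \<Rightarrow> real \<Rightarrow> real" where
  "C_2 Lx Ly = (1 / (6 * pi) + C_P Lx Ly / 2) * (1 / (Lx * Ly * (C_L Lx Ly)\<^sup>2))"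

definition A_2 :: "real \<Rightarrow> real \<Rightarrow> real" where
  "A_2 Lx Ly = C_1 Lx Ly * max 3 (C_2 Lx Ly)"

end

theory Submission
  imports Defs
begin

text \<open>
  At a dynamo instant the energy balance gives \<open>\<parallel>\<nabla>B\<parallel>\<^sup>2 / Rm \<le> - \<integral> u \<bullet> F\<close> with \<open>F = (\<nabla> \<times> B) \<times> B\<close>.
  Split \<open>u = v + w\<close>, where \<open>v\<close> solves the rotating Stokes problem forced by the buoyancy and \<open>w\<close> the one
  forced by \<open>\<Lambda> F\<close>. Since \<open>\<Lambda> \<integral> w \<bullet> F = Ek \<parallel>\<nabla>w\<parallel>\<^sup>2 \<ge> 0\<close>, only \<open>v\<close> can sustain the field, and
  \<open>- \<integral> v \<bullet> F = - \<integral> v \<bullet> (B \<bullet> \<nabla>) B\<close> is bounded by Ladyzhenskaya's inequality on horizontal sections in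
  terms of \<open>sup\<^sub>z \<parallel>\<nabla>\<^sub>h v\<parallel>\<close>. In Fourier variables the rotating Stokes problem is diagonal, and
  \<open>\<parallel>\<partial>\<^sub>z \<nabla>\<^sub>h v\<parallel> \<le> Ra \<parallel>\<nabla>\<^sup>2 T\<parallel>\<close> uniformly in \<open>Ek\<close>. This yields
  \<open>1 / Rm \<le> A\<^sub>2 Ra \<parallel>\<nabla>\<^sup>2 T\<parallel>\<close>, which is stronger than the claim. To avoid an existence theory, the
  buoyancy is replaced by trigonometric polynomials, for which \<open>v\<close> is explicit.
\<close>

section \<open>One-dimensional inequalities\<close>

text \<open>The obstacle is that the bound on \<open>v\<close> must not degenerate as
  \<open>Ek\<close> tends to 0. The governing symbol is \<open>C + Ek\<^sup>2 * (A + C)^3\<close>,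
  where \<open>A\<close> and \<open>C\<close> belong to the horizontal and the vertical part of the
  negative Laplacian. For small \<open>Ek\<close> only \<open>C\<close> is left, so rotation
  controls vertical derivatives alone; this suffices, because the supremum over z of a section norm
  costs just one of them. Odd modes vanish on the walls while the Laplacian of \<open>T\<close> need
  not, so the approximation is in L2 only. The wall values of \<open>T\<close> enter through a
  linear profile, whose buoyancy is a gradient and does no work. The remaining temperature error
  acts on \<open>w\<close> and is absorbed by viscosity, at a price proportional to its square over
  \<open>Ek\<close>; with \<open>Ek\<close> fixed this tends to 0. The magnetic field can have
  nonzero horizontal means. Those of its horizontal components are controlled by the wall
  conditions, that of the vertical one by exactness of the flux. The claimed bound is the root of a
  quadratic inequality, which follows from the linear one by adding a nonnegative term.\<close>

lemma integral_Cauchy_Schwarz: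
  fixes f g :: "'a::euclidean_space \<Rightarrow> real"
  assumes f: "continuous_on (cbox a b) f" and g: "continuous_on (cbox a b) g"
  shows "(integral (cbox a b) (\<lambda>x. f x * g x))\<^sup>2
           \<le> integral (cbox a b) (\<lambda>x. (f x)\<^sup>2) * integral (cbox a b) (\<lambda>x. (g x)\<^sup>2)"
proof -
  define A B C where "A = integral (cbox a b) (\<lambda>x. (f x)\<^sup>2)"
    and "B = integral (cbox a b) (\<lambda>x. f x * g x)"
    and "C = integral (cbox a b) (\<lambda>x. (g x)\<^sup>2)"
  have I: "(\<lambda>x. (f x)\<^sup>2) integrable_on cbox a b" "(\<lambda>x. f x * g x) integrable_on cbox a b"
    "(\<lambda>x. (g x)\<^sup>2) integrable_on cbox a b"
    by (intro integrable_continuous continuous_intros f g)+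
  have H: "((\<lambda>x. (f x)\<^sup>2) has_integral A) (cbox a b)" "((\<lambda>x. f x * g x) has_integral B) (cbox a b)"
    "((\<lambda>x. (g x)\<^sup>2) has_integral C) (cbox a b)"
    using I by (auto simp: A_def B_def C_def integrable_integral)
  have q: "0 \<le> t\<^sup>2 * A + 2 * t * s * B + s\<^sup>2 * C" for t s :: real
  proof -
    have "((\<lambda>x. t\<^sup>2 * (f x)\<^sup>2 + 2 * t * s * (f x * g x) + s\<^sup>2 * (g x)\<^sup>2) has_integral
        (t\<^sup>2 * A + 2 * t * s * B + s\<^sup>2 * C)) (cbox a b)"
      by (intro has_integral_add has_integral_mult_right H)
    moreover have "t\<^sup>2 * (f x)\<^sup>2 + 2 * t * s * (f x * g x) + s\<^sup>2 * (g x)\<^sup>2 = (t * f x + s * g x)\<^sup>2" for x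
      by (simp add: power2_eq_square algebra_simps)
    ultimately show ?thesis
      by (auto intro: has_integral_nonneg)
  qed
  have C0: "C \<ge> 0" using q[of 0 1] by simp
  have "B\<^sup>2 \<le> A * C"
  proof (cases "C = 0")
    case True
    have "B = 0"
    proof (rule ccontr)
      assume "B \<noteq> 0"
      \<comment> \<open>With \<open>C = 0\<close> the form is linear in its second argument, and
        this choice gives it the value -1.\<close>
      then show False using q[of 1 "- (A + 1) / (2 * B)"] True by (simp add: field_simps)
    qed
    then show ?thesis using True by simp
  next
    case False
    \<comment> \<open>For fixed t the form is smallest at s = - t B / C; taking t = C clears the
      denominator.\<close>
    have "0 \<le> C * (A * C - B\<^sup>2)"
      using q[of C "-B"] by (simp add: power2_eq_square algebra_simps)
    then show ?thesis using C0 False by (simp add: zero_le_mult_iff)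
  qed
  then show ?thesis by (simp add: A_def B_def C_def)
qed

text \<open>Cauchy-Schwarz in the plane on top of two Cauchy-Schwarz bounds; the mixed product is
  handled by the inequality of arithmetic and geometric means.\<close>

lemma square_sum_le_of_squares_le:
  fixes u v :: real
  assumes "u\<^sup>2 \<le> a * c" "v\<^sup>2 \<le> b * d" "a \<ge> 0" "b \<ge> 0" "c \<ge> 0" "d \<ge> 0"
  shows "(u + v)\<^sup>2 \<le> (a + b) * (c + d)"
proof -
  have "(u * v)\<^sup>2 \<le> (a * c) * (b * d)"
    unfolding power_mult_distrib using assms by (intro mult_mono) auto
  also have "\<dots> = (a * d) * (b * c)" by (simp add: ac_simps)
  also have "\<dots> \<le> ((a * d + b * c) / 2)\<^sup>2"
    using sum_squares_ge_zero[of "a * d - b * c" 0] by (simp add: power2_eq_square field_simps)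
  finally have "\<bar>u * v\<bar> \<le> \<bar>(a * d + b * c) / 2\<bar>"
    by (simp only: abs_le_square_iff)
  moreover have "0 \<le> (a * d + b * c) / 2" using assms(3-6) by simp
  ultimately have "u * v \<le> (a * d + b * c) / 2" by (metis abs_of_nonneg abs_le_D1)
  then have "2 * (u * v) \<le> a * d + b * c" by simp
  then show ?thesis using assms(1,2) by (simp add: power2_eq_square algebra_simps)
qed

text \<open>The kernels below jump at x. Cauchy-Schwarz for continuous integrands is therefore
  applied on either side of x, and the two bounds are recombined into one over the whole
  interval.\<close>

lemma two_piece_Cauchy_Schwarz:
  fixes f k1 k2 :: "real \<Rightarrow> real"
  assumes x: "a \<le> x" "x \<le> b" and f: "continuous_on {a..b} f"
    and k: "continuous_on {a..x} k1" "continuous_on {x..b} k2"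
  shows "(integral {a..x} (\<lambda>s. k1 s * f s) + integral {x..b} (\<lambda>s. k2 s * f s))\<^sup>2 \<le>
    (integral {a..x} (\<lambda>s. (k1 s)\<^sup>2) + integral {x..b} (\<lambda>s. (k2 s)\<^sup>2)) * integral {a..b} (\<lambda>s. (f s)\<^sup>2)"
proof -
  have f1: "continuous_on {a..x} f" "continuous_on {x..b} f"
    using x by (auto intro: continuous_on_subset[OF f])
  have sp: "integral {a..x} (\<lambda>s. (f s)\<^sup>2) + integral {x..b} (\<lambda>s. (f s)\<^sup>2) = integral {a..b} (\<lambda>s. (f s)\<^sup>2)"
    using x f by (intro Henstock_Kurzweil_Integration.integral_combine integrable_continuous_real continuous_intros)
  show ?thesis unfolding sp[symmetric]
    by (rule square_sum_le_of_squares_le)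
      (use integral_Cauchy_Schwarz[of a x k1 f] integral_Cauchy_Schwarz[of x b k2 f] f1 k
       in \<open>auto intro!: integral_nonneg integrable_continuous_real continuous_intros\<close>)
qed

lemma integral_affine_by_parts:
  fixes f f' :: "real \<Rightarrow> real"
  assumes ab: "a \<le> b" and d: "\<And>x. x \<in> {a..b} \<Longrightarrow> (f has_real_derivative f' x) (at x within {a..b})"
    and c: "continuous_on {a..b} f'"
  shows "integral {a..b} (\<lambda>s. (s + p) * f' s) = (b + p) * f b - (a + p) * f a - integral {a..b} f"
proof -
  have cf: "continuous_on {a..b} f"
    using d by (rule DERIV_continuous_on)
  have "((\<lambda>s. (s + p) * f' s + f s) has_integral ((b + p) * f b - (a + p) * f a)) {a..b}"
    by (rule fundamental_theorem_of_calculus[OF ab])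
      (auto intro!: derivative_eq_intros d simp flip: has_real_derivative_iff_has_vector_derivative)
  then have "integral {a..b} (\<lambda>s. (s + p) * f' s + f s) = (b + p) * f b - (a + p) * f a"
    by blast
  moreover have "integral {a..b} (\<lambda>s. (s + p) * f' s + f s) =
      integral {a..b} (\<lambda>s. (s + p) * f' s) + integral {a..b} f"
    by (intro integral_add integrable_continuous_real continuous_intros c cf)
  ultimately show ?thesis by simp
qed

lemma integral_affine_square:
  fixes a b p :: real
  assumes "a \<le> b"
  shows "integral {a..b} (\<lambda>s. (s + p)\<^sup>2) = ((b + p)^3 - (a + p)^3) / 3"
proof -
  have "((\<lambda>s. (s + p)\<^sup>2) has_integral ((b + p)^3 / 3 - (a + p)^3 / 3)) {a..b}"
    by (rule fundamental_theorem_of_calculus[OF assms])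
      (auto intro!: derivative_eq_intros simp: power2_eq_square simp flip: has_real_derivative_iff_has_vector_derivative)
  then show ?thesis by (simp add: diff_divide_distrib integral_unique)
qed

text \<open>The sawtooth kernel below is the periodic Green's function of \<open>d/ds\<close>.\<close>

lemma periodic_kernel:
  fixes f f' :: "real \<Rightarrow> real"
  assumes x: "0 \<le> x" "x \<le> L" and d: "\<And>x. x \<in> {0..L} \<Longrightarrow> (f has_real_derivative f' x) (at x within {0..L})"
    and c: "continuous_on {0..L} f'" and per: "f 0 = f L"
  shows "L * f x - integral {0..L} f =
    integral {0..x} (\<lambda>s. (s + (L / 2 - x)) * f' s) + integral {x..L} (\<lambda>s. (s + (- L / 2 - x)) * f' s)"
proof -
  have cf: "continuous_on {0..L} f"
    using d by (rule DERIV_continuous_on)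
  have "integral {0..x} (\<lambda>s. (s + (L / 2 - x)) * f' s) =
     (x + (L / 2 - x)) * f x - (0 + (L / 2 - x)) * f 0 - integral {0..x} f"
    by (rule integral_affine_by_parts) (use x in \<open>auto intro!: DERIV_subset[OF d] continuous_on_subset[OF c]\<close>)
  moreover have "integral {x..L} (\<lambda>s. (s + (- L / 2 - x)) * f' s) =
     (L + (- L / 2 - x)) * f L - (x + (- L / 2 - x)) * f x - integral {x..L} f"
    by (rule integral_affine_by_parts) (use x in \<open>auto intro!: DERIV_subset[OF d] continuous_on_subset[OF c]\<close>)
  moreover have "integral {0..x} f + integral {x..L} f = integral {0..L} f"
    using x cf by (intro Henstock_Kurzweil_Integration.integral_combine integrable_continuous_real)
  ultimately show ?thesis using per by (simp add: algebra_simps)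
qed

text \<open>The constant is the squared L2 norm of the sawtooth, which runs through the values from
  - L / 2 to L / 2 over one period, so that the norm does not depend on x.\<close>

lemma periodic_deviation_bound:
  fixes f f' :: "real \<Rightarrow> real"
  assumes x: "0 \<le> x" "x \<le> L" and d: "\<And>x. x \<in> {0..L} \<Longrightarrow> (f has_real_derivative f' x) (at x within {0..L})"
    and c: "continuous_on {0..L} f'" and per: "f 0 = f L"
  shows "(L * f x - integral {0..L} f)\<^sup>2 \<le> L^3 / 12 * integral {0..L} (\<lambda>s. (f' s)\<^sup>2)"
proof -
  have "(L * f x - integral {0..L} f)\<^sup>2 \<le>
    (integral {0..x} (\<lambda>s. (s + (L / 2 - x))\<^sup>2) + integral {x..L} (\<lambda>s. (s + (- L / 2 - x))\<^sup>2)) * integral {0..L} (\<lambda>s. (f' s)\<^sup>2)"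
    by (subst periodic_kernel[OF x d c per], assumption, rule two_piece_Cauchy_Schwarz) (use x c in \<open>auto intro!: continuous_intros\<close>)
  also have "integral {0..x} (\<lambda>s. (s + (L / 2 - x))\<^sup>2) + integral {x..L} (\<lambda>s. (s + (- L / 2 - x))\<^sup>2) = L^3 / 12"
    unfolding integral_affine_square[OF x(1)] integral_affine_square[OF x(2)]
    by (simp add: power3_eq_cube field_simps)
  finally show ?thesis .
qed

text \<open>The kernel identity for the square of f, with a kernel of modulus at most L / 2 against
  the derivative 2 f f'. Keeping the product f f' instead of the square of f' is what makes the
  two-dimensional argument of Ladyzhenskaya work.\<close>

lemma periodic_square_bound:
  fixes f f' :: "real \<Rightarrow> real"
  assumes x: "0 \<le> x" "x \<le> L" and d: "\<And>x. x \<in> {0..L} \<Longrightarrow> (f has_real_derivative f' x) (at x within {0..L})"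
    and c: "continuous_on {0..L} f'" and per: "f 0 = f L"
  shows "L * (f x)\<^sup>2 \<le> integral {0..L} (\<lambda>s. (f s)\<^sup>2) + L * integral {0..L} (\<lambda>s. \<bar>f s * f' s\<bar>)"
proof -
  have cf: "continuous_on {0..L} f"
    using d by (rule DERIV_continuous_on)
  have c1: "continuous_on {0..x} f" "continuous_on {0..x} f'" "continuous_on {x..L} f" "continuous_on {x..L} f'"
    using x by (auto intro: continuous_on_subset[OF cf] continuous_on_subset[OF c])
  have d2: "((\<lambda>x. (f x)\<^sup>2) has_real_derivative 2 * (f x * f' x)) (at x within {0..L})" if "x \<in> {0..L}" for x
    by (auto intro!: derivative_eq_intros d that simp: power2_eq_square)
  have "L * (f x)\<^sup>2 - integral {0..L} (\<lambda>s. (f s)\<^sup>2) =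
    integral {0..x} (\<lambda>s. (s + (L / 2 - x)) * (2 * (f s * f' s))) + integral {x..L} (\<lambda>s. (s + (- L / 2 - x)) * (2 * (f s * f' s)))"
    by (rule periodic_kernel[OF x d2]) (use per in \<open>auto intro!: continuous_intros c cf\<close>)
  also have "\<dots> \<le> integral {0..x} (\<lambda>s. L * \<bar>f s * f' s\<bar>) + integral {x..L} (\<lambda>s. L * \<bar>f s * f' s\<bar>)"
  proof (intro add_mono integral_le integrable_continuous_real continuous_intros c1)
    fix s assume s: "s \<in> {0..x}"
    have "(s + (L / 2 - x)) * 2 * (f s * f' s) \<le> \<bar>(s + (L / 2 - x)) * 2\<bar> * \<bar>f s * f' s\<bar>"
      by (simp flip: abs_mult)
    also have "\<dots> \<le> L * \<bar>f s * f' s\<bar>" using s x by (intro mult_right_mono) auto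
    finally show "(s + (L / 2 - x)) * (2 * (f s * f' s)) \<le> L * \<bar>f s * f' s\<bar>" by (simp add: mult_ac)
  next
    fix s assume s: "s \<in> {x..L}"
    have "(s + (- L / 2 - x)) * 2 * (f s * f' s) \<le> \<bar>(s + (- L / 2 - x)) * 2\<bar> * \<bar>f s * f' s\<bar>"
      by (simp flip: abs_mult)
    also have "\<dots> \<le> L * \<bar>f s * f' s\<bar>" using s x by (intro mult_right_mono) auto
    finally show "(s + (- L / 2 - x)) * (2 * (f s * f' s)) \<le> L * \<bar>f s * f' s\<bar>" by (simp add: mult_ac)
  qed
  also have "\<dots> = integral {0..L} (\<lambda>s. L * \<bar>f s * f' s\<bar>)"
    using x by (intro Henstock_Kurzweil_Integration.integral_combine integrable_continuous_real continuous_intros c cf)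
  finally show ?thesis by simp
qed

text \<open>Poincare-Wirtinger, by integrating the pointwise deviation bound. This gives L^2 / 12,
  where (L / (2 pi))^2 would be sharp; the weaker constant is good enough for the comparison with
  \<open>A_2\<close>.\<close>

lemma periodic_square_integral_bound:
  fixes f f' :: "real \<Rightarrow> real"
  assumes L: "0 < L" and d: "\<And>x. x \<in> {0..L} \<Longrightarrow> (f has_real_derivative f' x) (at x within {0..L})"
    and c: "continuous_on {0..L} f'" and per: "f 0 = f L"
  shows "integral {0..L} (\<lambda>s. (f s)\<^sup>2) \<le> (integral {0..L} f)\<^sup>2 / L + L\<^sup>2 / 12 * integral {0..L} (\<lambda>s. (f' s)\<^sup>2)"
proof -
  define m I where "m = integral {0..L} f" and "I = integral {0..L} (\<lambda>s. (f' s)\<^sup>2)"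
  have cf: "continuous_on {0..L} f"
    using d by (rule DERIV_continuous_on)
  have Hf: "(f has_integral m) {0..L}"
    unfolding m_def by (intro integrable_integral integrable_continuous_real cf)
  have Hf2: "((\<lambda>s. (f s)\<^sup>2) has_integral integral {0..L} (\<lambda>s. (f s)\<^sup>2)) {0..L}"
    by (intro integrable_integral integrable_continuous_real continuous_intros cf)
  have "((\<lambda>s. L\<^sup>2 * (f s)\<^sup>2 - 2 * L * m * f s + m\<^sup>2) has_integral
       (L\<^sup>2 * integral {0..L} (\<lambda>s. (f s)\<^sup>2) - 2 * L * m * m + (L - 0) * m\<^sup>2)) {0..L}"
    using L by (intro has_integral_add has_integral_diff has_integral_mult_right Hf Hf2)
      (use has_integral_const_real[of "m\<^sup>2" 0 L] in auto)
  moreover have "((\<lambda>s. L^3 / 12 * I) has_integral (L - 0) * (L^3 / 12 * I)) {0..L}"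
    using has_integral_const_real[of "L^3 / 12 * I" 0 L] L by auto
  moreover have "L\<^sup>2 * (f s)\<^sup>2 - 2 * L * m * f s + m\<^sup>2 \<le> L^3 / 12 * I" if "s \<in> {0..L}" for s
    using periodic_deviation_bound[OF _ _ d c per, of s] that
    by (auto simp: m_def I_def power2_eq_square algebra_simps)
  ultimately have "L\<^sup>2 * integral {0..L} (\<lambda>s. (f s)\<^sup>2) - 2 * L * m * m + (L - 0) * m\<^sup>2 \<le> (L - 0) * (L^3 / 12 * I)"
    by (rule has_integral_le)
  then have "L\<^sup>2 * integral {0..L} (\<lambda>s. (f s)\<^sup>2) \<le> L\<^sup>2 * (m\<^sup>2 / L + L\<^sup>2 / 12 * I)"
    using L by (simp add: power2_eq_square power3_eq_cube algebra_simps)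
  then show ?thesis using L by (simp add: m_def I_def)
qed

text \<open>The kernel is s to the left of x and s - 1 to the right; its squared norm (x^3 + (1 -
  x)^3) / 3 is largest at the end points.\<close>

lemma mean_zero_sup_bound:
  fixes f f' :: "real \<Rightarrow> real"
  assumes x: "0 \<le> x" "x \<le> 1" and d: "\<And>x. x \<in> {0..1} \<Longrightarrow> (f has_real_derivative f' x) (at x within {0..1})"
    and c: "continuous_on {0..1} f'" and z: "integral {0..1} f = 0"
  shows "(f x)\<^sup>2 \<le> 1 / 3 * integral {0..1} (\<lambda>s. (f' s)\<^sup>2)"
proof -
  have cf: "continuous_on {0..1} f"
    using d by (rule DERIV_continuous_on)
  have "integral {0..x} (\<lambda>s. (s + 0) * f' s) = (x + 0) * f x - (0 + 0) * f 0 - integral {0..x} f"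
    by (rule integral_affine_by_parts) (use x in \<open>auto intro!: DERIV_subset[OF d] continuous_on_subset[OF c]\<close>)
  moreover have "integral {x..1} (\<lambda>s. (s + (- 1)) * f' s) = (1 + (- 1)) * f 1 - (x + (- 1)) * f x - integral {x..1} f"
    by (rule integral_affine_by_parts) (use x in \<open>auto intro!: DERIV_subset[OF d] continuous_on_subset[OF c]\<close>)
  moreover have "integral {0..x} f + integral {x..1} f = integral {0..1} f"
    using x cf by (intro Henstock_Kurzweil_Integration.integral_combine integrable_continuous_real)
  ultimately have eq: "f x = integral {0..x} (\<lambda>s. (s + 0) * f' s) + integral {x..1} (\<lambda>s. (s + (- 1)) * f' s)"
    using z by (simp add: algebra_simps)
  have "(f x)\<^sup>2 \<le> (integral {0..x} (\<lambda>s. (s + 0)\<^sup>2) + integral {x..1} (\<lambda>s. (s + (- 1))\<^sup>2)) * integral {0..1} (\<lambda>s. (f' s)\<^sup>2)"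
    unfolding eq by (rule two_piece_Cauchy_Schwarz) (use x c in \<open>auto intro!: continuous_intros\<close>)
  also have "\<dots> \<le> 1 / 3 * integral {0..1} (\<lambda>s. (f' s)\<^sup>2)"
  proof (rule mult_right_mono)
    have "x * x \<le> x" using x mult_left_le by blast
    then show "integral {0..x} (\<lambda>s. (s + 0)\<^sup>2) + integral {x..1} (\<lambda>s. (s + (- 1))\<^sup>2) \<le> 1 / 3"
      unfolding integral_affine_square[OF x(1)] integral_affine_square[OF x(2)]
      by (simp add: power3_eq_cube field_simps)
    show "0 \<le> integral {0..1} (\<lambda>s. (f' s)\<^sup>2)"
      by (intro integral_nonneg integrable_continuous_real continuous_intros c) auto
  qed
  finally show ?thesis .
qed

text \<open>Since f' has integral zero, f x can be written with the kernel c on the left and c - 1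
  on the right for any constant c. The norm is smallest for c = 1 - x, where its square is x (1 -
  x).\<close>

lemma dirichlet_sup_bound:
  fixes f f' :: "real \<Rightarrow> real"
  assumes x: "0 \<le> x" "x \<le> 1" and d: "\<And>x. x \<in> {0..1} \<Longrightarrow> (f has_real_derivative f' x) (at x within {0..1})"
    and c: "continuous_on {0..1} f'" and z: "f 0 = 0" "f 1 = 0"
  shows "(f x)\<^sup>2 \<le> 1 / 4 * integral {0..1} (\<lambda>s. (f' s)\<^sup>2)"
proof -
  have "(f' has_integral (f x - f 0)) {0..x}" "(f' has_integral (f 1 - f x)) {x..1}"
    using x by (auto intro!: fundamental_theorem_of_calculus DERIV_subset[OF d]
      simp flip: has_real_derivative_iff_has_vector_derivative)
  then have "integral {0..x} f' = f x" "integral {x..1} f' = - f x" using z by (auto dest: integral_unique)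
  then have eq: "f x = integral {0..x} (\<lambda>s. (1 - x) * f' s) + integral {x..1} (\<lambda>s. (- x) * f' s)"
    unfolding integral_mult_right by (simp add: algebra_simps)
  have "(f x)\<^sup>2 \<le> (integral {0..x} (\<lambda>s. (1 - x)\<^sup>2) + integral {x..1} (\<lambda>s. (- x)\<^sup>2)) * integral {0..1} (\<lambda>s. (f' s)\<^sup>2)"
    by (subst eq, rule two_piece_Cauchy_Schwarz) (use x c in \<open>auto intro!: continuous_intros\<close>)
  also have "\<dots> \<le> 1 / 4 * integral {0..1} (\<lambda>s. (f' s)\<^sup>2)"
  proof (rule mult_right_mono)
    have "0 \<le> (x - 1 / 2)\<^sup>2" by simp
    then show "integral {0..x} (\<lambda>s. (1 - x)\<^sup>2) + integral {x..1} (\<lambda>s. (- x)\<^sup>2) \<le> 1 / 4"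
      using x by (simp add: power2_eq_square algebra_simps)
    show "0 \<le> integral {0..1} (\<lambda>s. (f' s)\<^sup>2)"
      by (intro integral_nonneg integrable_continuous_real continuous_intros c) auto
  qed
  finally show ?thesis .
qed

section \<open>Periodic functions on a rectangle\<close>

lemma continuous_on_slices:
  fixes f :: "real \<times> real \<Rightarrow> 'b::topological_space"
  assumes "continuous_on (cbox (a, c) (b, d)) f"
  shows "y \<in> {c..d} \<Longrightarrow> continuous_on {a..b} (\<lambda>x. f (x, y))"
    and "x \<in> {a..b} \<Longrightarrow> continuous_on {c..d} (\<lambda>y. f (x, y))"
  by (rule continuous_on_compose2[OF assms]; auto intro!: continuous_intros)+

lemma integral_rect_iterated:
  fixes f :: "real \<times> real \<Rightarrow> real"
  assumes f: "continuous_on (cbox (a, c) (b, d)) f"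
  shows "integral (cbox (a, c) (b, d)) f = integral {a..b} (\<lambda>x. integral {c..d} (\<lambda>y. f (x, y)))"
    and "integral (cbox (a, c) (b, d)) f = integral {c..d} (\<lambda>y. integral {a..b} (\<lambda>x. f (x, y)))"
    and "continuous_on {a..b} (\<lambda>x. integral {c..d} (\<lambda>y. f (x, y)))"
    and "continuous_on {c..d} (\<lambda>y. integral {a..b} (\<lambda>x. f (x, y)))"
proof -
  show 1: "integral (cbox (a, c) (b, d)) f = integral {a..b} (\<lambda>x. integral {c..d} (\<lambda>y. f (x, y)))"
    using integral_prod_continuous[OF f] by simp
  show "integral (cbox (a, c) (b, d)) f = integral {c..d} (\<lambda>y. integral {a..b} (\<lambda>x. f (x, y)))"
    unfolding 1 using integral_swap_continuous[of a c b d "\<lambda>x y. f (x, y)"] f by simp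
  have "continuous_on ({a..b} \<times> cbox c d) (\<lambda>(x, y). f (x, y))"
    using f by (simp add: cbox_Pair_eq)
  from integral_continuous_on_param[OF this]
  show "continuous_on {a..b} (\<lambda>x. integral {c..d} (\<lambda>y. f (x, y)))" by simp
  have "continuous_on ({c..d} \<times> cbox a b) (\<lambda>(y, x). f (x, y))"
    unfolding split_def by (rule continuous_on_compose2[OF f]) (auto intro!: continuous_intros)
  from integral_continuous_on_param[OF this]
  show "continuous_on {c..d} (\<lambda>y. integral {a..b} (\<lambda>x. f (x, y)))" by simp
qed

abbreviation rect :: "real \<Rightarrow> real \<Rightarrow> (real \<times> real) set" where
  "rect Lx Ly \<equiv> cbox (0, 0) (Lx, Ly)"

text \<open>Partial derivatives along axis-parallel lines and matching opposite edges are the data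
  that the one-dimensional inequalities consume.\<close>

definition rect_C1 :: "real \<Rightarrow> real \<Rightarrow> (real \<times> real \<Rightarrow> real) \<Rightarrow> (real \<times> real \<Rightarrow> real) \<Rightarrow> (real \<times> real \<Rightarrow> real) \<Rightarrow> bool"
  where "rect_C1 Lx Ly g gx gy \<longleftrightarrow>
    continuous_on (rect Lx Ly) g \<and> continuous_on (rect Lx Ly) gx \<and>
    continuous_on (rect Lx Ly) gy \<and>
    (\<forall>x\<in>{0..Lx}. \<forall>y\<in>{0..Ly}.
      ((\<lambda>s. g (s, y)) has_real_derivative gx (x, y)) (at x within {0..Lx}) \<and>
      ((\<lambda>s. g (x, s)) has_real_derivative gy (x, y)) (at y within {0..Ly})) \<and>
    (\<forall>y\<in>{0..Ly}. g (0, y) = g (Lx, y)) \<and> (\<forall>x\<in>{0..Lx}. g (x, 0) = g (x, Ly))"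

text \<open>The one-dimensional inequality in x leaves the line integrals \<open>G\<close>. They
  form a periodic function of y with vanishing integral, so the inequality applies a second time in
  y.\<close>

lemma rect_Poincare:
  assumes L: "0 < Lx" "0 < Ly" and g: "rect_C1 Lx Ly g gx gy"
    and z: "integral (rect Lx Ly) g = 0"
  shows "integral (rect Lx Ly) (\<lambda>p. (g p)\<^sup>2) \<le>
    Lx\<^sup>2 / 12 * integral (rect Lx Ly) (\<lambda>p. (gx p)\<^sup>2) +
    Ly\<^sup>2 / 12 * integral (rect Lx Ly) (\<lambda>p. (gy p)\<^sup>2)"
proof -
  note g' = g[unfolded rect_C1_def]
  have c: "continuous_on (rect Lx Ly) g" "continuous_on (rect Lx Ly) gx"
    "continuous_on (rect Lx Ly) gy" using g' by auto
  have c2: "continuous_on (rect Lx Ly) (\<lambda>p. (g p)\<^sup>2)" "continuous_on (rect Lx Ly) (\<lambda>p. (gx p)\<^sup>2)"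
    "continuous_on (rect Lx Ly) (\<lambda>p. (gy p)\<^sup>2)"
    by (intro continuous_intros c)+
  define G where "G y = integral {0..Lx} (\<lambda>x. g (x, y))" for y
  define G' where "G' y = integral {0..Lx} (\<lambda>x. gy (x, y))" for y
  have cG: "continuous_on {0..Ly} G" "continuous_on {0..Ly} G'"
    unfolding G_def G'_def by (intro integral_rect_iterated c)+
  have dG: "(G has_real_derivative G' y) (at y within {0..Ly})" if y: "y \<in> {0..Ly}" for y
    using leibniz_rule_field_derivative[of "{0..Ly}" 0 Lx "\<lambda>y x. g (x, y)" "\<lambda>y x. gy (x, y)" y]
      continuous_on_compose2[OF c(3), of "{0..Ly} \<times> {0..Lx}" "\<lambda>p. (snd p, fst p)"]
      g' that
    by (force simp: G_def[abs_def] G'_def split_def cbox_Pair_eq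
        intro!: integrable_continuous_real continuous_on_slices(1)[OF c(1)] continuous_intros)
  have perG: "G 0 = G Ly"
    unfolding G_def using g' by (intro integral_cong) auto
  have G0: "integral {0..Ly} G = 0"
    using z integral_rect_iterated(2)[OF c(1)] by (simp add: G_def[abs_def])
  have "integral {0..Ly} (\<lambda>y. (G y)\<^sup>2) \<le> (integral {0..Ly} G)\<^sup>2 / Ly + Ly\<^sup>2 / 12 * integral {0..Ly} (\<lambda>y. (G' y)\<^sup>2)"
    by (rule periodic_square_integral_bound) (use L dG cG perG in auto)
  also have "\<dots> = Ly\<^sup>2 / 12 * integral {0..Ly} (\<lambda>y. (G' y)\<^sup>2)" by (simp add: G0)
  also have "\<dots> \<le> Ly\<^sup>2 / 12 * integral {0..Ly} (\<lambda>y. Lx * integral {0..Lx} (\<lambda>x. (gy (x, y))\<^sup>2))"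
  proof (intro mult_left_mono integral_le integrable_continuous_real continuous_intros cG
      integral_rect_iterated(4)[OF c2(3)])
    fix y assume y: "y \<in> {0..Ly}"
    show "(G' y)\<^sup>2 \<le> Lx * integral {0..Lx} (\<lambda>x. (gy (x, y))\<^sup>2)"
      using integral_Cauchy_Schwarz[of 0 Lx "\<lambda>_. 1" "\<lambda>x. gy (x, y)"] continuous_on_slices(1)[OF c(3) y] L
      by (simp add: G'_def)
  qed auto
  also have "\<dots> = Lx * (Ly\<^sup>2 / 12 * integral (rect Lx Ly) (\<lambda>p. (gy p)\<^sup>2))"
    by (simp add: integral_rect_iterated(2)[OF c2(3)])
  finally have A: "integral {0..Ly} (\<lambda>y. (G y)\<^sup>2) / Lx \<le> Ly\<^sup>2 / 12 * integral (rect Lx Ly) (\<lambda>p. (gy p)\<^sup>2)"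
    using L by (simp add: field_simps)
  have "integral (rect Lx Ly) (\<lambda>p. (g p)\<^sup>2) = integral {0..Ly} (\<lambda>y. integral {0..Lx} (\<lambda>x. (g (x, y))\<^sup>2))"
    by (rule integral_rect_iterated(2)[OF c2(1)])
  also have "\<dots> \<le> integral {0..Ly} (\<lambda>y. (G y)\<^sup>2 / Lx + Lx\<^sup>2 / 12 * integral {0..Lx} (\<lambda>x. (gx (x, y))\<^sup>2))"
  proof (intro integral_le integrable_continuous_real continuous_intros cG
      integral_rect_iterated(4)[OF c2(1)] integral_rect_iterated(4)[OF c2(2)])
    fix y assume y: "y \<in> {0..Ly}"
    show "integral {0..Lx} (\<lambda>x. (g (x, y))\<^sup>2) \<le> (G y)\<^sup>2 / Lx + Lx\<^sup>2 / 12 * integral {0..Lx} (\<lambda>x. (gx (x, y))\<^sup>2)"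
      unfolding G_def
      by (rule periodic_square_integral_bound) (use L g' y continuous_on_slices(1)[OF c(2) y] in auto)
  qed (use L in auto)
  also have "\<dots> = integral {0..Ly} (\<lambda>y. (G y)\<^sup>2 / Lx) + integral {0..Ly} (\<lambda>y. Lx\<^sup>2 / 12 * integral {0..Lx} (\<lambda>x. (gx (x, y))\<^sup>2))"
    by (intro integral_add integrable_continuous_real continuous_intros cG integral_rect_iterated(4)[OF c2(2)])
      (use L in auto)
  also have "\<dots> = integral {0..Ly} (\<lambda>y. (G y)\<^sup>2) / Lx + Lx\<^sup>2 / 12 * integral (rect Lx Ly) (\<lambda>p. (gx p)\<^sup>2)"
    by (simp add: integral_rect_iterated(2)[OF c2(2)])
  finally show ?thesis using A by linarith
qed

text \<open>Ladyzhenskaya's argument: the square of g is bounded by a function of y alone and by a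
  function of x alone, so the fourth power is bounded by a product whose double integral
  factorises.\<close>

lemma rect_power4_le:
  assumes L: "0 < Lx" "0 < Ly" and g: "rect_C1 Lx Ly g gx gy"
  defines "N \<equiv> integral (rect Lx Ly) (\<lambda>p. (g p)\<^sup>2)"
  shows "Lx * Ly * integral (rect Lx Ly) (\<lambda>p. (g p)^4) \<le>
    (N + Lx * sqrt (N * integral (rect Lx Ly) (\<lambda>p. (gx p)\<^sup>2))) *
    (N + Ly * sqrt (N * integral (rect Lx Ly) (\<lambda>p. (gy p)\<^sup>2)))"
proof -
  let ?R = "rect Lx Ly"
  note g' = g[unfolded rect_C1_def]
  have c: "continuous_on ?R g" "continuous_on ?R gx" "continuous_on ?R gy" using g' by auto
  have c2: "continuous_on ?R (\<lambda>p. (g p)\<^sup>2)" "continuous_on ?R (\<lambda>p. \<bar>g p * gx p\<bar>)" "continuous_on ?R (\<lambda>p. \<bar>g p * gy p\<bar>)"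
    by (intro continuous_intros c)+
  define \<alpha> where "\<alpha> y = integral {0..Lx} (\<lambda>x. (g (x, y))\<^sup>2) + Lx * integral {0..Lx} (\<lambda>x. \<bar>g (x, y) * gx (x, y)\<bar>)" for y
  define \<beta> where "\<beta> x = integral {0..Ly} (\<lambda>y. (g (x, y))\<^sup>2) + Ly * integral {0..Ly} (\<lambda>y. \<bar>g (x, y) * gy (x, y)\<bar>)" for x
  have ca: "continuous_on {0..Ly} \<alpha>" unfolding \<alpha>_def
    by (intro continuous_intros integral_rect_iterated(4)[OF c2(1)] integral_rect_iterated(4)[OF c2(2)])
  have cb: "continuous_on {0..Lx} \<beta>" unfolding \<beta>_def
    by (intro continuous_intros integral_rect_iterated(3)[OF c2(1)] integral_rect_iterated(3)[OF c2(3)])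
  have a: "Lx * (g (x, y))\<^sup>2 \<le> \<alpha> y" and b: "Ly * (g (x, y))\<^sup>2 \<le> \<beta> x" if "x \<in> {0..Lx}" "y \<in> {0..Ly}" for x y
    unfolding \<alpha>_def \<beta>_def
    using periodic_square_bound[of x Lx "\<lambda>x. g (x, y)" "\<lambda>x. gx (x, y)"] periodic_square_bound[of y Ly "\<lambda>y. g (x, y)" "\<lambda>y. gy (x, y)"]
      continuous_on_slices(1)[OF c(2)] continuous_on_slices(2)[OF c(3)] that g' by auto
  have cab: "continuous_on ?R (\<lambda>p. \<beta> (fst p) * \<alpha> (snd p))"
    by (intro continuous_intros continuous_on_compose2[OF ca] continuous_on_compose2[OF cb]) (auto simp: cbox_Pair_eq)
  have "Lx * Ly * integral ?R (\<lambda>p. (g p)^4) = integral ?R (\<lambda>p. Lx * Ly * (g p)^4)" by simp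
  also have "\<dots> \<le> integral ?R (\<lambda>p. \<beta> (fst p) * \<alpha> (snd p))"
  proof (intro integral_le integrable_continuous cab continuous_intros c)
    fix p assume "p \<in> ?R"
    then have p: "fst p \<in> {0..Lx}" "snd p \<in> {0..Ly}" by (auto simp: cbox_Pair_eq)
    have "Lx * Ly * (g p)^4 = (Ly * (g p)\<^sup>2) * (Lx * (g p)\<^sup>2)" by (simp add: power2_eq_square power4_eq_xxxx)
    also have "\<dots> \<le> \<beta> (fst p) * \<alpha> (snd p)"
      using a[OF p] b[OF p] L by (intro mult_mono) (auto intro: order_trans[rotated])
    finally show "Lx * Ly * (g p)^4 \<le> \<beta> (fst p) * \<alpha> (snd p)" .
  qed
  also have "\<dots> = integral {0..Lx} \<beta> * integral {0..Ly} \<alpha>"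
    by (simp add: integral_rect_iterated(1)[OF cab])
  also have "integral {0..Lx} \<beta> = N + Ly * integral ?R (\<lambda>p. \<bar>g p * gy p\<bar>)"
    unfolding \<beta>_def N_def integral_rect_iterated(1)[OF c2(1)] integral_rect_iterated(1)[OF c2(3)]
    by (subst integral_add)
      (auto intro!: integrable_continuous_real continuous_intros integral_rect_iterated(3)[OF c2(1)] integral_rect_iterated(3)[OF c2(3)])
  also have "integral {0..Ly} \<alpha> = N + Lx * integral ?R (\<lambda>p. \<bar>g p * gx p\<bar>)"
    unfolding \<alpha>_def N_def integral_rect_iterated(2)[OF c2(1)] integral_rect_iterated(2)[OF c2(2)]
    by (subst integral_add)
      (auto intro!: integrable_continuous_real continuous_intros integral_rect_iterated(4)[OF c2(1)] integral_rect_iterated(4)[OF c2(2)])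
  also have "(N + Ly * integral ?R (\<lambda>p. \<bar>g p * gy p\<bar>)) * (N + Lx * integral ?R (\<lambda>p. \<bar>g p * gx p\<bar>)) \<le>
     (N + Ly * sqrt (N * integral ?R (\<lambda>p. (gy p)\<^sup>2))) * (N + Lx * sqrt (N * integral ?R (\<lambda>p. (gx p)\<^sup>2)))"
  proof -
    have "integral ?R (\<lambda>p. \<bar>g p * gx p\<bar>) \<le> sqrt (N * integral ?R (\<lambda>p. (gx p)\<^sup>2))"
      using integral_Cauchy_Schwarz[of "(0,0)" "(Lx,Ly)" "\<lambda>p. \<bar>g p\<bar>" "\<lambda>p. \<bar>gx p\<bar>"] c
      by (intro real_le_rsqrt) (simp add: N_def abs_mult continuous_on_rabs)
    moreover have "integral ?R (\<lambda>p. \<bar>g p * gy p\<bar>) \<le> sqrt (N * integral ?R (\<lambda>p. (gy p)\<^sup>2))"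
      using integral_Cauchy_Schwarz[of "(0,0)" "(Lx,Ly)" "\<lambda>p. \<bar>g p\<bar>" "\<lambda>p. \<bar>gy p\<bar>"] c
      by (intro real_le_rsqrt) (simp add: N_def abs_mult continuous_on_rabs)
    moreover have "0 \<le> N" unfolding N_def by (intro integral_nonneg integrable_continuous c2) auto
    moreover have "0 \<le> integral ?R (\<lambda>p. \<bar>g p * gx p\<bar>)" "0 \<le> integral ?R (\<lambda>p. \<bar>g p * gy p\<bar>)"
      by (intro integral_nonneg integrable_continuous c2; simp)+
    ultimately show ?thesis using L
      by (intro mult_mono add_left_mono mult_left_mono add_nonneg_nonneg mult_nonneg_nonneg) linarith+
  qed
  finally show ?thesis by (simp add: mult.commute)
qed

text \<open>The Poincare inequality eliminates the L2 norm and leaves the gradient alone, which is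
  the form in which V and B enter the transport estimate.\<close>

lemma rect_L4_bound:
  assumes L: "0 < Lx" "0 < Ly" and g: "rect_C1 Lx Ly g gx gy"
    and z: "integral (rect Lx Ly) g = 0"
  shows "integral (rect Lx Ly) (\<lambda>p. (g p)^4) \<le> (max Lx Ly)^4 / (12 * Lx * Ly) *
    (integral (rect Lx Ly) (\<lambda>p. (gx p)\<^sup>2) + integral (rect Lx Ly) (\<lambda>p. (gy p)\<^sup>2))\<^sup>2"
proof -
  let ?R = "rect Lx Ly"
  define l where "l = max Lx Ly"
  define n p q where "n = sqrt (integral ?R (\<lambda>p. (g p)\<^sup>2))"
    and "p = sqrt (integral ?R (\<lambda>p. (gx p)\<^sup>2))" and "q = sqrt (integral ?R (\<lambda>p. (gy p)\<^sup>2))"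
  define S where "S = sqrt (p\<^sup>2 + q\<^sup>2)"
  have l: "0 < l" "Lx \<le> l" "Ly \<le> l" using L by (auto simp: l_def)
  have nn: "0 \<le> integral ?R (\<lambda>p. (g p)\<^sup>2)" "0 \<le> integral ?R (\<lambda>p. (gx p)\<^sup>2)" "0 \<le> integral ?R (\<lambda>p. (gy p)\<^sup>2)"
    using g unfolding rect_C1_def by (auto intro!: integral_nonneg integrable_continuous continuous_intros)
  have n0: "0 \<le> n" "0 \<le> p" "0 \<le> q" "0 \<le> S" using nn by (auto simp: n_def p_def q_def S_def)
  have e: "integral ?R (\<lambda>p. (g p)\<^sup>2) = n\<^sup>2" "integral ?R (\<lambda>p. (gx p)\<^sup>2) = p\<^sup>2" "integral ?R (\<lambda>p. (gy p)\<^sup>2) = q\<^sup>2"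
    using nn by (simp_all add: n_def p_def q_def)
  have S2: "S\<^sup>2 = p\<^sup>2 + q\<^sup>2" by (simp add: S_def)
  have "n\<^sup>2 \<le> Lx\<^sup>2 / 12 * p\<^sup>2 + Ly\<^sup>2 / 12 * q\<^sup>2" using rect_Poincare[OF L g z] by (simp add: e)
  also have "\<dots> \<le> l\<^sup>2 / 12 * p\<^sup>2 + l\<^sup>2 / 12 * q\<^sup>2" using L l by (intro add_mono mult_right_mono divide_right_mono power_mono) auto
  finally have nS: "n\<^sup>2 \<le> l\<^sup>2 * S\<^sup>2 / 12" by (simp add: S2 algebra_simps)
  \<comment> \<open>Decimal upper bounds for 1 / sqrt 12 here and for sqrt 2 below: 0.29 + 1.42 / 2
    = 1, so both contributions fit exactly into one factor \<open>l * S\<close>.\<close>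
  moreover have "(29 / 100 * (l * S))\<^sup>2 = 841 / 10000 * (l\<^sup>2 * S\<^sup>2)" by (simp add: power2_eq_square)
  moreover have "0 \<le> l\<^sup>2 * S\<^sup>2" by simp
  ultimately have "n\<^sup>2 \<le> (29 / 100 * (l * S))\<^sup>2" by linarith
  then have n1: "n \<le> 29 / 100 * (l * S)" by (rule power2_le_imp_le) (use l n0 in simp)
  have "(p + q)\<^sup>2 \<le> 2 * S\<^sup>2"
    unfolding S2 using sum_squares_ge_zero[of "p - q" 0] by (simp add: power2_eq_square algebra_simps)
  also have "\<dots> \<le> 20164 / 10000 * S\<^sup>2" by (intro mult_right_mono) auto
  also have "\<dots> = (142 / 100 * S)\<^sup>2" by (simp add: power2_eq_square)
  finally have pq: "p + q \<le> 142 / 100 * S" by (rule power2_le_imp_le) (use n0 in simp)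
  have "Lx * Ly * integral ?R (\<lambda>p. (g p)^4) \<le> (n\<^sup>2 + Lx * sqrt (n\<^sup>2 * p\<^sup>2)) * (n\<^sup>2 + Ly * sqrt (n\<^sup>2 * q\<^sup>2))"
    using rect_power4_le[OF L g] by (simp only: e)
  also have "\<dots> = n\<^sup>2 * ((n + Lx * p) * (n + Ly * q))"
    using n0 by (simp add: real_sqrt_mult power2_eq_square algebra_simps)
  also have "\<dots> \<le> n\<^sup>2 * ((n + l * p) * (n + l * q))"
    using n0 l L by (intro mult_left_mono mult_mono add_mono mult_right_mono) auto
  also have "\<dots> \<le> n\<^sup>2 * (l * S)\<^sup>2"
  proof (rule mult_left_mono)
    have "(n + l * p) * (n + l * q) \<le> (n + l * (p + q) / 2)\<^sup>2"
      using sum_squares_ge_zero[of "l * (p - q)" 0] by (simp add: power2_eq_square field_simps)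
    also have "\<dots> \<le> (l * S)\<^sup>2"
    proof (rule power_mono)
      have "l * (p + q) \<le> l * (142 / 100 * S)" using l pq by (intro mult_left_mono) auto
      moreover have "l * (142 / 100 * S) = 142 / 100 * (l * S)" by simp
      ultimately show "n + l * (p + q) / 2 \<le> l * S" using n1 by linarith
    qed (use n0 l in auto)
    finally show "(n + l * p) * (n + l * q) \<le> (l * S)\<^sup>2" .
  qed simp
  also have "n\<^sup>2 * (l * S)\<^sup>2 \<le> l\<^sup>2 * S\<^sup>2 / 12 * (l * S)\<^sup>2" by (intro mult_right_mono nS) auto
  finally have "Lx * Ly * integral ?R (\<lambda>p. (g p)^4) \<le> l^4 / 12 * (S\<^sup>2)\<^sup>2"
    by (simp add: power2_eq_square power4_eq_xxxx mult_ac)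
  then show ?thesis unfolding e S2 l_def using L by (simp add: field_simps)
qed

text \<open>Hoelder's inequality with exponents 4, 4 and 2, as two applications of Cauchy-Schwarz
  followed by \<open>rect_L4_bound\<close> for the first two factors.\<close>

lemma rect_trilinear:
  assumes L: "0 < Lx" "0 < Ly" and f: "rect_C1 Lx Ly f fx fy" and h: "rect_C1 Lx Ly h hx hy"
    and z: "integral (rect Lx Ly) f = 0" "integral (rect Lx Ly) h = 0"
    and k: "continuous_on (rect Lx Ly) k"
  shows "(integral (rect Lx Ly) (\<lambda>p. f p * h p * k p))\<^sup>2 \<le> (max Lx Ly)^4 / (12 * Lx * Ly) *
    (integral (rect Lx Ly) (\<lambda>p. (fx p)\<^sup>2) + integral (rect Lx Ly) (\<lambda>p. (fy p)\<^sup>2)) *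
    (integral (rect Lx Ly) (\<lambda>p. (hx p)\<^sup>2) + integral (rect Lx Ly) (\<lambda>p. (hy p)\<^sup>2)) *
    integral (rect Lx Ly) (\<lambda>p. (k p)\<^sup>2)"
proof -
  let ?R = "rect Lx Ly"
  define \<kappa> where "\<kappa> = (max Lx Ly)^4 / (12 * Lx * Ly)"
  have k0: "0 \<le> \<kappa>" using L by (auto simp: \<kappa>_def)
  define F H where "F = integral ?R (\<lambda>p. (fx p)\<^sup>2) + integral ?R (\<lambda>p. (fy p)\<^sup>2)"
    and "H = integral ?R (\<lambda>p. (hx p)\<^sup>2) + integral ?R (\<lambda>p. (hy p)\<^sup>2)"
  have FH: "0 \<le> F" "0 \<le> H"
    using f h unfolding F_def H_def rect_C1_def
    by (auto intro!: integral_nonneg integrable_continuous continuous_intros add_nonneg_nonneg)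
  have c: "continuous_on ?R f" "continuous_on ?R h" using f h by (auto simp: rect_C1_def)
  have p4: "(x\<^sup>2)\<^sup>2 = x^4" for x :: real by simp
  have f4: "integral ?R (\<lambda>p. ((f p)\<^sup>2)\<^sup>2) \<le> \<kappa> * F\<^sup>2" and h4: "integral ?R (\<lambda>p. ((h p)\<^sup>2)\<^sup>2) \<le> \<kappa> * H\<^sup>2"
    using rect_L4_bound[OF L f z(1)] rect_L4_bound[OF L h z(2)] by (simp_all only: F_def H_def \<kappa>_def p4)
  have "(integral ?R (\<lambda>p. (f p)\<^sup>2 * (h p)\<^sup>2))\<^sup>2 \<le> integral ?R (\<lambda>p. ((f p)\<^sup>2)\<^sup>2) * integral ?R (\<lambda>p. ((h p)\<^sup>2)\<^sup>2)"
    by (rule integral_Cauchy_Schwarz) (intro continuous_intros c)+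
  also have "\<dots> \<le> (\<kappa> * F\<^sup>2) * (\<kappa> * H\<^sup>2)"
    using k0 by (intro mult_mono f4 h4) (auto simp: c intro!: integral_nonneg integrable_continuous continuous_intros)
  also have "\<dots> = (\<kappa> * F * H)\<^sup>2" by (simp add: power2_eq_square)
  finally have *: "integral ?R (\<lambda>p. (f p)\<^sup>2 * (h p)\<^sup>2) \<le> \<kappa> * F * H"
    by (rule power2_le_imp_le) (use k0 FH in simp)
  have "(integral ?R (\<lambda>p. f p * h p * k p))\<^sup>2 \<le> integral ?R (\<lambda>p. (f p * h p)\<^sup>2) * integral ?R (\<lambda>p. (k p)\<^sup>2)"
    by (rule integral_Cauchy_Schwarz) (intro continuous_intros c k)+
  also have "\<dots> \<le> \<kappa> * F * H * integral ?R (\<lambda>p. (k p)\<^sup>2)"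
    using * by (intro mult_right_mono) (auto simp: power_mult_distrib k intro!: integral_nonneg integrable_continuous continuous_intros)
  finally show ?thesis by (simp add: F_def H_def \<kappa>_def mult_ac)
qed

section \<open>Fields on the slab\<close>

definition point :: "real \<Rightarrow> real \<Rightarrow> real \<Rightarrow> real^3" where
  "point x y z = vector [x, y, z]"

lemma point_nth [simp]: "point x y z $ 1 = x" "point x y z $ 2 = y" "point x y z $ 3 = z"
  by (simp_all add: point_def)

lemma point_eq: "point (x $ 1) (x $ 2) (x $ 3) = x"
  by (simp add: vec_eq_iff forall_3)

lemma point_slab [simp]: "point x y z \<in> slab \<longleftrightarrow> 0 \<le> z \<and> z \<le> 1"
  by (simp add: slab_def)

lemma mem_cell: "x \<in> cell Lx Ly \<longleftrightarrow>
    0 \<le> x $ 1 \<and> x $ 1 \<le> Lx \<and> 0 \<le> x $ 2 \<and> x $ 2 \<le> Ly \<and> 0 \<le> x $ 3 \<and> x $ 3 \<le> 1"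
  by (auto simp: cell_def mem_box_cart forall_3)

lemma cell_subset_slab: "cell Lx Ly \<subseteq> slab"
  by (auto simp: mem_cell slab_def)

lemma continuous_on_point [continuous_intros]:
  assumes "continuous_on S f" "continuous_on S g" "continuous_on S h"
  shows "continuous_on S (\<lambda>s. point (f s) (g s) (h s))"
proof -
  have "point a b c = a *\<^sub>R axis 1 1 + b *\<^sub>R axis 2 1 + c *\<^sub>R axis 3 1" for a b c
    by (simp add: vec_eq_iff forall_3 axis_def)
  then show ?thesis by (simp add: assms continuous_intros)
qed

text \<open>The coordinate map carries boxes of \<open>real^3\<close> to boxes of nested pairs with
  the same content, so integrals transfer to a product type and can be iterated. The grouping ((x,
  y), z) separates horizontal sections from the vertical variable.\<close>

lemma integral_cell_eq_box:
  fixes f :: "real^3 \<Rightarrow> real"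
  assumes c: "continuous_on (cell Lx Ly) f"
  shows "integral (cell Lx Ly) f = integral (cbox ((0, 0), 0) ((Lx, Ly), 1)) (\<lambda>((x, y), z). f (point x y z))"
proof -
  define \<phi> :: "(real \<times> real) \<times> real \<Rightarrow> real^3" where "\<phi> = (\<lambda>((x, y), z). point x y z)"
  define \<psi> :: "real^3 \<Rightarrow> (real \<times> real) \<times> real" where "\<psi> x = ((x $ 1, x $ 2), x $ 3)" for x
  have im1: "\<psi> ` cbox u v = cbox ((u $ 1, u $ 2), u $ 3) ((v $ 1, v $ 2), v $ 3)" for u v
  proof (intro equalityI subsetI)
    fix p assume "p \<in> cbox ((u $ 1, u $ 2), u $ 3) ((v $ 1, v $ 2), v $ 3)"
    then have "\<phi> p \<in> cbox u v" "p = \<psi> (\<phi> p)"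
      by (auto simp: \<phi>_def \<psi>_def cbox_Pair_eq mem_box_cart forall_3)
    then show "p \<in> \<psi> ` cbox u v" by blast
  qed (auto simp: \<psi>_def cbox_Pair_eq mem_box_cart)
  have im2: "\<phi> ` cbox u v = cbox (\<phi> u) (\<phi> v)" for u v
  proof (intro equalityI subsetI)
    fix p assume "p \<in> cbox (\<phi> u) (\<phi> v)"
    then have "\<psi> p \<in> cbox u v"
      by (cases u; cases v) (auto simp: \<phi>_def \<psi>_def cbox_Pair_eq mem_box_cart forall_3)
    moreover have "p = \<phi> (\<psi> p)" by (simp add: \<phi>_def \<psi>_def point_eq)
    ultimately show "p \<in> \<phi> ` cbox u v" by blast
  qed (cases u; cases v; auto simp: \<phi>_def cbox_Pair_eq mem_box_cart forall_3)
  have ct: "measure lborel (\<phi> ` cbox u v) = 1 * measure lborel (cbox u v)" for u v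
  proof (cases "cbox u v = {}")
    case False
    then have "cbox (\<phi> u) (\<phi> v) \<noteq> {}" using im2 by blast
    then have "measure lborel (cbox (\<phi> u) (\<phi> v)) = (\<Prod>i\<in>UNIV. \<phi> v $ i - \<phi> u $ i)"
      by (rule content_cbox_cart)
    also have "\<dots> = measure lborel (cbox u v)"
    proof -
      obtain u1 u2 u3 v1 v2 v3 where uv: "u = ((u1, u2), u3)" "v = ((v1, v2), v3)"
        by (metis prod.collapse)
      have "u1 \<le> v1" "u2 \<le> v2" "u3 \<le> v3" using False unfolding uv by (auto simp: cbox_Pair_eq)
      then have "measure lborel (cbox u v) = (v1 - u1) * (v2 - u2) * (v3 - u3)"
        by (simp add: uv content_Pair)
      moreover have "(\<Prod>i\<in>UNIV. \<phi> v $ i - \<phi> u $ i) = (v1 - u1) * (v2 - u2) * (v3 - u3)"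
        unfolding uv \<phi>_def split_conv UNIV_3 by (simp add: mult.assoc)
      ultimately show ?thesis by simp
    qed
    finally show ?thesis by (simp add: im2)
  qed simp
  have cp: "continuous_on UNIV \<phi>" unfolding \<phi>_def split_def by (intro continuous_intros)
  have inv1: "\<psi> (\<phi> x) = x" for x by (simp add: \<phi>_def \<psi>_def split_def)
  have inv2: "\<phi> (\<psi> x) = x" for x by (simp add: \<phi>_def \<psi>_def point_eq)
  have H: "(f has_integral integral (cell Lx Ly) f) (cbox 0 (vector [Lx, Ly, 1]))"
    using integrable_continuous[OF c[unfolded cell_def]] by (simp add: cell_def integrable_integral)
  have "((\<lambda>p. f (\<phi> p)) has_integral (1 / 1) *\<^sub>R integral (cell Lx Ly) f) (\<psi> ` cbox 0 (vector [Lx, Ly, 1]))"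
    by (rule has_integral_twiddle[OF zero_less_one inv1 inv2 _ _ _ ct H])
      (use cp im1 im2 in \<open>blast intro: continuous_on_interior[OF cp, simplified]\<close>)+
  then have "((\<lambda>p. f (\<phi> p)) has_integral integral (cell Lx Ly) f) (cbox ((0, 0), 0) ((Lx, Ly), 1))"
    by (simp add: im1)
  then show ?thesis unfolding \<phi>_def by (simp add: integral_unique split_def)
qed

definition hsec :: "(real^3 \<Rightarrow> real) \<Rightarrow> real \<Rightarrow> real \<times> real \<Rightarrow> real" where
  "hsec f z = (\<lambda>(x, y). f (point x y z))"

lemma hsec_continuous:
  assumes "continuous_on slab f" "z \<in> {0..1}"
  shows "continuous_on S (hsec f z)"
  unfolding hsec_def split_def
  by (rule continuous_on_compose2[OF assms(1)]) (use assms(2) in \<open>auto intro!: continuous_intros\<close>)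

lemma integral_cell_hsec:
  assumes f: "continuous_on slab f"
  shows "integral (cell Lx Ly) f = integral {0..1} (\<lambda>z. integral (rect Lx Ly) (hsec f z))"
    and "continuous_on {0..1} (\<lambda>z. integral (rect Lx Ly) (hsec f z))"
    and "integral (cell Lx Ly) f =
      integral (rect Lx Ly) (\<lambda>(x, y). integral {0..1} (\<lambda>z. f (point x y z)))"
    and "continuous_on (rect Lx Ly) (\<lambda>(x, y). integral {0..1} (\<lambda>z. f (point x y z)))"
proof -
  have c: "continuous_on (cbox ((0, 0), 0) ((Lx, Ly), 1)) (\<lambda>((x, y), z). f (point x y z))"
    unfolding split_def
    by (rule continuous_on_compose2[OF f]) (auto intro!: continuous_intros simp: cbox_Pair_eq)
  have e: "integral (cell Lx Ly) f = integral (cbox ((0, 0), 0) ((Lx, Ly), 1)) (\<lambda>((x, y), z). f (point x y z))"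
    by (rule integral_cell_eq_box) (rule continuous_on_subset[OF f cell_subset_slab])
  also have "\<dots> = integral (rect Lx Ly) (\<lambda>p. integral (cbox 0 1) (\<lambda>z. f (point (fst p) (snd p) z)))"
    using integral_prod_continuous[OF c] by (simp add: split_def)
  finally show 3: "integral (cell Lx Ly) f = integral (rect Lx Ly) (\<lambda>(x, y). integral {0..1} (\<lambda>z. f (point x y z)))"
    by (simp add: split_def)
  have "integral (rect Lx Ly) (\<lambda>p. integral (cbox 0 1) (\<lambda>z. f (point (fst p) (snd p) z))) =
      integral (cbox 0 1) (\<lambda>z. integral (rect Lx Ly) (\<lambda>p. f (point (fst p) (snd p) z)))"
    by (rule integral_swap_continuous) (use c in \<open>simp add: split_def\<close>)
  then show "integral (cell Lx Ly) f = integral {0..1} (\<lambda>z. integral (rect Lx Ly) (hsec f z))"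
    using 3 by (simp add: split_def hsec_def)
  have "continuous_on ({0..1} \<times> rect Lx Ly) (\<lambda>(z, p). hsec f z p)"
    unfolding hsec_def split_def
    by (rule continuous_on_compose2[OF f]) (auto intro!: continuous_intros)
  from integral_continuous_on_param[OF this]
  show "continuous_on {0..1} (\<lambda>z. integral (rect Lx Ly) (hsec f z))" .
  have "continuous_on (rect Lx Ly \<times> cbox 0 1) (\<lambda>(p, z). f (point (fst p) (snd p) z))"
    unfolding split_def
    by (rule continuous_on_compose2[OF f]) (auto intro!: continuous_intros)
  from integral_continuous_on_param[OF this]
  show "continuous_on (rect Lx Ly) (\<lambda>(x, y). integral {0..1} (\<lambda>z. f (point x y z)))"
    by (simp add: split_def)
qed

lemma cell_integrable: "continuous_on slab f \<Longrightarrow> f integrable_on cell Lx Ly" for f :: "real^3 \<Rightarrow> real"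
  unfolding cell_def
  by (rule integrable_continuous, rule continuous_on_subset)
    (use cell_subset_slab[of Lx Ly, unfolded cell_def] in auto)

text \<open>The gradient is carried as an argument rather than computed by \<open>pderiv_at\<close>.
  Trigonometric fields with \<open>tr_d\<close> and smooth fields with \<open>pderiv_at\<close>
  become instances alike, and the closure lemmas read as sum and product rules.\<close>

definition C1_field :: "real \<Rightarrow> real \<Rightarrow> (real^3 \<Rightarrow> real) \<Rightarrow> (3 \<Rightarrow> real^3 \<Rightarrow> real) \<Rightarrow> bool" where
  "C1_field Lx Ly f g \<longleftrightarrow> periodic_xy Lx Ly f \<and> (\<forall>i. continuous_on slab (g i)) \<and>
     (\<forall>x\<in>slab. (f has_derivative (\<lambda>h. \<Sum>i\<in>UNIV. g i x * h $ i)) (at x within slab))"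

lemma C1_field_continuous:
  assumes "C1_field Lx Ly f g"
  shows "continuous_on slab f" "continuous_on slab (g i)"
  using assms unfolding C1_field_def by (auto intro: has_derivative_continuous_on)

lemma C1_field_cong:
  assumes "C1_field Lx Ly f g" "\<And>x. x \<in> slab \<Longrightarrow> f' x = f x" "\<And>i x. x \<in> slab \<Longrightarrow> g' i x = g i x"
  shows "C1_field Lx Ly f' g'"
proof -
  have tr: "x + Lx *\<^sub>R axis 1 1 \<in> slab" "x + Ly *\<^sub>R axis 2 1 \<in> slab" if "x \<in> slab" for x
    using that by (auto simp: slab_def axis_def)
  show ?thesis using assms tr unfolding C1_field_def periodic_xy_def
    by (auto intro: has_derivative_transform continuous_on_eq)
qed

lemma C1_field_add:
  assumes "C1_field Lx Ly f g" "C1_field Lx Ly f' g'"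
  shows "C1_field Lx Ly (\<lambda>x. f x + f' x) (\<lambda>i x. g i x + g' i x)"
  using assms unfolding C1_field_def periodic_xy_def
  by (auto intro!: continuous_intros derivative_eq_intros simp: algebra_simps sum.distrib)

lemma C1_field_cmul:
  assumes "C1_field Lx Ly f g"
  shows "C1_field Lx Ly (\<lambda>x. c * f x) (\<lambda>i x. c * g i x)"
  using assms unfolding C1_field_def periodic_xy_def
  by (auto intro!: continuous_intros derivative_eq_intros simp: algebra_simps sum_distrib_left)

lemma C1_field_diff:
  assumes "C1_field Lx Ly f g" "C1_field Lx Ly f' g'"
  shows "C1_field Lx Ly (\<lambda>x. f x - f' x) (\<lambda>i x. g i x - g' i x)"
  using C1_field_add[OF assms(1) C1_field_cmul[OF assms(2), of "-1"]] by simp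

lemma C1_field_mult:
  assumes "C1_field Lx Ly f g" "C1_field Lx Ly f' g'"
  shows "C1_field Lx Ly (\<lambda>x. f x * f' x) (\<lambda>i x. g i x * f' x + f x * g' i x)"
  using assms C1_field_continuous[OF assms(1)] C1_field_continuous[OF assms(2)]
  unfolding C1_field_def periodic_xy_def
  by (auto intro!: continuous_intros derivative_eq_intros
      simp: algebra_simps sum_distrib_left sum_distrib_right sum.distrib)

text \<open>Horizontal lines never leave the slab, so any set S serves in the first two claims;
  vertical lines do leave it, hence the closed unit interval in the third.\<close>

lemma C1_field_partial:
  assumes f: "C1_field Lx Ly f g" and z: "z \<in> {0..1}"
  shows "((\<lambda>s. f (point s y z)) has_real_derivative g 1 (point x y z)) (at x within S)"
    and "((\<lambda>s. f (point x s z)) has_real_derivative g 2 (point x y z)) (at y within S)"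
    and "((\<lambda>s. f (point x y s)) has_real_derivative g 3 (point x y z)) (at z within {0..1})"
proof -
  have f': "(f has_derivative (\<lambda>h. \<Sum>i\<in>UNIV. g i (point x y z) * h $ i)) (at (point x y z) within slab)"
    using f z by (auto simp: C1_field_def)
  have p: "point a b c = point 0 0 0 + a *\<^sub>R axis 1 1 + b *\<^sub>R axis 2 1 + c *\<^sub>R axis 3 1" for a b c
    by (simp add: vec_eq_iff forall_3 axis_def)
  have d: "((\<lambda>s. point s y z) has_derivative (\<lambda>h. h *\<^sub>R axis 1 1)) (at x within S)"
    "((\<lambda>s. point x s z) has_derivative (\<lambda>h. h *\<^sub>R axis 2 1)) (at y within S)"
    "((\<lambda>s. point x y s) has_derivative (\<lambda>h. h *\<^sub>R axis 3 1)) (at z within {0..1})"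
    by (subst p, auto intro!: derivative_eq_intros)+
  have "((\<lambda>s. f (point s y z)) has_derivative (\<lambda>h. \<Sum>i\<in>UNIV. g i (point x y z) * (h *\<^sub>R axis 1 1) $ i)) (at x within S)"
    by (rule has_derivative_in_compose[OF d(1)], rule has_derivative_subset[OF f']) (use z in auto)
  then show "((\<lambda>s. f (point s y z)) has_real_derivative g 1 (point x y z)) (at x within S)"
    unfolding has_field_derivative_def by (rule has_derivative_eq_rhs) (simp add: sum_3 axis_def fun_eq_iff)
  have "((\<lambda>s. f (point x s z)) has_derivative (\<lambda>h. \<Sum>i\<in>UNIV. g i (point x y z) * (h *\<^sub>R axis 2 1) $ i)) (at y within S)"
    by (rule has_derivative_in_compose[OF d(2)], rule has_derivative_subset[OF f']) (use z in auto)
  then show "((\<lambda>s. f (point x s z)) has_real_derivative g 2 (point x y z)) (at y within S)"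
    unfolding has_field_derivative_def by (rule has_derivative_eq_rhs) (simp add: sum_3 axis_def fun_eq_iff)
  have "((\<lambda>s. f (point x y s)) has_derivative (\<lambda>h. \<Sum>i\<in>UNIV. g i (point x y z) * (h *\<^sub>R axis 3 1) $ i)) (at z within {0..1})"
    by (rule has_derivative_in_compose[OF d(3)], rule has_derivative_subset[OF f']) (use z in auto)
  then show "((\<lambda>s. f (point x y s)) has_real_derivative g 3 (point x y z)) (at z within {0..1})"
    unfolding has_field_derivative_def by (rule has_derivative_eq_rhs) (simp add: sum_3 axis_def fun_eq_iff)
qed

lemma periodic_xy_point:
  assumes f: "periodic_xy Lx Ly f" and z: "z \<in> {0..1}"
  shows "f (point 0 y z) = f (point Lx y z)" "f (point x 0 z) = f (point x Ly z)"
proof -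
  have "point 0 y z + Lx *\<^sub>R axis 1 1 = point Lx y z" "point x 0 z + Ly *\<^sub>R axis 2 1 = point x Ly z"
    by (simp_all add: vec_eq_iff forall_3 axis_def)
  then show "f (point 0 y z) = f (point Lx y z)" "f (point x 0 z) = f (point x Ly z)"
    using f z unfolding periodic_xy_def by (metis atLeastAtMost_iff point_slab)+
qed

lemma C1_field_periodic:
  assumes "C1_field Lx Ly f g" "z \<in> {0..1}"
  shows "f (point 0 y z) = f (point Lx y z)" "f (point x 0 z) = f (point x Ly z)"
  using assms periodic_xy_point unfolding C1_field_def by metis+

lemma C1_field_rect_C1:
  assumes f: "C1_field Lx Ly f g" and z: "z \<in> {0..1}"
  shows "rect_C1 Lx Ly (hsec f z) (hsec (g 1) z) (hsec (g 2) z)"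
  unfolding rect_C1_def
  using C1_field_partial[OF f z] C1_field_periodic[OF f z] C1_field_continuous[OF f] z
  by (intro conjI ballI hsec_continuous) (auto simp: hsec_def)

lemma section_integral_partial_eq_0:
  assumes L: "0 < Lx" "0 < Ly" and f: "C1_field Lx Ly f g" and i: "i \<noteq> 3" and z: "z \<in> {0..1}"
  shows "integral (rect Lx Ly) (hsec (g i) z) = 0"
proof -
  note c = C1_field_continuous[OF f]
  have "integral {0..Lx} (\<lambda>x. hsec (g 1) z (x, y)) = 0" for y
    using fundamental_theorem_of_calculus[of 0 Lx "\<lambda>x. f (point x y z)" "\<lambda>x. g 1 (point x y z)"]
      C1_field_partial(1)[OF f z] C1_field_periodic[OF f z] L
    by (auto simp: hsec_def has_real_derivative_iff_has_vector_derivative integral_unique)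
  moreover have "integral {0..Ly} (\<lambda>y. hsec (g 2) z (x, y)) = 0" for x
    using fundamental_theorem_of_calculus[of 0 Ly "\<lambda>y. f (point x y z)" "\<lambda>y. g 2 (point x y z)"]
      C1_field_partial(2)[OF f z] C1_field_periodic[OF f z] L
    by (auto simp: hsec_def has_real_derivative_iff_has_vector_derivative integral_unique)
  ultimately show ?thesis
    using i exhaust_3[of i] integral_rect_iterated(1)[OF hsec_continuous[OF c(2)[of 2] z]]
      integral_rect_iterated(2)[OF hsec_continuous[OF c(2)[of 1] z]] by auto
qed

lemma vertical_integral_partial_eq_0:
  assumes f: "C1_field Lx Ly f g" and b: "\<forall>x. x $ 3 = 0 \<or> x $ 3 = 1 \<longrightarrow> f x = 0"
  shows "integral {0..1} (\<lambda>z. g 3 (point x y z)) = 0"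
  using fundamental_theorem_of_calculus[of 0 1 "\<lambda>z. f (point x y z)" "\<lambda>z. g 3 (point x y z)"]
    C1_field_partial(3)[OF f] b
  by (auto simp: has_real_derivative_iff_has_vector_derivative integral_unique)

lemma integral_partial_eq_0:
  assumes L: "0 < Lx" "0 < Ly" and f: "C1_field Lx Ly f g"
    and b: "i = 3 \<Longrightarrow> \<forall>x. x $ 3 = 0 \<or> x $ 3 = 1 \<longrightarrow> f x = 0"
  shows "integral (cell Lx Ly) (g i) = 0"
proof (cases "i = 3")
  case True
  show ?thesis
    using vertical_integral_partial_eq_0[OF f b[OF True]] True
    by (simp add: integral_cell_hsec(3)[OF C1_field_continuous(2)[OF f]] split_def)
next
  case False
  have "integral {0..1} (\<lambda>z. integral (rect Lx Ly) (hsec (g i) z)) = integral {0..1} (\<lambda>z::real. 0::real)"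
    by (intro integral_cong section_integral_partial_eq_0[OF L f False])
  then show ?thesis by (simp add: integral_cell_hsec(1)[OF C1_field_continuous(2)[OF f]])
qed

text \<open>Lateral boundary terms cancel by periodicity, so a wall condition is asked only for the
  vertical derivative, and only of the product of the two fields.\<close>

lemma integral_by_parts_cell:
  assumes L: "0 < Lx" "0 < Ly" and f: "C1_field Lx Ly f g" and f': "C1_field Lx Ly f' g'"
    and b: "i = 3 \<Longrightarrow> \<forall>x. x $ 3 = 0 \<or> x $ 3 = 1 \<longrightarrow> f x * f' x = 0"
  shows "integral (cell Lx Ly) (\<lambda>x. f x * g' i x) = - integral (cell Lx Ly) (\<lambda>x. g i x * f' x)"
proof -
  note c = C1_field_continuous[OF f] C1_field_continuous[OF f']
  have "integral (cell Lx Ly) (\<lambda>x. g i x * f' x + f x * g' i x) = 0"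
    by (rule integral_partial_eq_0[OF L C1_field_mult[OF f f'] b])
  moreover have "integral (cell Lx Ly) (\<lambda>x. g i x * f' x + f x * g' i x) =
      integral (cell Lx Ly) (\<lambda>x. g i x * f' x) + integral (cell Lx Ly) (\<lambda>x. f x * g' i x)"
    by (intro integral_add cell_integrable continuous_intros c)
  ultimately show ?thesis by simp
qed

lemma hsec_cmult: "hsec (\<lambda>x. f x * g x) z = (\<lambda>p. hsec f z p * hsec g z p)"
  by (auto simp: hsec_def)

lemma hsec_power: "hsec (\<lambda>x. (f x)^n) z = (\<lambda>p. (hsec f z p)^n)"
  by (auto simp: hsec_def)

lemma hsec_sum: "hsec (\<lambda>x. \<Sum>i\<in>I. f i x) z = (\<lambda>p. \<Sum>i\<in>I. hsec (f i) z p)"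
  by (auto simp: hsec_def)

lemma horizontal_integral_deriv:
  assumes f: "C1_field Lx Ly f g" and z: "z \<in> {0..1}"
  shows "((\<lambda>z. integral (rect Lx Ly) (hsec f z)) has_real_derivative integral (rect Lx Ly) (hsec (g 3) z)) (at z within {0..1})"
proof (rule leibniz_rule_field_derivative)
  show "continuous_on ({0..1} \<times> rect Lx Ly) (\<lambda>(z, p). hsec (g 3) z p)"
    unfolding hsec_def split_def
    by (rule continuous_on_compose2[OF C1_field_continuous(2)[OF f]]) (auto intro!: continuous_intros)
  show "((\<lambda>z. hsec f z p) has_real_derivative hsec (g 3) z p) (at z within {0..1})" if "z \<in> {0..1}" for z p
    using C1_field_partial(3)[OF f that] by (simp add: hsec_def split_def)
qed (use z in \<open>auto intro!: integrable_continuous hsec_continuous[OF C1_field_continuous(1)[OF f]]\<close>)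

text \<open>One vertical derivative controls sections at every height. The alternatives are meant
  for the vertical velocity component, which vanishes on the walls, and for the horizontal ones,
  whose vertical mean is zero; 1 / 3 covers both one-dimensional constants.\<close>

lemma section_L2_bound:
  assumes f: "C1_field Lx Ly f g" and z: "z \<in> {0..1}"
    and b: "(\<forall>x. x $ 3 = 0 \<or> x $ 3 = 1 \<longrightarrow> f x = 0) \<or> (\<forall>x y. integral {0..1} (\<lambda>z. f (point x y z)) = 0)"
  shows "integral (rect Lx Ly) (\<lambda>p. (hsec f z p)\<^sup>2) \<le> 1 / 3 * integral (cell Lx Ly) (\<lambda>x. (g 3 x)\<^sup>2)"
proof -
  note c = C1_field_continuous[OF f]
  have c3: "continuous_on slab (\<lambda>x. (g 3 x)\<^sup>2)" by (intro continuous_intros c)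
  have cv: "continuous_on {0..1} (\<lambda>z. g 3 (point x y z))" for x y
    by (rule continuous_on_compose2[OF c(2)]) (auto intro!: continuous_intros)
  have pt: "(f (point x y z))\<^sup>2 \<le> 1 / 3 * integral {0..1} (\<lambda>z. (g 3 (point x y z))\<^sup>2)" for x y
  proof -
    have nn: "0 \<le> integral {0..1} (\<lambda>z. (g 3 (point x y z))\<^sup>2)"
      by (intro integral_nonneg integrable_continuous_real continuous_intros cv) auto
    have d: "((\<lambda>z. f (point x y z)) has_real_derivative g 3 (point x y z)) (at z within {0..1})" if "z \<in> {0..1}" for z
      by (rule C1_field_partial(3)[OF f that])
    from b show ?thesis
    proof
      assume "\<forall>x. x $ 3 = 0 \<or> x $ 3 = 1 \<longrightarrow> f x = 0"
      then have "(f (point x y z))\<^sup>2 \<le> 1 / 4 * integral {0..1} (\<lambda>z. (g 3 (point x y z))\<^sup>2)"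
        by (intro dirichlet_sup_bound) (use z d cv in auto)
      also have "\<dots> \<le> 1 / 3 * integral {0..1} (\<lambda>z. (g 3 (point x y z))\<^sup>2)"
        using nn by (intro mult_right_mono) auto
      finally show ?thesis .
    next
      assume "\<forall>x y. integral {0..1} (\<lambda>z. f (point x y z)) = 0"
      then show ?thesis by (intro mean_zero_sup_bound) (use z d cv in auto)
    qed
  qed
  have "integral (rect Lx Ly) (\<lambda>p. (hsec f z p)\<^sup>2) \<le>
      integral (rect Lx Ly) (\<lambda>p. 1 / 3 * (case p of (x, y) \<Rightarrow> integral {0..1} (\<lambda>z. (g 3 (point x y z))\<^sup>2)))"
    by (intro integral_le integrable_continuous continuous_intros hsec_continuous c z
        integral_cell_hsec(4)[OF c3]) (use pt in \<open>auto simp: hsec_def\<close>)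
  also have "\<dots> = 1 / 3 * integral (cell Lx Ly) (\<lambda>x. (g 3 x)\<^sup>2)"
    by (simp only: integral_mult_right integral_cell_hsec(3)[OF c3])
  finally show ?thesis .
qed

lemma dirichlet_Poincare:
  assumes f: "C1_field Lx Ly f g" and b: "\<forall>x. x $ 3 = 0 \<or> x $ 3 = 1 \<longrightarrow> f x = 0"
  shows "integral (cell Lx Ly) (\<lambda>x. (f x)\<^sup>2) \<le> integral (cell Lx Ly) (\<lambda>x. (g 3 x)\<^sup>2)"
proof -
  note c = C1_field_continuous[OF f]
  have c2: "continuous_on slab (\<lambda>x. (f x)\<^sup>2)" by (intro continuous_intros c)
  have "integral (cell Lx Ly) (\<lambda>x. (f x)\<^sup>2) = integral {0..1} (\<lambda>z. integral (rect Lx Ly) (hsec (\<lambda>x. (f x)\<^sup>2) z))"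
    by (rule integral_cell_hsec(1)[OF c2])
  also have "\<dots> \<le> integral {0..1} (\<lambda>z::real. 1 / 3 * integral (cell Lx Ly) (\<lambda>x. (g 3 x)\<^sup>2))"
    by (intro integral_le integrable_continuous_real integral_cell_hsec(2)[OF c2] continuous_intros)
      (use section_L2_bound[OF f _ disjI1[OF b]] in \<open>simp add: hsec_power\<close>)
  also have "\<dots> \<le> integral (cell Lx Ly) (\<lambda>x. (g 3 x)\<^sup>2)"
    using integral_nonneg[OF cell_integrable[of "\<lambda>x. (g 3 x)\<^sup>2"]] c by (simp add: continuous_intros)
  finally show ?thesis .
qed

text \<open>Shaped for the transport estimate, where a comes from V, b from B and c from the
  gradient of B. Cauchy-Schwarz is applied once, on the product of the index sets, so no factor
  depending on the number of terms appears.\<close>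

lemma double_sum_Cauchy_Schwarz:
  fixes t c :: "'a \<Rightarrow> 'b \<Rightarrow> real"
  assumes t: "\<And>i j. (t i j)\<^sup>2 \<le> a i * b j * c i j" and nn: "\<And>i. 0 \<le> a i" "\<And>j. 0 \<le> b j" "\<And>i j. 0 \<le> c i j"
  shows "(\<Sum>i\<in>I. \<Sum>j\<in>J. \<bar>t i j\<bar>)\<^sup>2 \<le> (\<Sum>i\<in>I. a i) * (\<Sum>j\<in>J. b j) * (\<Sum>i\<in>I. \<Sum>j\<in>J. c i j)"
proof -
  have "\<bar>t i j\<bar> \<le> sqrt (a i * b j) * sqrt (c i j)" for i j
    using t[of i j] by (simp add: real_le_rsqrt flip: real_sqrt_mult)
  then have "(\<Sum>i\<in>I. \<Sum>j\<in>J. \<bar>t i j\<bar>) \<le> (\<Sum>i\<in>I. \<Sum>j\<in>J. sqrt (a i * b j) * sqrt (c i j))"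
    by (intro sum_mono)
  then have "(\<Sum>i\<in>I. \<Sum>j\<in>J. \<bar>t i j\<bar>)\<^sup>2 \<le> (\<Sum>i\<in>I. \<Sum>j\<in>J. sqrt (a i * b j) * sqrt (c i j))\<^sup>2"
    by (intro power_mono sum_nonneg) auto
  also have "\<dots> = (\<Sum>p\<in>I\<times>J. sqrt (a (fst p) * b (snd p)) * sqrt (c (fst p) (snd p)))\<^sup>2"
    by (simp add: sum.cartesian_product split_def)
  also have "\<dots> \<le> (\<Sum>p\<in>I\<times>J. (sqrt (a (fst p) * b (snd p)))\<^sup>2) * (\<Sum>p\<in>I\<times>J. (sqrt (c (fst p) (snd p)))\<^sup>2)"
    by (rule Cauchy_Schwarz_ineq_sum)
  also have "\<dots> = (\<Sum>p\<in>I\<times>J. a (fst p) * b (snd p)) * (\<Sum>p\<in>I\<times>J. c (fst p) (snd p))"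
    using nn by simp
  also have "(\<Sum>p\<in>I\<times>J. a (fst p) * b (snd p)) = (\<Sum>i\<in>I. a i) * (\<Sum>j\<in>J. b j)"
    by (simp add: sum_product sum.cartesian_product split_def)
  also have "(\<Sum>p\<in>I\<times>J. c (fst p) (snd p)) = (\<Sum>i\<in>I. \<Sum>j\<in>J. c i j)"
    by (simp add: sum.cartesian_product split_def)
  finally show ?thesis .
qed

text \<open>The integral of f over sections is a function of z that vanishes at both ends, so the
  one-dimensional Dirichlet bound with its constant 1 / 4 applies to it.\<close>

lemma horizontal_mean_bound:
  assumes L: "0 < Lx" "0 < Ly" and f: "C1_field Lx Ly f g" and z: "z \<in> {0..1}"
    and b: "\<forall>x. x $ 3 = 0 \<or> x $ 3 = 1 \<longrightarrow> f x = 0"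
  shows "(integral (rect Lx Ly) (hsec f z) / (Lx * Ly))\<^sup>2 \<le>
    integral (cell Lx Ly) (\<lambda>x. (g 3 x)\<^sup>2) / (4 * (Lx * Ly))"
proof -
  note c = C1_field_continuous[OF f]
  have c3: "continuous_on slab (\<lambda>x. (g 3 x)\<^sup>2)" by (intro continuous_intros c)
  let ?b = "\<lambda>z. integral (rect Lx Ly) (hsec f z)" and ?b' = "\<lambda>z. integral (rect Lx Ly) (hsec (g 3) z)"
  have z0: "hsec f 0 = (\<lambda>_. 0)" "hsec f 1 = (\<lambda>_. 0)" using b by (auto simp: hsec_def)
  have "(?b z)\<^sup>2 \<le> 1 / 4 * integral {0..1} (\<lambda>z. (?b' z)\<^sup>2)"
    by (rule dirichlet_sup_bound) (use z horizontal_integral_deriv[OF f] integral_cell_hsec(2)[OF c(2)] z0 in auto)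
  also have "integral {0..1} (\<lambda>z. (?b' z)\<^sup>2) \<le> integral {0..1} (\<lambda>z. Lx * Ly * integral (rect Lx Ly) (hsec (\<lambda>x. (g 3 x)\<^sup>2) z))"
  proof (intro integral_le integrable_continuous_real continuous_intros integral_cell_hsec(2)[OF c(2)] integral_cell_hsec(2)[OF c3])
    fix z :: real assume z: "z \<in> {0..1}"
    show "(?b' z)\<^sup>2 \<le> Lx * Ly * integral (rect Lx Ly) (hsec (\<lambda>x. (g 3 x)\<^sup>2) z)"
      using integral_Cauchy_Schwarz[of "(0,0)" "(Lx,Ly)" "\<lambda>_. 1" "hsec (g 3) z"] hsec_continuous[OF c(2) z] L
      by (simp add: hsec_power content_Pair)
  qed
  also have "\<dots> = Lx * Ly * integral (cell Lx Ly) (\<lambda>x. (g 3 x)\<^sup>2)"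
    by (simp add: integral_cell_hsec(1)[OF c3])
  finally have "(?b z)\<^sup>2 \<le> Lx * Ly * integral (cell Lx Ly) (\<lambda>x. (g 3 x)\<^sup>2) / 4" by simp
  then show ?thesis using L by (simp add: field_simps power2_eq_square)
qed

section \<open>Transport estimate\<close>

lemma abs_double_sum_le:
  fixes t :: "'a \<Rightarrow> 'b \<Rightarrow> real"
  shows "\<bar>\<Sum>i\<in>I. \<Sum>j\<in>J. t i j\<bar> \<le> (\<Sum>i\<in>I. \<Sum>j\<in>J. \<bar>t i j\<bar>)"
  by (rule order_trans[OF sum_abs]) (intro sum_mono sum_abs)

lemma rect_C1_diff_const:
  "rect_C1 Lx Ly g gx gy \<Longrightarrow> rect_C1 Lx Ly (\<lambda>p. g p - c) gx gy"
  unfolding rect_C1_def by (auto intro!: continuous_intros derivative_eq_intros)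

text \<open>At each height B is split into its horizontal mean and a fluctuation; let l be the
  larger period. The fluctuation meets V in the trilinear estimate and yields the term with l^2. The
  mean is bounded by the vertical derivative of B over the whole cell, meets V through the Poincare
  inequality, and yields the term with l / 2. Since V enters through a supremum over z, the rest
  integrates to the gradient energy of B.\<close>

lemma transport_estimate:
  fixes V B :: "3 \<Rightarrow> real^3 \<Rightarrow> real" and VG BG :: "3 \<Rightarrow> 3 \<Rightarrow> real^3 \<Rightarrow> real"
  assumes L: "0 < Lx" "0 < Ly"
    and V: "\<And>i. C1_field Lx Ly (V i) (VG i)" and B: "\<And>i. C1_field Lx Ly (B i) (BG i)"
    and mean: "\<And>i z. z \<in> {0..1} \<Longrightarrow> integral (rect Lx Ly) (hsec (V i) z) = 0"
    and sup: "\<And>z. z \<in> {0..1} \<Longrightarrow> (\<Sum>i\<in>UNIV. integral (rect Lx Ly) (\<lambda>p. (hsec (VG i 1) z p)\<^sup>2) +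
        integral (rect Lx Ly) (\<lambda>p. (hsec (VG i 2) z p)\<^sup>2)) \<le> M\<^sup>2"
    and M: "0 \<le> M"
    and flux: "\<And>z. z \<in> {0..1} \<Longrightarrow> integral (rect Lx Ly) (hsec (B 3) z) = 0"
    and bdry: "\<And>i x. i \<noteq> 3 \<Longrightarrow> x $ 3 = 0 \<or> x $ 3 = 1 \<Longrightarrow> B i x = 0"
  shows "\<bar>integral (cell Lx Ly) (\<lambda>x. \<Sum>i\<in>UNIV. \<Sum>j\<in>UNIV. V i x * B j x * BG i j x)\<bar> \<le>
    M * max Lx Ly * (max Lx Ly + 1 / 2) / sqrt (12 * (Lx * Ly)) *
    integral (cell Lx Ly) (\<lambda>x. \<Sum>i\<in>UNIV. \<Sum>j\<in>UNIV. (BG i j x)\<^sup>2)"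
proof -
  define l where "l = max Lx Ly"
  define G where "G = integral (cell Lx Ly) (\<lambda>x. \<Sum>i\<in>UNIV. \<Sum>j\<in>UNIV. (BG i j x)\<^sup>2)"
  define s where "s = sqrt (Lx * Ly)"
  have s: "0 < s" "s\<^sup>2 = Lx * Ly" using L by (simp_all add: s_def)
  have l: "0 < l" "Lx \<le> l" "Ly \<le> l" using L by (auto simp: l_def)
  note cV = C1_field_continuous[OF V] and cB = C1_field_continuous[OF B]
  have cBG2: "continuous_on slab (\<lambda>x. \<Sum>i\<in>UNIV. \<Sum>j\<in>UNIV. (BG i j x)\<^sup>2)" by (intro continuous_intros cB)
  have cT: "continuous_on slab (\<lambda>x. \<Sum>i\<in>UNIV. \<Sum>j\<in>UNIV. V i x * B j x * BG i j x)" by (intro continuous_intros cV cB)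
  define Z where "Z z = integral (rect Lx Ly) (hsec (\<lambda>x. \<Sum>i\<in>UNIV. \<Sum>j\<in>UNIV. (BG i j x)\<^sup>2) z)" for z
  have G0: "0 \<le> G" unfolding G_def by (intro integral_nonneg cell_integrable cBG2) (auto intro!: sum_nonneg)
  have GZ: "G = integral {0..1} Z" and cZ: "continuous_on {0..1} Z"
    unfolding G_def Z_def by (rule integral_cell_hsec[OF cBG2])+
  have slice: "\<bar>integral (rect Lx Ly) (hsec (\<lambda>x. \<Sum>i\<in>UNIV. \<Sum>j\<in>UNIV. V i x * B j x * BG i j x) z)\<bar> \<le>
      M * l\<^sup>2 / (sqrt 12 * s) * Z z + M * l / (sqrt 12 * (4 * s)) * (G + Z z)" if z: "z \<in> {0..1}" for z
  proof -
    define R where "R = rect Lx Ly"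
    define v where "v i = hsec (V i) z" for i
    define vG where "vG i j = hsec (VG i j) z" for i j
    define b where "b j = integral R (hsec (B j) z) / (Lx * Ly)" for j
    define w where "w j p = hsec (B j) z p - b j" for j p
    define bG where "bG i j = hsec (BG i j) z" for i j
    define X where "X i = integral R (\<lambda>p. (vG i 1 p)\<^sup>2) + integral R (\<lambda>p. (vG i 2 p)\<^sup>2)" for i
    define K where "K i j = integral R (\<lambda>p. (bG i j p)\<^sup>2)" for i j
    have cv: "continuous_on R (v i)" "continuous_on R (vG i j)" "continuous_on R (bG i j)" "continuous_on R (hsec (B j) z)" for i j
      unfolding v_def vG_def bG_def by (intro hsec_continuous cV cB z)+
    have cw: "continuous_on R (w j)" for j unfolding w_def by (intro continuous_intros cv)
    have I: "f integrable_on R" if "continuous_on R f" for f :: "_ \<Rightarrow> real"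
      using that unfolding R_def by (rule integrable_continuous)
    have X0: "0 \<le> X i" and K0: "0 \<le> K i j" for i j
      unfolding X_def K_def by (intro add_nonneg_nonneg integral_nonneg I continuous_intros cv; simp)+
    have XM: "(\<Sum>i\<in>UNIV. X i) \<le> M\<^sup>2" using sup[OF z] by (simp add: X_def vG_def R_def)
    have KZ: "(\<Sum>i\<in>UNIV. \<Sum>j\<in>UNIV. K i j) = Z z"
    proof -
      have "Z z = integral R (\<lambda>p. \<Sum>i\<in>UNIV. \<Sum>j\<in>UNIV. (bG i j p)\<^sup>2)"
        by (simp add: Z_def hsec_sum hsec_power bG_def R_def)
      also have "\<dots> = (\<Sum>i\<in>UNIV. \<Sum>j\<in>UNIV. K i j)"
        unfolding K_def by (simp add: integral_sum I cv continuous_intros)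
      finally show ?thesis by simp
    qed
    have Z0: "0 \<le> Z z" unfolding KZ[symmetric] by (intro sum_nonneg K0)
    have v1: "rect_C1 Lx Ly (v i) (vG i 1) (vG i 2)" for i
      unfolding v_def vG_def by (rule C1_field_rect_C1[OF V z])
    have w1: "rect_C1 Lx Ly (w j) (bG j 1) (bG j 2)" for j
      unfolding w_def bG_def by (intro rect_C1_diff_const C1_field_rect_C1[OF B z])
    have v0: "integral R (v i) = 0" for i unfolding v_def R_def by (rule mean[OF z])
    have w0: "integral R (w j) = 0" for j
    proof -
      have "integral R (w j) = integral R (hsec (B j) z) - integral R (\<lambda>p. b j)"
        unfolding w_def by (intro integral_diff I cv continuous_intros)
      also have "integral R (\<lambda>p. b j) = integral R (hsec (B j) z)"
        using L by (simp add: R_def b_def content_Pair)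
      finally show ?thesis by simp
    qed
    \<comment> \<open>The walls do not control the vertical component of B, so its mean has to be
      removed by the flux.\<close>
    have b3: "b 3 = 0" unfolding b_def R_def by (simp add: flux[OF z])
    have b2: "(\<Sum>j\<in>UNIV. (b j)\<^sup>2) \<le> G / (4 * s\<^sup>2)"
    proof -
      have "(b j)\<^sup>2 \<le> integral (cell Lx Ly) (\<lambda>x. (BG j 3 x)\<^sup>2) / (4 * s\<^sup>2)" for j
      proof (cases "j = 3")
        case True
        have "0 \<le> integral (cell Lx Ly) (\<lambda>x. (BG j 3 x)\<^sup>2)"
          by (intro integral_nonneg cell_integrable continuous_intros cB) auto
        then show ?thesis using True b3 by simp
      next
        case False
        show ?thesis unfolding b_def R_def s(2)
          by (rule horizontal_mean_bound[OF L B z]) (use bdry False in auto)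
      qed
      then have "(\<Sum>j\<in>UNIV. (b j)\<^sup>2) \<le> (\<Sum>j\<in>UNIV. integral (cell Lx Ly) (\<lambda>x. (BG j 3 x)\<^sup>2) / (4 * s\<^sup>2))"
        by (rule sum_mono)
      also have "\<dots> = integral (cell Lx Ly) (\<lambda>x. \<Sum>j\<in>UNIV. (BG j 3 x)\<^sup>2) / (4 * s\<^sup>2)"
        by (simp add: integral_sum cell_integrable continuous_intros cB flip: sum_divide_distrib)
      also have "integral (cell Lx Ly) (\<lambda>x. \<Sum>j\<in>UNIV. (BG j 3 x)\<^sup>2) \<le> G"
        unfolding G_def
        by (intro integral_le cell_integrable continuous_intros cB sum_mono) (rule member_le_sum; simp)
      finally show ?thesis by (simp add: divide_right_mono)
    qed
    define t1 where "t1 i j = integral R (\<lambda>p. v i p * w j p * bG i j p)" for i j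
    define t2 where "t2 i j = b j * integral R (\<lambda>p. v i p * bG i j p)" for i j
    have split: "integral R (hsec (\<lambda>x. \<Sum>i\<in>UNIV. \<Sum>j\<in>UNIV. V i x * B j x * BG i j x) z) =
      (\<Sum>i\<in>UNIV. \<Sum>j\<in>UNIV. t1 i j) + (\<Sum>i\<in>UNIV. \<Sum>j\<in>UNIV. t2 i j)"
    proof -
      have "integral R (hsec (\<lambda>x. \<Sum>i\<in>UNIV. \<Sum>j\<in>UNIV. V i x * B j x * BG i j x) z) =
        integral R (\<lambda>p. \<Sum>i\<in>UNIV. \<Sum>j\<in>UNIV. v i p * w j p * bG i j p + b j * (v i p * bG i j p))"
        by (rule integral_cong) (auto simp: hsec_sum hsec_cmult v_def w_def bG_def algebra_simps)
      also have "\<dots> = (\<Sum>i\<in>UNIV. \<Sum>j\<in>UNIV. t1 i j + t2 i j)"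
        unfolding t1_def t2_def
        by (simp add: integral_sum integral_add I cv cw continuous_intros)
      finally show ?thesis by (simp add: sum.distrib)
    qed
    have "(\<Sum>i\<in>UNIV. \<Sum>j\<in>UNIV. \<bar>t1 i j\<bar>)\<^sup>2 \<le>
      (\<Sum>i\<in>UNIV. l^4 / (12 * Lx * Ly) * X i) * (\<Sum>j\<in>UNIV. K j 1 + K j 2) * (\<Sum>i\<in>UNIV. \<Sum>j\<in>UNIV. K i j)"
    proof (rule double_sum_Cauchy_Schwarz)
      show "(t1 i j)\<^sup>2 \<le> l^4 / (12 * Lx * Ly) * X i * (K j 1 + K j 2) * K i j" for i j
        using rect_trilinear[OF L v1 w1 v0[unfolded R_def] w0[unfolded R_def] cv(3)[unfolded R_def]]
        by (simp add: t1_def X_def K_def l_def R_def)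
    qed (use L X0 K0 l in auto)
    also have "\<dots> \<le> (l^4 / (12 * Lx * Ly) * M\<^sup>2) * Z z * Z z"
      unfolding KZ sum_distrib_left[symmetric]
    proof (intro mult_right_mono mult_mono mult_left_mono XM Z0)
      have "(\<Sum>j\<in>UNIV. K j 1 + K j 2) \<le> (\<Sum>i\<in>UNIV. \<Sum>j\<in>UNIV. K i j)"
        by (intro sum_mono) (simp add: sum_3 K0)
      then show "(\<Sum>j\<in>UNIV. K j 1 + K j 2) \<le> Z z" by (simp add: KZ)
    qed (use L X0 K0 l in \<open>auto intro!: sum_nonneg mult_nonneg_nonneg\<close>)
    also have "\<dots> = (M * l\<^sup>2 / (sqrt 12 * s) * Z z)\<^sup>2"
      using s by (simp add: power_mult_distrib power_divide field_simps power2_eq_square power4_eq_xxxx)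
    finally have T1: "(\<Sum>i\<in>UNIV. \<Sum>j\<in>UNIV. \<bar>t1 i j\<bar>) \<le> M * l\<^sup>2 / (sqrt 12 * s) * Z z"
      by (rule power2_le_imp_le) (use M l s Z0 in simp)
    have "(\<Sum>i\<in>UNIV. \<Sum>j\<in>UNIV. \<bar>t2 i j\<bar>)\<^sup>2 \<le>
      (\<Sum>i\<in>UNIV. l\<^sup>2 / 12 * X i) * (\<Sum>j\<in>UNIV. (b j)\<^sup>2) * (\<Sum>i\<in>UNIV. \<Sum>j\<in>UNIV. K i j)"
    proof (rule double_sum_Cauchy_Schwarz)
      fix i j
      have "(integral R (\<lambda>p. v i p * bG i j p))\<^sup>2 \<le> integral R (\<lambda>p. (v i p)\<^sup>2) * K i j"
        unfolding K_def R_def by (rule integral_Cauchy_Schwarz) (use cv in \<open>simp_all add: R_def\<close>)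
      also have "\<dots> \<le> l\<^sup>2 / 12 * X i * K i j"
      proof (rule mult_right_mono[OF _ K0])
        have "integral R (\<lambda>p. (v i p)\<^sup>2) \<le> Lx\<^sup>2 / 12 * integral R (\<lambda>p. (vG i 1 p)\<^sup>2) + Ly\<^sup>2 / 12 * integral R (\<lambda>p. (vG i 2 p)\<^sup>2)"
          using rect_Poincare[OF L v1] v0 by (simp add: R_def)
        also have "\<dots> \<le> l\<^sup>2 / 12 * integral R (\<lambda>p. (vG i 1 p)\<^sup>2) + l\<^sup>2 / 12 * integral R (\<lambda>p. (vG i 2 p)\<^sup>2)"
          using L l by (intro add_mono mult_right_mono divide_right_mono power_mono integral_nonneg I continuous_intros cv) auto
        finally show "integral R (\<lambda>p. (v i p)\<^sup>2) \<le> l\<^sup>2 / 12 * X i" by (simp add: X_def algebra_simps)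
      qed
      finally have "(b j)\<^sup>2 * (integral R (\<lambda>p. v i p * bG i j p))\<^sup>2 \<le> (b j)\<^sup>2 * (l\<^sup>2 / 12 * X i * K i j)"
        by (rule mult_left_mono) simp
      then show "(t2 i j)\<^sup>2 \<le> l\<^sup>2 / 12 * X i * (b j)\<^sup>2 * K i j"
        by (simp add: t2_def power_mult_distrib mult_ac)
    qed (use X0 K0 in auto)
    also have "\<dots> \<le> (l\<^sup>2 / 12 * M\<^sup>2) * (G / (4 * s\<^sup>2)) * Z z"
      unfolding KZ sum_distrib_left[symmetric]
      by (intro mult_right_mono mult_mono mult_left_mono XM Z0 b2)
        (use X0 G0 in \<open>auto intro!: sum_nonneg mult_nonneg_nonneg\<close>)
    also have "\<dots> = (M * l / (sqrt 12 * (2 * s)))\<^sup>2 * (G * Z z)"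
      using s by (simp add: power_mult_distrib power_divide)
    \<comment> \<open>The square root of \<open>G * Z z\<close> is not linear in \<open>Z z\<close>;
      arithmetic and geometric means make the bound linear, so that integrating over z returns
      \<open>G\<close>.\<close>
    also have "\<dots> \<le> (M * l / (sqrt 12 * (2 * s)))\<^sup>2 * ((G + Z z) / 2)\<^sup>2"
    proof (rule mult_left_mono)
      show "G * Z z \<le> ((G + Z z) / 2)\<^sup>2"
        using sum_squares_ge_zero[of "G - Z z" 0] by (simp add: power2_eq_square field_simps)
    qed simp
    also have "\<dots> = (M * l / (sqrt 12 * (4 * s)) * (G + Z z))\<^sup>2"
      by (simp add: power_mult_distrib power_divide)
    finally have T2: "(\<Sum>i\<in>UNIV. \<Sum>j\<in>UNIV. \<bar>t2 i j\<bar>) \<le> M * l / (sqrt 12 * (4 * s)) * (G + Z z)"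
      by (rule power2_le_imp_le) (use M l s Z0 G0 in simp)
    show ?thesis
      using T1 T2 abs_double_sum_le[of t1 UNIV UNIV] abs_double_sum_le[of t2 UNIV UNIV]
      unfolding R_def[symmetric] split by linarith
  qed
  have "\<bar>integral (cell Lx Ly) (\<lambda>x. \<Sum>i\<in>UNIV. \<Sum>j\<in>UNIV. V i x * B j x * BG i j x)\<bar> \<le>
    integral {0..1} (\<lambda>z. M * l\<^sup>2 / (sqrt 12 * s) * Z z + M * l / (sqrt 12 * (4 * s)) * (G + Z z))"
    unfolding integral_cell_hsec(1)[OF cT] real_norm_def[symmetric]
    by (intro integral_norm_bound_integral integrable_continuous_real continuous_intros cZ integral_cell_hsec(2)[OF cT])
      (use slice s in simp_all)
  also have "\<dots> = M * l\<^sup>2 / (sqrt 12 * s) * G + M * l / (sqrt 12 * (4 * s)) * (G + G)"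
  proof (rule integral_unique)
    have HZ: "(Z has_integral G) {0..1}"
      unfolding GZ by (intro integrable_integral integrable_continuous_real cZ)
    show "((\<lambda>z. M * l\<^sup>2 / (sqrt 12 * s) * Z z + M * l / (sqrt 12 * (4 * s)) * (G + Z z)) has_integral
        M * l\<^sup>2 / (sqrt 12 * s) * G + M * l / (sqrt 12 * (4 * s)) * (G + G)) {0..1}"
      by (intro has_integral_add has_integral_mult_right HZ) (use has_integral_const_real[of G 0 1] in simp)
  qed
  also have "\<dots> = M * l * (l + 1 / 2) / (sqrt 12 * s) * G"
    using s by (simp add: field_simps power2_eq_square)
  finally show ?thesis by (simp add: l_def G_def s_def real_sqrt_mult)
qed

section \<open>Trigonometric fields\<close>

text \<open>
  The mode \<open>(a, \<alpha>, \<beta>, \<phi>, m, s)\<close> stands for \<open>a cos (\<alpha> x + \<beta> y + \<phi>) sin (m z + s)\<close>.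
  The phases make partial derivatives of modes syntactically modes again.
\<close>

type_synonym mode = "real \<times> real \<times> real \<times> real \<times> real \<times> real"

fun mode_fun :: "mode \<Rightarrow> real^3 \<Rightarrow> real" where
  "mode_fun (a, \<alpha>, \<beta>, \<phi>, m, s) x = a * cos (\<alpha> * x $ 1 + \<beta> * x $ 2 + \<phi>) * sin (m * x $ 3 + s)"

fun mode_d :: "3 \<Rightarrow> mode \<Rightarrow> mode" where
  "mode_d i (a, \<alpha>, \<beta>, \<phi>, m, s) =
     (if i = 1 then (a * \<alpha>, \<alpha>, \<beta>, \<phi> + pi / 2, m, s)
      else if i = 2 then (a * \<beta>, \<alpha>, \<beta>, \<phi> + pi / 2, m, s)
      else (a * m, \<alpha>, \<beta>, \<phi>, m, s + pi / 2))"

text \<open>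
  The symbols of \<open>- \<Delta>\<close> in the horizontal and the vertical variables; \<open>tr_mul g\<close> below is the Fourier
  multiplier with symbol \<open>g\<close>.
\<close>

fun hsym :: "mode \<Rightarrow> real" where "hsym (a, \<alpha>, \<beta>, \<phi>, m, s) = \<alpha>\<^sup>2 + \<beta>\<^sup>2"
fun vsym :: "mode \<Rightarrow> real" where "vsym (a, \<alpha>, \<beta>, \<phi>, m, s) = m\<^sup>2"

fun mode_scale :: "real \<Rightarrow> mode \<Rightarrow> mode" where
  "mode_scale c (a, \<alpha>, \<beta>, \<phi>, m, s) = (c * a, \<alpha>, \<beta>, \<phi>, m, s)"

text \<open>A nonzero n keeps the vertical symbol positive, which legitimates dividing by the symbol
  of the negative Laplacian; horizontal frequencies may vanish.\<close>

fun mode_ok :: "real \<Rightarrow> real \<Rightarrow> mode \<Rightarrow> bool" where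
  "mode_ok Lx Ly (a, \<alpha>, \<beta>, \<phi>, m, s) \<longleftrightarrow>
     (\<exists>j::int. \<alpha> * Lx = 2 * pi * j) \<and> (\<exists>j::int. \<beta> * Ly = 2 * pi * j) \<and> (\<exists>n::int. n \<noteq> 0 \<and> m = pi * n)"

text \<open>The z-factor is then sin (m z) up to sign, and together with \<open>mode_ok\<close> it
  vanishes on both walls. A z-derivative leaves the class, a second one returns to it.\<close>

fun mode_odd :: "mode \<Rightarrow> bool" where "mode_odd (a, \<alpha>, \<beta>, \<phi>, m, s) \<longleftrightarrow> sin s = 0"

text \<open>Lists of modes let derivatives and multipliers act entry by entry, so that many
  identities are equalities of lists and not merely of functions. Frequencies may repeat.\<close>

definition trig :: "mode list \<Rightarrow> real^3 \<Rightarrow> real" where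
  "trig l x = (\<Sum>q\<leftarrow>l. mode_fun q x)"

definition tr_ok :: "real \<Rightarrow> real \<Rightarrow> mode list \<Rightarrow> bool" where
  "tr_ok Lx Ly l \<longleftrightarrow> (\<forall>q\<in>set l. mode_ok Lx Ly q)"

definition tr_odd :: "mode list \<Rightarrow> bool" where
  "tr_odd l \<longleftrightarrow> (\<forall>q\<in>set l. mode_odd q)"

definition tr_d :: "3 \<Rightarrow> mode list \<Rightarrow> mode list" where
  "tr_d i = map (mode_d i)"

definition tr_mul :: "(real \<Rightarrow> real \<Rightarrow> real) \<Rightarrow> mode list \<Rightarrow> mode list" where
  "tr_mul g = map (\<lambda>q. mode_scale (g (hsym q) (vsym q)) q)"

lemma mode_scale_simps [simp]:
  "mode_fun (mode_scale c q) x = c * mode_fun q x"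
  "hsym (mode_scale c q) = hsym q" "vsym (mode_scale c q) = vsym q"
  "mode_ok Lx Ly (mode_scale c q) = mode_ok Lx Ly q" "mode_odd (mode_scale c q) = mode_odd q"
  "mode_scale c (mode_scale d q) = mode_scale (c * d) q"
  "mode_d i (mode_scale c q) = mode_scale c (mode_d i q)"
  by (cases q; simp)+

lemma mode_d_simps [simp]:
  "hsym (mode_d i q) = hsym q" "vsym (mode_d i q) = vsym q"
  "mode_ok Lx Ly (mode_d i q) = mode_ok Lx Ly q"
  "i \<noteq> 3 \<Longrightarrow> mode_odd (mode_d i q) = mode_odd q"
  by (cases q; use exhaust_3[of i] in auto)+

lemma mode_d_commute: "mode_d i (mode_d j q) = mode_d j (mode_d i q)"
  by (cases q) auto

lemma mode_d_square:
  "mode_fun (mode_d 1 (mode_d 1 q)) x + mode_fun (mode_d 2 (mode_d 2 q)) x = - hsym q * mode_fun q x"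
  "mode_fun (mode_d 3 (mode_d 3 q)) x = - vsym q * mode_fun q x"
proof -
  obtain a \<alpha> \<beta> \<phi> m s where q: "q = (a, \<alpha>, \<beta>, \<phi>, m, s)" by (cases q) auto
  have c: "cos (y + (\<phi> + pi / 2 + pi / 2)) = - cos (y + \<phi>)" for y
    using cos_periodic_pi[of "y + \<phi>"] by (simp add: algebra_simps)
  have s: "sin (y + (s + pi / 2 + pi / 2)) = - sin (y + s)" for y
    using sin_periodic_pi[of "y + s"] by (simp add: algebra_simps)
  show "mode_fun (mode_d 1 (mode_d 1 q)) x + mode_fun (mode_d 2 (mode_d 2 q)) x = - hsym q * mode_fun q x"
    using c[of "\<alpha> * x $ 1 + \<beta> * x $ 2"] by (simp add: q power2_eq_square algebra_simps)
  show "mode_fun (mode_d 3 (mode_d 3 q)) x = - vsym q * mode_fun q x"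
    using s[of "m * x $ 3"] by (simp add: q power2_eq_square algebra_simps)
qed

lemma hsym_nonneg [simp]: "0 \<le> hsym q" and vsym_nonneg [simp]: "0 \<le> vsym q"
  by (cases q; simp)+

lemma vsym_pos: "mode_ok Lx Ly q \<Longrightarrow> 0 < vsym q"
  by (cases q) auto

lemma trig_simps [simp]:
  "trig [] x = 0" "trig (q # l) x = mode_fun q x + trig l x" "trig (l @ l') x = trig l x + trig l' x"
  by (simp_all add: trig_def)

lemma tr_d_simps [simp]: "tr_d i [] = []" "tr_d i (q # l) = mode_d i q # tr_d i l" "tr_d i (l @ l') = tr_d i l @ tr_d i l'"
  by (simp_all add: tr_d_def)

lemma tr_mul_simps [simp]:
  "tr_mul g [] = []" "tr_mul g (q # l) = mode_scale (g (hsym q) (vsym q)) q # tr_mul g l"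
  "tr_mul g (l @ l') = tr_mul g l @ tr_mul g l'"
  by (simp_all add: tr_mul_def)

lemma tr_ok_simps [simp]:
  "tr_ok Lx Ly []" "tr_ok Lx Ly (q # l) \<longleftrightarrow> mode_ok Lx Ly q \<and> tr_ok Lx Ly l"
  "tr_ok Lx Ly (l @ l') \<longleftrightarrow> tr_ok Lx Ly l \<and> tr_ok Lx Ly l'"
  "tr_ok Lx Ly (tr_d i l) = tr_ok Lx Ly l" "tr_ok Lx Ly (tr_mul g l) = tr_ok Lx Ly l"
  by (auto simp: tr_ok_def tr_d_def tr_mul_def)

lemma tr_odd_simps [simp]:
  "tr_odd []" "tr_odd (q # l) \<longleftrightarrow> mode_odd q \<and> tr_odd l" "tr_odd (l @ l') \<longleftrightarrow> tr_odd l \<and> tr_odd l'"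
  "tr_odd (tr_mul g l) = tr_odd l" "i \<noteq> 3 \<Longrightarrow> tr_odd (tr_d i l) = tr_odd l"
  by (auto simp: tr_odd_def tr_d_def tr_mul_def)

lemma tr_d_commute: "tr_d i (tr_d j l) = tr_d j (tr_d i l)"
  by (simp add: tr_d_def mode_d_commute)

lemma tr_d_mul: "tr_d i (tr_mul g l) = tr_mul g (tr_d i l)"
  by (simp add: tr_d_def tr_mul_def)

lemma tr_mul_mul: "tr_mul g (tr_mul h l) = tr_mul (\<lambda>A C. g A C * h A C) l"
  by (simp add: tr_mul_def)

text \<open>Agreement is asked only where admissible modes have their symbols, which keeps zero
  denominators out of the calculations.\<close>

lemma tr_mul_cong:
  assumes "tr_ok Lx Ly l" "\<And>A C. 0 \<le> A \<Longrightarrow> 0 < C \<Longrightarrow> g A C = h A C"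
  shows "tr_mul g l = tr_mul h l"
  unfolding tr_mul_def
proof (rule map_cong[OF refl])
  fix q assume "q \<in> set l"
  then have "mode_ok Lx Ly q" using assms(1) by (simp add: tr_ok_def)
  then have "0 < vsym q" by (rule vsym_pos)
  then show "mode_scale (g (hsym q) (vsym q)) q = mode_scale (h (hsym q) (vsym q)) q"
    by (simp add: assms(2))
qed

lemma trig_mul_linear:
  "trig (tr_mul (\<lambda>A C. g A C + h A C) l) x = trig (tr_mul g l) x + trig (tr_mul h l) x"
  "trig (tr_mul (\<lambda>A C. c * g A C) l) x = c * trig (tr_mul g l) x"
  "trig (tr_mul (\<lambda>A C. c) l) x = c * trig l x"
  by (induction l) (auto simp: algebra_simps)

lemma trig_laplacian:
  "trig (tr_d 1 (tr_d 1 l)) x + trig (tr_d 2 (tr_d 2 l)) x = - trig (tr_mul (\<lambda>A C. A) l) x"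
  "trig (tr_d 3 (tr_d 3 l)) x = - trig (tr_mul (\<lambda>A C. C) l) x"
proof (induction l)
  case (Cons q l)
  { case 1 then show ?case using Cons.IH(1) mode_d_square(1)[of q x] by (simp del: mode_d.simps) }
  { case 2 then show ?case using Cons.IH(2) mode_d_square(2)[of q x] by (simp del: mode_d.simps) }
qed simp_all

lemma trig_odd_bdry:
  assumes "tr_ok Lx Ly l" "tr_odd l" "x $ 3 = 0 \<or> x $ 3 = 1"
  shows "trig l x = 0"
proof -
  have "mode_fun q x = 0" if q: "mode_ok Lx Ly q" "mode_odd q" for q
  proof -
    obtain a \<alpha> \<beta> \<phi> m s where qq: "q = (a, \<alpha>, \<beta>, \<phi>, m, s)" by (cases q) auto
    obtain n :: int where "m = pi * n" using q(1) by (auto simp: qq)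
    then have "sin (m * x $ 3) = 0" using assms(3) by (auto simp: sin_zero_iff_int2 mult.commute)
    then show ?thesis using q(2) by (simp add: qq sin_add)
  qed
  then show ?thesis using assms(1,2) by (induction l) auto
qed

lemma mode_C1_field:
  assumes "mode_ok Lx Ly q"
  shows "C1_field Lx Ly (mode_fun q) (\<lambda>i. mode_fun (mode_d i q))"
proof -
  obtain a \<alpha> \<beta> \<phi> m s where q: "q = (a, \<alpha>, \<beta>, \<phi>, m, s)" by (cases q) auto
  obtain j k :: int where jk: "\<alpha> * Lx = 2 * pi * j" "\<beta> * Ly = 2 * pi * k" using assms by (auto simp: q)
  have per: "cos (y + 2 * pi * of_int j) = cos y" for y j
    using cos_integer_2pi[of j] sin_integer_2pi[of j] by (simp add: cos_add)
  show ?thesis unfolding C1_field_def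
  proof (intro conjI allI ballI)
    show "periodic_xy Lx Ly (mode_fun q)"
      unfolding periodic_xy_def
    proof (intro ballI conjI)
      fix x :: "real^3"
      have "\<alpha> * (x $ 1 + Lx) + \<beta> * x $ 2 + \<phi> = (\<alpha> * x $ 1 + \<beta> * x $ 2 + \<phi>) + 2 * pi * of_int j"
        using jk by (simp add: algebra_simps)
      then have "cos (\<alpha> * (x $ 1 + Lx) + \<beta> * x $ 2 + \<phi>) = cos (\<alpha> * x $ 1 + \<beta> * x $ 2 + \<phi>)"
        by (simp only: per)
      then show "mode_fun q (x + Lx *\<^sub>R axis 1 1) = mode_fun q x"
        by (simp add: q axis_def)
      have "\<alpha> * x $ 1 + \<beta> * (x $ 2 + Ly) + \<phi> = (\<alpha> * x $ 1 + \<beta> * x $ 2 + \<phi>) + 2 * pi * of_int k"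
        using jk by (simp add: algebra_simps)
      then have "cos (\<alpha> * x $ 1 + \<beta> * (x $ 2 + Ly) + \<phi>) = cos (\<alpha> * x $ 1 + \<beta> * x $ 2 + \<phi>)"
        by (simp only: per)
      then show "mode_fun q (x + Ly *\<^sub>R axis 2 1) = mode_fun q x"
        by (simp add: q axis_def)
    qed
    show "continuous_on slab (mode_fun (mode_d i q))" for i
      by (auto simp: q intro!: continuous_intros)
    fix x :: "real^3"
    show "(mode_fun q has_derivative (\<lambda>h. \<Sum>i\<in>UNIV. mode_fun (mode_d i q) x * h $ i)) (at x within slab)"
    proof -
      have d: "((\<lambda>x::real^3. x $ i) has_derivative (\<lambda>h. h $ i)) (at x within slab)" for i
        by (rule bounded_linear_imp_has_derivative[OF bounded_linear_vec_nth])
      have c: "cos (y + (\<phi> + pi / 2)) = - sin (y + \<phi>)" and s: "sin (y + (s + pi / 2)) = cos (y + s)" for y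
        using cos_add[of "y + \<phi>" "pi / 2"] sin_add[of "y + s" "pi / 2"] by (simp_all add: add.assoc)
      show ?thesis unfolding q mode_fun.simps[abs_def]
        by (rule has_derivative_eq_rhs, (rule derivative_intros d)+) (simp add: sum_3 c s, simp add: fun_eq_iff algebra_simps)
    qed
  qed
qed

lemma trig_C1_field: "tr_ok Lx Ly l \<Longrightarrow> C1_field Lx Ly (trig l) (\<lambda>i. trig (tr_d i l))"
proof (induction l)
  case Nil
  show ?case by (auto simp: C1_field_def periodic_xy_def)
next
  case (Cons q l)
  then have "C1_field Lx Ly (\<lambda>x. mode_fun q x + trig l x) (\<lambda>i x. mode_fun (mode_d i q) x + trig (tr_d i l) x)"
    by (intro C1_field_add mode_C1_field) auto
  then show ?case by (rule C1_field_cong) auto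
qed

section \<open>Inner products of trigonometric fields and calculus of multipliers\<close>

definition tr_ip :: "real \<Rightarrow> real \<Rightarrow> mode list \<Rightarrow> mode list \<Rightarrow> real" where
  "tr_ip Lx Ly l l' = integral (cell Lx Ly) (\<lambda>x. trig l x * trig l' x)"

lemma trig_continuous: "tr_ok Lx Ly l \<Longrightarrow> continuous_on slab (trig l)"
  by (rule C1_field_continuous(1)[OF trig_C1_field])

lemma tr_ip_commute: "tr_ip Lx Ly l l' = tr_ip Lx Ly l' l"
  by (simp add: tr_ip_def mult.commute)

lemma tr_ip_nil [simp]: "tr_ip Lx Ly [] l = 0" "tr_ip Lx Ly l [] = 0"
  by (simp_all add: tr_ip_def)

lemma tr_ip_append:
  assumes "tr_ok Lx Ly l1" "tr_ok Lx Ly l2" "tr_ok Lx Ly l"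
  shows "tr_ip Lx Ly (l1 @ l2) l = tr_ip Lx Ly l1 l + tr_ip Lx Ly l2 l"
    and "tr_ip Lx Ly l (l1 @ l2) = tr_ip Lx Ly l l1 + tr_ip Lx Ly l l2"
proof -
  show "tr_ip Lx Ly (l1 @ l2) l = tr_ip Lx Ly l1 l + tr_ip Lx Ly l2 l"
    using assms by (simp add: tr_ip_def distrib_right integral_add cell_integrable continuous_intros trig_continuous)
  then show "tr_ip Lx Ly l (l1 @ l2) = tr_ip Lx Ly l l1 + tr_ip Lx Ly l l2"
    by (simp only: tr_ip_commute[of Lx Ly l])
qed

lemma tr_ip_mul_linear:
  assumes "tr_ok Lx Ly l" "tr_ok Lx Ly l'"
  shows "tr_ip Lx Ly (tr_mul (\<lambda>A C. g A C + h A C) l) l' = tr_ip Lx Ly (tr_mul g l) l' + tr_ip Lx Ly (tr_mul h l) l'"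
    and "tr_ip Lx Ly (tr_mul (\<lambda>A C. c * g A C) l) l' = c * tr_ip Lx Ly (tr_mul g l) l'"
  using assms by (simp_all add: tr_ip_def trig_mul_linear distrib_right integral_add cell_integrable
    continuous_intros trig_continuous mult.assoc)

lemma tr_ip_by_parts:
  assumes L: "0 < Lx" "0 < Ly" and ok: "tr_ok Lx Ly l" "tr_ok Lx Ly l'"
    and odd: "i \<noteq> 3 \<or> tr_odd l \<or> tr_odd l'"
  shows "tr_ip Lx Ly l (tr_d i l') = - tr_ip Lx Ly (tr_d i l) l'"
  unfolding tr_ip_def
  by (rule integral_by_parts_cell[OF L trig_C1_field[OF ok(1)] trig_C1_field[OF ok(2)]])
    (use odd trig_odd_bdry ok in auto)

lemma tr_ip_horizontal_gradient:
  assumes L: "0 < Lx" "0 < Ly" and ok: "tr_ok Lx Ly l" "tr_ok Lx Ly l'"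
  shows "tr_ip Lx Ly (tr_d 1 l) (tr_d 1 l') + tr_ip Lx Ly (tr_d 2 l) (tr_d 2 l') = tr_ip Lx Ly (tr_mul (\<lambda>A C. A) l) l'"
proof -
  have "tr_ip Lx Ly (tr_d 1 l) (tr_d 1 l') + tr_ip Lx Ly (tr_d 2 l) (tr_d 2 l') =
      - (tr_ip Lx Ly (tr_d 1 (tr_d 1 l)) l' + tr_ip Lx Ly (tr_d 2 (tr_d 2 l)) l')"
    using ok by (simp add: tr_ip_by_parts[OF L])
  also have "\<dots> = - integral (cell Lx Ly) (\<lambda>x. (trig (tr_d 1 (tr_d 1 l)) x + trig (tr_d 2 (tr_d 2 l)) x) * trig l' x)"
    using ok by (simp add: tr_ip_def distrib_right integral_add cell_integrable continuous_intros trig_continuous)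
  finally show ?thesis by (simp add: trig_laplacian tr_ip_def)
qed

lemma tr_ip_vertical_gradient:
  assumes L: "0 < Lx" "0 < Ly" and ok: "tr_ok Lx Ly l" "tr_ok Lx Ly l'" "tr_odd l'"
  shows "tr_ip Lx Ly (tr_d 3 l) (tr_d 3 l') = tr_ip Lx Ly (tr_mul (\<lambda>A C. C) l) l'"
proof -
  have "tr_ip Lx Ly (tr_d 3 l) (tr_d 3 l') = - tr_ip Lx Ly (tr_d 3 (tr_d 3 l)) l'"
    using ok by (simp add: tr_ip_by_parts[OF L])
  then show ?thesis by (simp add: trig_laplacian tr_ip_def)
qed

lemma tr_ip_single:
  "tr_ip Lx Ly [mode_scale c q] [mode_scale d q'] = c * d * tr_ip Lx Ly [q] [q']"
proof -
  have "(\<lambda>x. trig [mode_scale c q] x * trig [mode_scale d q'] x) = (\<lambda>x. (c * d) * (trig [q] x * trig [q'] x))"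
    by (simp add: fun_eq_iff)
  then show ?thesis by (simp only: tr_ip_def integral_mult_right)
qed

text \<open>
  Since both parts of the Laplacian are symmetric, modes with different symbols are orthogonal;
  hence multipliers obey a functional calculus.
\<close>

lemma tr_ip_mul:
  assumes L: "0 < Lx" "0 < Ly" and ok: "tr_ok Lx Ly l" "tr_ok Lx Ly l'" and odd: "tr_odd l" "tr_odd l'"
  shows "tr_ip Lx Ly (tr_mul g l) (tr_mul h l') = tr_ip Lx Ly (tr_mul (\<lambda>A C. g A C * h A C) l) l'"
proof -
  have id: "mode_scale 1 q = q" for q by (cases q) simp
  have single: "tr_ip Lx Ly (tr_mul g [q]) (tr_mul h [q']) = tr_ip Lx Ly (tr_mul (\<lambda>A C. g A C * h A C) [q]) [q']"
    if q: "mode_ok Lx Ly q" "mode_odd q" "mode_ok Lx Ly q'" "mode_odd q'" for q q'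
  proof (cases "tr_ip Lx Ly [q] [q'] = 0")
    case True
    then show ?thesis
      using tr_ip_single[of Lx Ly "g (hsym q) (vsym q)" q "h (hsym q') (vsym q')" q']
        tr_ip_single[of Lx Ly "g (hsym q) (vsym q) * h (hsym q) (vsym q)" q 1 q']
      by (simp add: id)
  next
    case False
    have "tr_ip Lx Ly (tr_mul (\<lambda>A C. A) [q]) [q'] = tr_ip Lx Ly [q] (tr_mul (\<lambda>A C. A) [q'])"
      using tr_ip_horizontal_gradient[OF L, of "[q]" "[q']"] tr_ip_horizontal_gradient[OF L, of "[q']" "[q]"] q
      by (simp add: tr_ip_commute)
    then have A: "hsym q = hsym q'"
      using False tr_ip_single[of Lx Ly "hsym q" q 1 q'] tr_ip_single[of Lx Ly 1 q "hsym q'" q'] by (simp add: id)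
    have "tr_ip Lx Ly (tr_mul (\<lambda>A C. C) [q]) [q'] = tr_ip Lx Ly [q] (tr_mul (\<lambda>A C. C) [q'])"
      using tr_ip_vertical_gradient[OF L, of "[q]" "[q']"] tr_ip_vertical_gradient[OF L, of "[q']" "[q]"] q
      by (simp add: tr_ip_commute)
    then have C: "vsym q = vsym q'"
      using False tr_ip_single[of Lx Ly "vsym q" q 1 q'] tr_ip_single[of Lx Ly 1 q "vsym q'" q'] by (simp add: id)
    show ?thesis
      using tr_ip_single[of Lx Ly "g (hsym q) (vsym q)" q "h (hsym q') (vsym q')" q']
        tr_ip_single[of Lx Ly "g (hsym q) (vsym q) * h (hsym q) (vsym q)" q 1 q']
      by (simp add: A C id)
  qed
  have row: "tr_ip Lx Ly (tr_mul g [q]) (tr_mul h l') = tr_ip Lx Ly (tr_mul (\<lambda>A C. g A C * h A C) [q]) l'"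
    if q: "mode_ok Lx Ly q" "mode_odd q" and l': "tr_ok Lx Ly l'" "tr_odd l'" for q l'
    using l'
  proof (induction l')
    case (Cons p l')
    have "tr_ip Lx Ly (tr_mul g [q]) (tr_mul h ([p] @ l')) = tr_ip Lx Ly (tr_mul (\<lambda>A C. g A C * h A C) [q]) ([p] @ l')"
      unfolding tr_mul_simps(3)[of h]
      using Cons q single[of q p] by (subst (1 2) tr_ip_append(2)) auto
    then show ?case by simp
  qed simp
  show ?thesis using ok(1) odd(1)
  proof (induction l)
    case (Cons q l)
    have "tr_ip Lx Ly (tr_mul g ([q] @ l)) (tr_mul h l') = tr_ip Lx Ly (tr_mul (\<lambda>A C. g A C * h A C) ([q] @ l)) l'"
      unfolding tr_mul_simps(3)
      using Cons ok odd row[of q l'] by (subst (1 2) tr_ip_append(1)) auto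
    then show ?case by simp
  qed simp
qed

text \<open>A nonnegative difference of symbols is the square of a symbol, so the difference of the
  two sides is a squared norm.\<close>

lemma tr_ip_mul_mono:
  assumes L: "0 < Lx" "0 < Ly" and l: "tr_ok Lx Ly l" "tr_odd l"
    and le: "\<And>A C. 0 \<le> A \<Longrightarrow> 0 < C \<Longrightarrow> g A C \<le> h A C"
  shows "tr_ip Lx Ly (tr_mul g l) l \<le> tr_ip Lx Ly (tr_mul h l) l"
proof -
  let ?r = "\<lambda>A C. sqrt (h A C - g A C)"
  have "0 \<le> tr_ip Lx Ly (tr_mul ?r l) (tr_mul ?r l)"
    unfolding tr_ip_def using l
    by (intro integral_nonneg cell_integrable continuous_intros trig_continuous) auto
  also have "\<dots> = tr_ip Lx Ly (tr_mul (\<lambda>A C. ?r A C * ?r A C) l) l"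
    by (rule tr_ip_mul[OF L l(1) l(1) l(2) l(2)])
  also have "tr_mul (\<lambda>A C. ?r A C * ?r A C) l = tr_mul (\<lambda>A C. h A C + (- 1) * g A C) l"
    by (rule tr_mul_cong[OF l(1)]) (simp add: le)
  also have "tr_ip Lx Ly \<dots> l = tr_ip Lx Ly (tr_mul h l) l + (- 1) * tr_ip Lx Ly (tr_mul g l) l"
    using l by (simp only: tr_ip_mul_linear)
  finally show ?thesis by simp
qed

lemma tr_ip_mul_self:
  assumes L: "0 < Lx" "0 < Ly" and l: "tr_ok Lx Ly l" "tr_odd l"
  shows "tr_ip Lx Ly (tr_mul g l) (tr_mul g l) = tr_ip Lx Ly (tr_mul (\<lambda>A C. (g A C)\<^sup>2) l) l"
  by (simp add: tr_ip_mul[OF L l(1) l(1) l(2) l(2)] power2_eq_square)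

section \<open>The rotating Stokes problem\<close>

text \<open>
  Horizontally, \<open>w\<close> is the sum of a stream-function part \<open>a\<close> and a potential part \<open>b\<close>; these are
  orthogonal.
\<close>

lemma tr_ip_helmholtz:
  assumes L: "0 < Lx" "0 < Ly" and ok: "tr_ok Lx Ly a" "tr_ok Lx Ly b" and odd: "tr_odd a" "tr_odd b"
  defines "w1 \<equiv> tr_d 2 a @ tr_d 1 b" and "w2 \<equiv> tr_d 1 (tr_mul (\<lambda>A C. - 1) a) @ tr_d 2 b"
  shows "tr_ip Lx Ly (tr_mul g w1) w1 + tr_ip Lx Ly (tr_mul g w2) w2 =
    tr_ip Lx Ly (tr_mul (\<lambda>A C. A * g A C) a) a + tr_ip Lx Ly (tr_mul (\<lambda>A C. A * g A C) b) b"
proof -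
  define ga gb where "ga = tr_mul g a" and "gb = tr_mul g b"
  have ok': "tr_ok Lx Ly ga" "tr_ok Lx Ly gb" using ok by (simp_all add: ga_def gb_def)
  have neg: "tr_ip Lx Ly (tr_mul g (tr_mul (\<lambda>A C. - 1) l)) l' = - tr_ip Lx Ly (tr_mul g l) l'"
    "tr_ip Lx Ly l' (tr_mul (\<lambda>A C. - 1) l) = - tr_ip Lx Ly l' l" for l l' g
  proof -
    have "tr_mul g (tr_mul (\<lambda>A C. - 1) l) = tr_mul (\<lambda>A C. - 1) (tr_mul g l)" by (simp add: tr_mul_mul)
    then show "tr_ip Lx Ly (tr_mul g (tr_mul (\<lambda>A C. - 1) l)) l' = - tr_ip Lx Ly (tr_mul g l) l'"
      by (simp add: tr_ip_def trig_mul_linear)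
    show "tr_ip Lx Ly l' (tr_mul (\<lambda>A C. - 1) l) = - tr_ip Lx Ly l' l"
      by (simp add: tr_ip_def trig_mul_linear)
  qed
  \<comment> \<open>Two integrations by parts exchange the horizontal directions in the mixed
    products of \<open>a\<close> and \<open>b\<close>, so those from \<open>w1\<close> cancel those
    from \<open>w2\<close>.\<close>
  have cross: "tr_ip Lx Ly (tr_d 2 l) (tr_d 1 l') = tr_ip Lx Ly (tr_d 1 l) (tr_d 2 l')"
    if "tr_ok Lx Ly l" "tr_ok Lx Ly l'" for l l'
  proof -
    have "tr_ip Lx Ly (tr_d 2 l) (tr_d 1 l') = - tr_ip Lx Ly (tr_d 1 (tr_d 2 l)) l'"
      using that by (simp add: tr_ip_by_parts[OF L])
    also have "\<dots> = tr_ip Lx Ly (tr_d 1 l) (tr_d 2 l')"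
      using that by (simp add: tr_ip_by_parts[OF L] tr_d_commute[of 1 2])
    finally show ?thesis .
  qed
  have A: "tr_ip Lx Ly (tr_mul (\<lambda>A C. A * g A C) l) l =
      tr_ip Lx Ly (tr_d 1 (tr_mul g l)) (tr_d 1 l) + tr_ip Lx Ly (tr_d 2 (tr_mul g l)) (tr_d 2 l)" if "tr_ok Lx Ly l" for l
    using that by (simp add: tr_ip_horizontal_gradient[OF L] tr_mul_mul)
  have w1: "tr_ip Lx Ly (tr_mul g w1) w1 =
     tr_ip Lx Ly (tr_d 2 ga) (tr_d 2 a) + tr_ip Lx Ly (tr_d 2 ga) (tr_d 1 b) +
     tr_ip Lx Ly (tr_d 1 gb) (tr_d 2 a) + tr_ip Lx Ly (tr_d 1 gb) (tr_d 1 b)"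
    using ok ok' by (simp add: w1_def ga_def gb_def tr_ip_append flip: tr_d_mul)
  have w2: "tr_ip Lx Ly (tr_mul g w2) w2 =
     tr_ip Lx Ly (tr_d 1 ga) (tr_d 1 a) - tr_ip Lx Ly (tr_d 1 ga) (tr_d 2 b) -
     tr_ip Lx Ly (tr_d 2 gb) (tr_d 1 a) + tr_ip Lx Ly (tr_d 2 gb) (tr_d 2 b)"
    using ok ok' by (simp add: w2_def ga_def gb_def tr_ip_append tr_d_mul neg)
  show ?thesis unfolding w1 w2 A[OF ok(1)] A[OF ok(2)] ga_def[symmetric] gb_def[symmetric]
    using cross[of ga b] cross[of gb a] ok ok' by simp
qed

text \<open>The solution is generated by a single potential \<open>\<sigma>\<close> with \<open>(- \<partial>\<^sub>z\<^sup>2 - Ek\<^sup>2 \<Delta>\<^sup>3) \<sigma> = Ra \<theta>\<close>.\<close>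

lemma rotating_stokes_solution:
  fixes Ra Ek :: real
  assumes L: "0 < Lx" "0 < Ly" and Ek: "0 < Ek" and q: "tr_ok Lx Ly q" "tr_odd q"
  obtains v :: "3 \<Rightarrow> mode list" and p \<theta> :: "mode list" where
    "\<And>i. tr_ok Lx Ly (v i)" "tr_ok Lx Ly p" "tr_ok Lx Ly \<theta>" "tr_odd \<theta>" "tr_odd (v 3)"
    "\<And>i x. i \<noteq> 3 \<Longrightarrow> x $ 3 = 0 \<or> x $ 3 = 1 \<Longrightarrow> trig (tr_d 3 (v i)) x = 0"
    "\<And>x. (\<Sum>i\<in>UNIV. trig (tr_d i (tr_d i \<theta>)) x) = trig q x"
    "\<And>x. (\<Sum>i\<in>UNIV. trig (tr_d i (v i)) x) = 0"
    "\<And>x. cross3 e_z (\<chi> i. trig (v i) x) + (\<chi> i. trig (tr_d i p) x) -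
        Ek *\<^sub>R (\<chi> i. \<Sum>j\<in>UNIV. trig (tr_d j (tr_d j (v i))) x) = (Ra * trig \<theta> x) *\<^sub>R e_z"
    "\<And>i z. z \<in> {0..1} \<Longrightarrow> integral (rect Lx Ly) (hsec (trig (v i)) z) = 0"
    "\<And>z. z \<in> {0..1} \<Longrightarrow>
      (\<Sum>i\<in>UNIV. integral (rect Lx Ly) (\<lambda>y. (hsec (trig (tr_d 1 (v i))) z y)\<^sup>2) +
        integral (rect Lx Ly) (\<lambda>y. (hsec (trig (tr_d 2 (v i))) z y)\<^sup>2)) \<le> Ra\<^sup>2 / 3 * tr_ip Lx Ly q q"
proof -
  \<comment> \<open>\<open>A + C\<close> is the symbol of the negative Laplacian: this factor
    recovers the temperature \<open>\<theta>\<close> from its Laplacian \<open>q\<close>, and the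
    other one inverts the operator acting on \<open>\<sigma>\<close>.\<close>
  define \<sigma> where "\<sigma> = tr_mul (\<lambda>A C. - Ra / ((A + C) * (C + Ek\<^sup>2 * (A + C)^3))) q"
  \<comment> \<open>Up to a z-derivative, \<open>\<sigma>\<close> and \<open>\<tau>\<close> are
    stream function and potential of the horizontal velocity. With this \<open>\<tau>\<close> the
    rotational parts of Coriolis and viscous force cancel, and a pure gradient is left for the
    pressure to balance.\<close>
  define \<tau> where "\<tau> = tr_mul (\<lambda>A C. Ek * (A + C)) \<sigma>"
  define w1 w2 where "w1 = tr_d 2 \<sigma> @ tr_d 1 \<tau>" and "w2 = tr_d 1 (tr_mul (\<lambda>A C. - 1) \<sigma>) @ tr_d 2 \<tau>"
  \<comment> \<open>Dictated by incompressibility: minus the horizontal Laplacian of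
    \<open>\<tau>\<close>.\<close>
  define v3 where "v3 = tr_mul (\<lambda>A C. Ek * A * (A + C)) \<sigma>"
  define v :: "3 \<Rightarrow> mode list" where "v i = (if i = 1 then tr_d 3 w1 else if i = 2 then tr_d 3 w2 else v3)" for i
  \<comment> \<open>Balances both horizontal momentum equations; the vertical one then becomes the
    equation for \<open>\<sigma>\<close>.\<close>
  define p where "p = tr_d 3 (tr_mul (\<lambda>A C. - 1 - Ek\<^sup>2 * (A + C)\<^sup>2) \<sigma>)"
  define \<theta> where "\<theta> = tr_mul (\<lambda>A C. - 1 / (A + C)) q"
  have v_simps [simp]: "v 1 = tr_d 3 w1" "v 2 = tr_d 3 w2" "v 3 = v3" by (simp_all add: v_def)
  have \<sigma>: "tr_ok Lx Ly \<sigma>" "tr_odd \<sigma>" using q by (simp_all add: \<sigma>_def)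
  have \<tau>: "tr_ok Lx Ly \<tau>" "tr_odd \<tau>" using \<sigma> by (simp_all add: \<tau>_def)
  have w: "tr_ok Lx Ly w1" "tr_odd w1" "tr_ok Lx Ly w2" "tr_odd w2" using \<sigma> \<tau> by (simp_all add: w1_def w2_def)
  have v3: "tr_ok Lx Ly v3" "tr_odd v3" using \<sigma> by (simp_all add: v3_def)
  have v_ok: "tr_ok Lx Ly (v i)" for i using w v3 by (simp add: v_def)
  have lap: "(\<Sum>j\<in>UNIV. trig (tr_d j (tr_d j l)) x) = - trig (tr_mul (\<lambda>A C. A + C) l) x" for l x
    using trig_laplacian[of l x] by (simp add: sum_3 trig_mul_linear)
  have den: "C + Ek\<^sup>2 * (A + C)^3 \<noteq> 0" "A + C \<noteq> 0" if "0 \<le> A" "0 < C" for A C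
    using that Ek by (auto simp: add_nonneg_eq_0_iff)
  have q\<sigma>: "tr_mul (\<lambda>A C. (A + C) * (C + Ek\<^sup>2 * (A + C)^3)) \<sigma> = tr_mul (\<lambda>A C. - Ra) q"
    unfolding \<sigma>_def tr_mul_mul by (rule tr_mul_cong[OF q(1)]) (use den in \<open>simp add: divide_simps\<close>)
  have \<theta>\<sigma>: "tr_mul (\<lambda>A C. C + Ek\<^sup>2 * (A + C)^3) \<sigma> = tr_mul (\<lambda>A C. Ra) \<theta>"
    unfolding \<sigma>_def \<theta>_def tr_mul_mul by (rule tr_mul_cong[OF q(1)]) (use den in \<open>simp add: divide_simps\<close>)
  have d3d3: "trig (tr_d 3 (tr_d 3 l)) x = - trig (tr_mul (\<lambda>A C. C) l) x" for l x by (rule trig_laplacian)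
  \<comment> \<open>The horizontal velocity is a z-derivative of an odd field, so its own
    z-derivative is odd again and the stress-free condition is built in.\<close>
  have bdry: "trig (tr_d 3 (v i)) x = 0" if "i \<noteq> 3" "x $ 3 = 0 \<or> x $ 3 = 1" for i x
    using that exhaust_3[of i] trig_odd_bdry[OF _ _ that(2), of Lx Ly] w by (auto simp: d3d3)
  have lap\<theta>: "(\<Sum>i\<in>UNIV. trig (tr_d i (tr_d i \<theta>)) x) = trig q x" for x
  proof -
    have "tr_mul (\<lambda>A C. A + C) \<theta> = tr_mul (\<lambda>A C. - 1) q"
      unfolding \<theta>_def tr_mul_mul by (rule tr_mul_cong[OF q(1)]) (use den in simp)
    then show ?thesis by (simp add: lap trig_mul_linear)
  qed
  have T: "trig (tr_mul (\<lambda>A C. Ek * A * (A + C)) l) x = Ek * trig (tr_mul (\<lambda>A C. A * (A + C)) l) x" for l x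
    using trig_mul_linear(2)[of Ek "\<lambda>A C. A * (A + C)" l x] by (simp add: mult.assoc)
  have div: "(\<Sum>i\<in>UNIV. trig (tr_d i (v i)) x) = 0" for x
  proof -
    have "trig (tr_d 1 (tr_d 3 w1)) x + trig (tr_d 2 (tr_d 3 w2)) x =
       trig (tr_d 1 (tr_d 1 (tr_d 3 \<tau>))) x + trig (tr_d 2 (tr_d 2 (tr_d 3 \<tau>))) x"
      by (simp add: w1_def w2_def tr_d_mul trig_mul_linear tr_d_commute[of 3] tr_d_commute[of 2 1])
    also have "\<dots> = - trig (tr_mul (\<lambda>A C. A) (tr_d 3 \<tau>)) x" by (rule trig_laplacian)
    also have "tr_mul (\<lambda>A C. A) (tr_d 3 \<tau>) = tr_d 3 v3"
      by (simp add: \<tau>_def v3_def tr_mul_mul mult_ac flip: tr_d_mul)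
    finally show ?thesis by (simp add: sum_3)
  qed
  have momentum: "cross3 e_z (\<chi> i. trig (v i) x) + (\<chi> i. trig (tr_d i p) x) -
        Ek *\<^sub>R (\<chi> i. \<Sum>j\<in>UNIV. trig (tr_d j (tr_d j (v i))) x) = (Ra * trig \<theta> x) *\<^sub>R e_z" for x
  proof -
    define e where "e = tr_d 3 \<sigma>"
    define K where "K l = tr_mul (\<lambda>A C. A + C) l" for l
    have Kd: "K (tr_d i l) = tr_d i (K l)" "K (l @ l') = K l @ K l'" for i l l' by (simp_all add: K_def tr_d_mul)
    have mul1: "tr_mul (\<lambda>A C. c * (A + C)) l = tr_mul (\<lambda>A C. c) (K l)" for l c
      by (simp add: K_def tr_mul_mul)
    have KK: "trig (tr_mul (\<lambda>A C. - 1 - Ek\<^sup>2 * (A + C)\<^sup>2) l) x = - trig l x - Ek\<^sup>2 * trig (K (K l)) x" for l x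
      using trig_mul_linear(1)[of "\<lambda>A C. - 1" "\<lambda>A C. - (Ek\<^sup>2) * (A + C)\<^sup>2" l x]
        trig_mul_linear(2)[of "- (Ek\<^sup>2)" "\<lambda>A C. (A + C)\<^sup>2" l x] trig_mul_linear(3)[of "- 1" l x]
      by (simp add: K_def tr_mul_mul power2_eq_square)
    have Kc: "K (tr_mul (\<lambda>A C. c) l) = tr_mul (\<lambda>A C. c) (K l)" for l c by (simp add: K_def tr_mul_mul mult.commute)
    have 1: "trig (v 1) x = trig (tr_d 2 e) x + Ek * trig (tr_d 1 (K e)) x"
      "trig (v 2) x = - trig (tr_d 1 e) x + Ek * trig (tr_d 2 (K e)) x"
      "trig (K (v 1)) x = trig (tr_d 2 (K e)) x + Ek * trig (tr_d 1 (K (K e))) x"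
      "trig (K (v 2)) x = - trig (tr_d 1 (K e)) x + Ek * trig (tr_d 2 (K (K e))) x"
      by (simp_all add: w1_def w2_def \<tau>_def mul1 e_def Kd Kc tr_d_mul trig_mul_linear tr_d_commute[of 3])
    have 2: "trig (tr_d i p) x = - trig (tr_d i e) x - Ek\<^sup>2 * trig (tr_d i (K (K e))) x" for i
      by (simp add: p_def tr_d_mul KK e_def Kd)
    \<comment> \<open>With K = A + C, the pressure contributes C (1 + Ek^2 K^2) and viscosity Ek^2 A
      K^2; the sum is C + Ek^2 K^3.\<close>
    have 3: "trig (tr_d 3 p) x + Ek * trig (K (v 3)) x = Ra * trig \<theta> x"
    proof -
      have "trig (tr_d 3 p) x + Ek * trig (K (v 3)) x =
         trig (tr_mul (\<lambda>A C. C * (1 + Ek\<^sup>2 * (A + C)\<^sup>2) + Ek * ((A + C) * (Ek * A * (A + C)))) \<sigma>) x"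
      proof -
        have "trig (tr_d 3 p) x = - trig (tr_mul (\<lambda>A C. C * (- 1 - Ek\<^sup>2 * (A + C)\<^sup>2)) \<sigma>) x"
          by (simp add: p_def d3d3 tr_mul_mul)
        also have "\<dots> = trig (tr_mul (\<lambda>A C. C * (1 + Ek\<^sup>2 * (A + C)\<^sup>2)) \<sigma>) x"
          using trig_mul_linear(2)[of "- 1" "\<lambda>A C. C * (- 1 - Ek\<^sup>2 * (A + C)\<^sup>2)" \<sigma> x] by (simp add: algebra_simps)
        finally show ?thesis
          by (simp only: trig_mul_linear) (simp add: K_def v3_def tr_mul_mul)
      qed
      also have "(\<lambda>A C. C * (1 + Ek\<^sup>2 * (A + C)\<^sup>2) + Ek * ((A + C) * (Ek * A * (A + C)))) = (\<lambda>A C. C + Ek\<^sup>2 * (A + C)^3)"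
        by (simp add: fun_eq_iff power2_eq_square power3_eq_cube algebra_simps)
      also have "trig (tr_mul (\<lambda>A C. C + Ek\<^sup>2 * (A + C)^3) \<sigma>) x = Ra * trig \<theta> x"
        by (simp only: \<theta>\<sigma> trig_mul_linear)
      finally show ?thesis .
    qed
    have c1: "- trig (v 2) x + trig (tr_d 1 p) x + Ek * trig (K (v 1)) x = 0"
      unfolding 1 2 by (simp add: power2_eq_square algebra_simps)
    have c2: "trig (v 1) x + trig (tr_d 2 p) x + Ek * trig (K (v 2)) x = 0"
      unfolding 1 2 by (simp add: power2_eq_square algebra_simps)
    show ?thesis
      unfolding lap K_def[symmetric] using c1 c2 3
      by (simp add: vec_eq_iff forall_3 cross3_def e_z_def axis_def del: v_simps)
  qed
  have mean: "integral (rect Lx Ly) (hsec (trig (v i)) z) = 0" if z: "z \<in> {0..1}" for i z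
  proof -
    have app: "integral (rect Lx Ly) (hsec (trig (tr_d i a @ tr_d j b)) z) = 0"
      if "tr_ok Lx Ly a" "tr_ok Lx Ly b" "i \<noteq> 3" "j \<noteq> 3" for a b i j
    proof -
      have "integral (rect Lx Ly) (hsec (trig (tr_d i a @ tr_d j b)) z) =
          integral (rect Lx Ly) (\<lambda>y. hsec (trig (tr_d i a)) z y + hsec (trig (tr_d j b)) z y)"
        by (rule integral_cong) (simp add: hsec_def split_def)
      also have "\<dots> = integral (rect Lx Ly) (hsec (trig (tr_d i a)) z) + integral (rect Lx Ly) (hsec (trig (tr_d j b)) z)"
        by (intro integral_add integrable_continuous hsec_continuous trig_continuous z) (use that in auto)
      also have "\<dots> = 0"
        using section_integral_partial_eq_0[OF L trig_C1_field[OF that(1)] that(3) z]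
          section_integral_partial_eq_0[OF L trig_C1_field[OF that(2)] that(4) z] by simp
      finally show ?thesis .
    qed
    \<comment> \<open>The factor \<open>A\<close> in the symbol of \<open>v3\<close> makes it a
      horizontal Laplacian, hence of zero mean on every section.\<close>
    define r where "r = tr_mul (\<lambda>A C. - Ek * (A + C)) \<sigma>"
    have "trig v3 = trig (tr_d 1 (tr_d 1 r) @ tr_d 2 (tr_d 2 r))"
    proof
      fix x
      have "trig (tr_d 1 (tr_d 1 r) @ tr_d 2 (tr_d 2 r)) x = - trig (tr_mul (\<lambda>A C. A) r) x"
        by (simp add: trig_laplacian)
      also have "tr_mul (\<lambda>A C. A) r = tr_mul (\<lambda>A C. - 1 * (Ek * A * (A + C))) \<sigma>"
        unfolding r_def tr_mul_mul by (rule arg_cong[where f = "\<lambda>g. tr_mul g \<sigma>"]) (simp add: fun_eq_iff)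
      also have "- trig \<dots> x = trig v3 x"
        unfolding v3_def trig_mul_linear(2)[of "- 1"] by simp
      finally show "trig v3 x = trig (tr_d 1 (tr_d 1 r) @ tr_d 2 (tr_d 2 r)) x" by simp
    qed
    moreover have "tr_ok Lx Ly r" using \<sigma> by (simp add: r_def)
    moreover have "tr_d 3 w1 = tr_d 2 (tr_d 3 \<sigma>) @ tr_d 1 (tr_d 3 \<tau>)"
      "tr_d 3 w2 = tr_d 1 (tr_d 3 (tr_mul (\<lambda>A C. - 1) \<sigma>)) @ tr_d 2 (tr_d 3 \<tau>)"
      by (simp_all add: w1_def w2_def tr_d_commute[of 3])
    ultimately show ?thesis using exhaust_3[of i] \<sigma> \<tau>
      by (elim disjE) (simp_all add: app)
  qed
  have sup: "(\<Sum>i\<in>UNIV. integral (rect Lx Ly) (\<lambda>y. (hsec (trig (tr_d 1 (v i))) z y)\<^sup>2) +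
        integral (rect Lx Ly) (\<lambda>y. (hsec (trig (tr_d 2 (v i))) z y)\<^sup>2)) \<le> Ra\<^sup>2 / 3 * tr_ip Lx Ly q q"
    if z: "z \<in> {0..1}" for z
  proof -
    define N where "N l = tr_ip Lx Ly l l" for l
    have sec: "integral (rect Lx Ly) (\<lambda>y. (hsec (trig (tr_d j (v i))) z y)\<^sup>2) \<le> 1 / 3 * N (tr_d 3 (tr_d j (v i)))"
      if j: "j \<noteq> 3" for i j
    proof -
      have "(\<forall>x. x $ 3 = 0 \<or> x $ 3 = 1 \<longrightarrow> trig (tr_d j (v i)) x = 0) \<or>
          (\<forall>x y. integral {0..1} (\<lambda>z. trig (tr_d j (v i)) (point x y z)) = 0)"
      proof (cases "i = 3")
        case True
        then show ?thesis using trig_odd_bdry[of Lx Ly "tr_d j v3"] v3 j by auto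
      next
        case False
        have "integral {0..1} (\<lambda>z. trig (tr_d 3 (tr_d j w)) (point x y z)) = 0"
          if "tr_ok Lx Ly w" "tr_odd w" for w x y
          using vertical_integral_partial_eq_0[OF trig_C1_field[of Lx Ly "tr_d j w"]] that j
            trig_odd_bdry[of Lx Ly "tr_d j w"] by auto
        then show ?thesis using False exhaust_3[of i] w by (auto simp: tr_d_commute[of j 3])
      qed
      from section_L2_bound[OF trig_C1_field z this] v_ok[of i]
      show ?thesis by (simp add: N_def tr_ip_def power2_eq_square)
    qed
    have N12: "N (tr_d 3 (tr_d 1 (tr_d 3 l))) + N (tr_d 3 (tr_d 2 (tr_d 3 l))) = tr_ip Lx Ly (tr_mul (\<lambda>A C. A * (C * C)) l) l"
      if l: "tr_ok Lx Ly l" "tr_odd l" for l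
    proof -
      have "N (tr_d 3 (tr_d j (tr_d 3 l))) = tr_ip Lx Ly (tr_d j (tr_mul (\<lambda>A C. C) l)) (tr_d j (tr_mul (\<lambda>A C. C) l))" for j
        by (simp add: N_def tr_ip_def tr_d_commute[of j 3] d3d3 tr_d_mul)
      then have "N (tr_d 3 (tr_d 1 (tr_d 3 l))) + N (tr_d 3 (tr_d 2 (tr_d 3 l))) =
          tr_ip Lx Ly (tr_mul (\<lambda>A C. A) (tr_mul (\<lambda>A C. C) l)) (tr_mul (\<lambda>A C. C) l)"
        using l by (simp add: tr_ip_horizontal_gradient[OF L])
      also have "\<dots> = tr_ip Lx Ly (tr_mul (\<lambda>A C. A * C * C) l) l"
        using l by (simp add: tr_mul_mul tr_ip_mul[OF L])
      finally show ?thesis by (simp add: mult.assoc)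
    qed
    have N3: "N (tr_d 3 (tr_d 1 v3)) + N (tr_d 3 (tr_d 2 v3)) = tr_ip Lx Ly (tr_mul (\<lambda>A C. A * C) v3) v3"
    proof -
      have "N (tr_d 3 (tr_d j v3)) = tr_ip Lx Ly (tr_d j (tr_mul (\<lambda>A C. C) v3)) (tr_d j v3)" if "j \<noteq> 3" for j
        using v3 that by (simp add: N_def tr_ip_vertical_gradient[OF L] tr_d_mul)
      then show ?thesis using v3 by (simp add: tr_ip_horizontal_gradient[OF L] tr_mul_mul)
    qed
    have \<tau>\<sigma>: "tr_ip Lx Ly (tr_mul g \<tau>) \<tau> = tr_ip Lx Ly (tr_mul (\<lambda>A C. g A C * (Ek * (A + C))\<^sup>2) \<sigma>) \<sigma>" for g
      using \<sigma> by (simp add: \<tau>_def tr_mul_mul tr_ip_mul[OF L] power2_eq_square mult_ac)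
    have v3\<sigma>: "tr_ip Lx Ly (tr_mul g v3) v3 = tr_ip Lx Ly (tr_mul (\<lambda>A C. g A C * (Ek * A * (A + C))\<^sup>2) \<sigma>) \<sigma>" for g
      using \<sigma> by (simp add: v3_def tr_mul_mul tr_ip_mul[OF L] power2_eq_square mult_ac)
    have "(\<Sum>i\<in>UNIV. integral (rect Lx Ly) (\<lambda>y. (hsec (trig (tr_d 1 (v i))) z y)\<^sup>2) +
        integral (rect Lx Ly) (\<lambda>y. (hsec (trig (tr_d 2 (v i))) z y)\<^sup>2)) \<le>
        (\<Sum>i\<in>UNIV. 1 / 3 * N (tr_d 3 (tr_d 1 (v i))) + 1 / 3 * N (tr_d 3 (tr_d 2 (v i))))"
      by (intro sum_mono add_mono sec) auto
    also have "\<dots> = 1 / 3 * (tr_ip Lx Ly (tr_mul (\<lambda>A C. A * (C * C)) w1) w1 + tr_ip Lx Ly (tr_mul (\<lambda>A C. A * (C * C)) w2) w2 +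
        tr_ip Lx Ly (tr_mul (\<lambda>A C. A * C) v3) v3)"
      unfolding N12[OF w(1,2), symmetric] N12[OF w(3,4), symmetric] N3[symmetric] by (simp add: sum_3)
    also have "\<dots> = 1 / 3 * (tr_ip Lx Ly (tr_mul (\<lambda>A C. A * (A * (C * C))) \<sigma>) \<sigma> + tr_ip Lx Ly (tr_mul (\<lambda>A C. A * (A * (C * C))) \<tau>) \<tau> +
        tr_ip Lx Ly (tr_mul (\<lambda>A C. A * C) v3) v3)"
      unfolding w1_def w2_def tr_ip_helmholtz[OF L \<sigma>(1) \<tau>(1) \<sigma>(2) \<tau>(2)] ..
    also have "\<dots> = 1 / 3 * tr_ip Lx Ly (tr_mul (\<lambda>A C. A * (A * (C * C)) + A * (A * (C * C)) * (Ek * (A + C))\<^sup>2 +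
        A * C * (Ek * A * (A + C))\<^sup>2) \<sigma>) \<sigma>"
      unfolding \<tau>\<sigma> v3\<sigma> using \<sigma> by (simp only: tr_ip_mul_linear)
    also have "\<dots> \<le> 1 / 3 * tr_ip Lx Ly (tr_mul (\<lambda>A C. ((A + C) * (C + Ek\<^sup>2 * (A + C)^3))\<^sup>2) \<sigma>) \<sigma>"
    proof (intro mult_left_mono tr_ip_mul_mono[OF L \<sigma>])
      \<comment> \<open>With K = A + C, the left side is A^2 C^2 + Ek^2 A^2 C K^3, while the right
        side contains K^2 C^2 + 2 Ek^2 C K^5. Since A \<le> K, the terms compare for every
        \<open>Ek\<close>; this is the source of uniformity.\<close>
      fix A C :: real assume A: "0 \<le> A" and C: "0 < C"
      define K where "K = A + C"
      have K: "0 \<le> K" "A \<le> K" using A C by (simp_all add: K_def)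
      have "A * A \<le> K * K" using K A by (intro mult_mono) auto
      then have 1: "(A * A) * (C * C) \<le> (K * K) * (C * C)" by (intro mult_right_mono) auto
      have "A * A * (C * K^3) \<le> K * K * (C * K^3)"
        using \<open>A * A \<le> K * K\<close> K C by (intro mult_right_mono) auto
      then have "Ek\<^sup>2 * (A * A * (C * K^3)) \<le> Ek\<^sup>2 * (K * K * (C * K^3))" by (intro mult_left_mono) auto
      moreover have "0 \<le> Ek\<^sup>2 * (K * K * (C * K^3))" "0 \<le> (Ek\<^sup>2 * K^4)\<^sup>2" using K C by auto
      ultimately have "A * A * (C * C) + Ek\<^sup>2 * (A * A * (C * K^3)) \<le>
          (K * K) * (C * C) + 2 * (Ek\<^sup>2 * (K * K * (C * K^3))) + (Ek\<^sup>2 * K^4)\<^sup>2"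
        using 1 by linarith
      also have "\<dots> = (K * (C + Ek\<^sup>2 * K^3))\<^sup>2" by (simp add: power2_eq_square eval_nat_numeral algebra_simps)
      also have "Ek\<^sup>2 * (A * A * (C * K^3)) = A * (A * (C * C)) * (Ek * K)\<^sup>2 + A * C * (Ek * A * K)\<^sup>2"
      proof -
        have K3: "K^3 = K\<^sup>2 * (A + C)" by (simp add: K_def power2_eq_square power3_eq_cube)
        show ?thesis unfolding K3 by (simp add: power2_eq_square algebra_simps)
      qed
      finally show "A * (A * (C * C)) + A * (A * (C * C)) * (Ek * (A + C))\<^sup>2 + A * C * (Ek * A * (A + C))\<^sup>2 \<le>
          ((A + C) * (C + Ek\<^sup>2 * (A + C)^3))\<^sup>2" by (simp add: K_def add.assoc mult.assoc)
    qed simp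
    also have "\<dots> = 1 / 3 * tr_ip Lx Ly (tr_mul (\<lambda>A C. - Ra) q) (tr_mul (\<lambda>A C. - Ra) q)"
      unfolding tr_ip_mul_self[OF L \<sigma>, symmetric] q\<sigma> ..
    also have "\<dots> = Ra\<^sup>2 / 3 * tr_ip Lx Ly q q"
      by (simp add: tr_ip_def trig_mul_linear power2_eq_square mult_ac flip: integral_mult_right)
    finally show ?thesis .
  qed
  show ?thesis
    by (rule that[of v p \<theta>]) (use v_ok bdry lap\<theta> div momentum mean sup q v3 \<sigma> in \<open>simp_all add: p_def \<theta>_def\<close>)
qed

section \<open>Density of trigonometric fields\<close>

text \<open>Products of cosines in z are sums of cosines, so this class is an algebra with
  constants, as Stone-Weierstrass requires; sines in z are not closed under products. Odd modes come
  back on multiplication by sin (pi z).\<close>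

inductive_set cos_poly :: "real \<Rightarrow> real \<Rightarrow> (real^3 \<Rightarrow> real) set" for Lx Ly where
  mode: "\<alpha> * Lx = 2 * pi * of_int j \<Longrightarrow> \<beta> * Ly = 2 * pi * of_int k \<Longrightarrow>
    (\<lambda>x. a * cos (\<alpha> * x $ 1 + \<beta> * x $ 2 + \<phi>) * cos (pi * of_int n * x $ 3)) \<in> cos_poly Lx Ly"
| add: "f \<in> cos_poly Lx Ly \<Longrightarrow> g \<in> cos_poly Lx Ly \<Longrightarrow> (\<lambda>x. f x + g x) \<in> cos_poly Lx Ly"

lemma cos_poly_mult_mode:
  assumes j: "\<alpha> * Lx = 2 * pi * of_int j" "\<beta> * Ly = 2 * pi * of_int k" and g: "g \<in> cos_poly Lx Ly"
  shows "(\<lambda>x. a * cos (\<alpha> * x $ 1 + \<beta> * x $ 2 + \<phi>) * cos (pi * of_int n * x $ 3) * g x) \<in> cos_poly Lx Ly"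
  using g
proof induction
  case (mode \<alpha>' j' \<beta>' k' a' \<phi>' n')
  \<comment> \<open>The product-to-sum formulas give four modes, with \<open>\<epsilon>\<close> and
    \<open>\<delta>\<close> ranging over 1 and -1.\<close>
  let ?m = "\<lambda>\<epsilon> \<delta> x. a * a' / 4 * cos ((\<alpha> + of_int \<epsilon> * \<alpha>') * x $ 1 + (\<beta> + of_int \<epsilon> * \<beta>') * x $ 2 + (\<phi> + of_int \<epsilon> * \<phi>')) *
    cos (pi * of_int (n + \<delta> * n') * x $ 3)"
  have m: "?m \<epsilon> \<delta> \<in> cos_poly Lx Ly" for \<epsilon> \<delta> :: int
    by (rule cos_poly.mode[where j = "j + \<epsilon> * j'" and k = "k + \<epsilon> * k'"])
      (use j mode in \<open>simp_all add: algebra_simps\<close>)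
  have e: "a * cos P * cos N * (a' * cos P' * cos N') =
      a * a' / 4 * cos (P + P') * cos (N + N') + a * a' / 4 * cos (P + P') * cos (N - N') +
      (a * a' / 4 * cos (P - P') * cos (N + N') + a * a' / 4 * cos (P - P') * cos (N - N'))" for P N P' N' :: real
    by (simp add: cos_add cos_diff algebra_simps)
  have "(\<lambda>x. a * cos (\<alpha> * x $ 1 + \<beta> * x $ 2 + \<phi>) * cos (pi * of_int n * x $ 3) *
      (a' * cos (\<alpha>' * x $ 1 + \<beta>' * x $ 2 + \<phi>') * cos (pi * of_int n' * x $ 3))) =
      (\<lambda>x. ?m 1 1 x + ?m 1 (- 1) x + (?m (- 1) 1 x + ?m (- 1) (- 1) x))"
    unfolding e by (simp add: algebra_simps)
  also have "\<dots> \<in> cos_poly Lx Ly" by (intro cos_poly.add m)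
  finally show ?case .
next
  case (add f g)
  then show ?case by (simp add: distrib_left cos_poly.add)
qed

lemma cos_poly_mult:
  assumes f: "f \<in> cos_poly Lx Ly" and g: "g \<in> cos_poly Lx Ly"
  shows "(\<lambda>x. f x * g x) \<in> cos_poly Lx Ly"
  using f
proof induction
  case (mode \<alpha> j \<beta> k a \<phi> n)
  then show ?case using cos_poly_mult_mode g by blast
next
  case (add f h)
  then show ?case by (simp add: distrib_right cos_poly.add)
qed

lemma cos_poly_const: "(\<lambda>x. c) \<in> cos_poly Lx Ly"
  using cos_poly.mode[of 0 Lx 0 0 Ly 0 c 0 0] by simp

lemma cos_poly_sin_mult:
  assumes "f \<in> cos_poly Lx Ly"
  shows "\<exists>q. tr_ok Lx Ly q \<and> tr_odd q \<and> (\<forall>x. sin (pi * x $ 3) * f x = trig q x)"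
  using assms
proof induction
  case (mode \<alpha> j \<beta> k a \<phi> n)
  \<comment> \<open>Index 0 arises for n = 1 and n = -1. The sine is zero there and
    \<open>mode_ok\<close> excludes the frequency, hence the empty list.\<close>
  define part where "part i = (if i = 0 then [] else [(a / 2, \<alpha>, \<beta>, \<phi>, pi * of_int i, 0 :: real)])" for i :: int
  have p: "trig (part i) x = a / 2 * cos (\<alpha> * x $ 1 + \<beta> * x $ 2 + \<phi>) * sin (pi * of_int i * x $ 3)" for i x
    by (simp add: part_def)
  have e: "sin P * (a * C * cos N) = a / 2 * C * sin (P + N) + a / 2 * C * sin (P - N)" for P N C :: real
    by (simp add: sin_add sin_diff algebra_simps)
  have "sin (pi * x $ 3) * (a * cos (\<alpha> * x $ 1 + \<beta> * x $ 2 + \<phi>) * cos (pi * of_int n * x $ 3)) =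
      trig (part (1 + n) @ part (1 - n)) x" for x
    unfolding e trig_simps p by (simp add: algebra_simps)
  moreover have "tr_ok Lx Ly (part i) \<and> tr_odd (part i)" for i
    using mode by (auto simp: part_def)
  ultimately show ?case by (intro exI[of _ "part (1 + n) @ part (1 - n)"]) simp
next
  case (add f g)
  then obtain q1 q2 where "tr_ok Lx Ly q1" "tr_odd q1" "\<forall>x. sin (pi * x $ 3) * f x = trig q1 x"
    "tr_ok Lx Ly q2" "tr_odd q2" "\<forall>x. sin (pi * x $ 3) * g x = trig q2 x" by blast
  then show ?case by (intro exI[of _ "q1 @ q2"]) (auto simp: distrib_left)
qed

text \<open>
  Stone-Weierstrass is applied on the image of the cell under a map that identifies exactly the
  points identified by periodicity.
\<close>

lemma cos_poly_dense:
  assumes L: "0 < Lx" "0 < Ly" and f: "continuous_on slab f" "periodic_xy Lx Ly f" and e: "0 < e"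
  shows "\<exists>g\<in>cos_poly Lx Ly. \<forall>x\<in>cell Lx Ly. \<bar>f x - g x\<bar> < e"
proof -
  define \<Phi> :: "real^3 \<Rightarrow> complex \<times> complex \<times> real"
    where "\<Phi> x = (cis (2 * pi / Lx * x $ 1), cis (2 * pi / Ly * x $ 2), cos (pi * x $ 3))" for x
  define K where "K = \<Phi> ` cell Lx Ly"
  define F where "F k = f (SOME x. x \<in> cell Lx Ly \<and> \<Phi> x = k)" for k
  have c\<Phi>: "continuous_on UNIV \<Phi>"
    unfolding \<Phi>_def cis_conv_exp by (intro continuous_intros)
  have cell: "compact (cell Lx Ly)" unfolding cell_def by (rule compact_cbox)
  have K: "compact K" unfolding K_def
    by (rule compact_continuous_image[OF continuous_on_subset[OF c\<Phi>] cell]) simp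
  have cf: "continuous_on (cell Lx Ly) f" by (rule continuous_on_subset[OF f(1) cell_subset_slab])
  \<comment> \<open>Equal points of the circle differ by a multiple of the period; within one closed
    period only equality or the pair of end points is left.\<close>
  have angle: "s = t \<or> (s = 0 \<and> t = l) \<or> (s = l \<and> t = 0)"
    if "cis (2 * pi / l * s) = cis (2 * pi / l * t)" "0 \<le> s" "s \<le> l" "0 \<le> t" "t \<le> l" "0 < l" for s t l :: real
  proof -
    have "sin (2 * pi / l * s) = sin (2 * pi / l * t) \<and> cos (2 * pi / l * s) = cos (2 * pi / l * t)"
      using that(1) by (simp add: complex_eq_iff)
    then obtain n :: int where "2 * pi / l * s = 2 * pi / l * t + 2 * pi * n"
      unfolding sin_cos_eq_iff by blast
    then have "2 * pi * (s - t - l * n) = 0" using that by (simp add: field_simps)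
    then have n: "s - t = l * n" by simp
    then have "l * \<bar>real_of_int n\<bar> = \<bar>s - t\<bar>" using that by (simp add: abs_mult)
    also have "\<dots> \<le> l * 1" using that by auto
    finally have "\<bar>real_of_int n\<bar> \<le> 1" using that by simp
    then have "\<bar>n\<bar> \<le> 1" using that by simp
    then have "n = 0 \<or> n = 1 \<or> n = - 1" by auto
    then show ?thesis using n that by auto
  qed
  have wd: "f x = f y" if xy: "x \<in> cell Lx Ly" "y \<in> cell Lx Ly" "\<Phi> x = \<Phi> y" for x y
  proof -
    have z: "x $ 3 = y $ 3"
      using that cos_inj_pi[of "pi * x $ 3" "pi * y $ 3"] by (auto simp: \<Phi>_def mem_cell)
    have "f (point (x $ 1) (x $ 2) (x $ 3)) = f (point (y $ 1) (x $ 2) (x $ 3))"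
      using angle[of Lx "x $ 1" "y $ 1"] that L periodic_xy_point(1)[OF f(2), of "x $ 3" "x $ 2"] by (auto simp: \<Phi>_def mem_cell)
    also have "\<dots> = f (point (y $ 1) (y $ 2) (x $ 3))"
      using angle[of Ly "x $ 2" "y $ 2"] that L periodic_xy_point(2)[OF f(2), of "x $ 3" "y $ 1"] by (auto simp: \<Phi>_def mem_cell)
    finally have "f (point (x $ 1) (x $ 2) (x $ 3)) = f (point (y $ 1) (y $ 2) (y $ 3))" by (simp only: z)
    then show ?thesis by (simp only: point_eq)
  qed
  have F: "F (\<Phi> x) = f x" if "x \<in> cell Lx Ly" for x
  proof -
    have "(SOME y. y \<in> cell Lx Ly \<and> \<Phi> y = \<Phi> x) \<in> cell Lx Ly \<and> \<Phi> (SOME y. y \<in> cell Lx Ly \<and> \<Phi> y = \<Phi> x) = \<Phi> x"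
      by (rule someI[of _ x]) (use that in simp)
    then show ?thesis unfolding F_def using wd that by blast
  qed
  \<comment> \<open>\<open>\<Phi>\<close> is not injective on the cell, so continuity is checked on
    closed sets: their preimages under \<open>F\<close> are images of compact sets under
    \<open>\<Phi>\<close>.\<close>
  have cF: "continuous_on K F"
    unfolding continuous_on_closed_vimage[OF compact_imp_closed[OF K]]
  proof (intro allI impI)
    fix B :: "real set" assume "closed B"
    then have "closed (f -` B \<inter> cell Lx Ly)"
      using cf continuous_on_closed_vimage[OF compact_imp_closed[OF cell]] by blast
    then have "compact (f -` B \<inter> cell Lx Ly)"
      using compact_Int_closed[OF cell] by (metis inf.right_idem inf_commute)
    then have "compact (\<Phi> ` (f -` B \<inter> cell Lx Ly))"
      by (rule compact_continuous_image[OF continuous_on_subset[OF c\<Phi>], rotated]) simp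
    moreover have "\<Phi> ` (f -` B \<inter> cell Lx Ly) = F -` B \<inter> K"
      unfolding K_def using F by auto
    ultimately show "closed (F -` B \<inter> K)" by (simp add: compact_imp_closed)
  qed
  define R where "R = {G :: complex \<times> complex \<times> real \<Rightarrow> real. continuous_on K G \<and> (\<lambda>x. G (\<Phi> x)) \<in> cos_poly Lx Ly}"
  have coord: "(\<lambda>k. Re (fst k)) \<in> R" "(\<lambda>k. Im (fst k)) \<in> R" "(\<lambda>k. Re (fst (snd k))) \<in> R"
    "(\<lambda>k. Im (fst (snd k))) \<in> R" "(\<lambda>k. snd (snd k)) \<in> R"
    unfolding R_def
    using cos_poly.mode[of "2 * pi / Lx" Lx 1 0 Ly 0 1 0 0] cos_poly.mode[of "2 * pi / Lx" Lx 1 0 Ly 0 1 "- pi / 2" 0]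
      cos_poly.mode[of 0 Lx 0 "2 * pi / Ly" Ly 1 1 0 0] cos_poly.mode[of 0 Lx 0 "2 * pi / Ly" Ly 1 1 "- pi / 2" 0]
      cos_poly.mode[of 0 Lx 0 0 Ly 0 1 0 1] L
    by (auto intro!: continuous_intros simp: \<Phi>_def cos_diff)
  interpret function_ring_on R K
  proof
    show "compact K" by (rule K)
    show "\<And>f. f \<in> R \<Longrightarrow> continuous_on K f" by (simp add: R_def)
    show "\<And>f g. f \<in> R \<Longrightarrow> g \<in> R \<Longrightarrow> (\<lambda>x. f x + g x) \<in> R"
      by (auto simp: R_def intro: continuous_intros cos_poly.add)
    show "\<And>f g. f \<in> R \<Longrightarrow> g \<in> R \<Longrightarrow> (\<lambda>x. f x * g x) \<in> R"
      by (auto simp: R_def intro: continuous_intros cos_poly_mult)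
    show "\<And>c. (\<lambda>_. c) \<in> R" by (simp add: R_def cos_poly_const)
    show "\<exists>f\<in>R. f x \<noteq> f y" if "x \<noteq> y" for x y
    proof (rule ccontr)
      assume "\<not> (\<exists>f\<in>R. f x \<noteq> f y)"
      then have "\<And>f. f \<in> R \<Longrightarrow> f x = f y" by blast
      from this[OF coord(1)] this[OF coord(2)] this[OF coord(3)] this[OF coord(4)] this[OF coord(5)]
      show False using that by (simp add: prod_eq_iff complex_eq_iff)
    qed
  qed
  obtain G where G: "G \<in> R" "\<forall>k\<in>K. \<bar>F k - G k\<bar> < e"
    using Stone_Weierstrass_basic[OF cF e] by blast
  then show ?thesis
    by (intro bexI[of _ "\<lambda>x. G (\<Phi> x)"]) (auto simp: R_def K_def F)
qed

text \<open>Odd modes vanish on the walls but h need not. Uniform approximation is applied to h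
  divided by the sine, truncated from below near the walls; multiplying back is wrong only in two
  thin layers, which are cheap in L2.\<close>

lemma trig_dense_L2:
  assumes L: "0 < Lx" "0 < Ly" and h: "continuous_on slab h" "periodic_xy Lx Ly h" and e: "0 < e"
  obtains q where "tr_ok Lx Ly q" "tr_odd q" "integral (cell Lx Ly) (\<lambda>x. (h x - trig q x)\<^sup>2) < e"
proof -
  have "compact (cell Lx Ly)" unfolding cell_def by (rule compact_cbox)
  then have "bounded (h ` cell Lx Ly)"
    by (intro compact_imp_bounded compact_continuous_image continuous_on_subset[OF h(1) cell_subset_slab])
  then obtain M where M: "\<And>x. x \<in> cell Lx Ly \<Longrightarrow> \<bar>h x\<bar> \<le> M" by (auto simp: bounded_iff)
  define a where "a = Lx * Ly"
  have a: "0 < a" using L by (simp add: a_def)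
  \<comment> \<open>Thickness of the wall layers, chosen so that they contribute less than e / 4;
    the summand 1 avoids a division by zero for \<open>M = 0\<close>.\<close>
  define d where "d = min (1 / 4) (e / (16 * a * (M\<^sup>2 + 1)))"
  have M1: "0 < M\<^sup>2 + 1" by (simp add: add_nonneg_pos)
  have d: "0 < d" "d < 1 / 2" "d \<le> e / (16 * a * (M\<^sup>2 + 1))" using e a M1 by (auto simp: d_def)
  define \<delta> where "\<delta> = sin (pi * d)"
  have \<delta>: "0 < \<delta>" unfolding \<delta>_def by (rule sin_gt_zero) (use d in auto)
  \<comment> \<open>The uniform error contributes 2 a \<eta>^2 = e / 4.\<close>
  define \<eta> where "\<eta> = sqrt (e / (8 * a))"
  have \<eta>: "0 < \<eta>" "\<eta>\<^sup>2 = e / (8 * a)" using e a by (simp_all add: \<eta>_def)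
  define f where "f x = h x / max (sin (pi * x $ 3)) \<delta>" for x
  \<comment> \<open>Relative error of dividing and multiplying back: it lies between 0 and 1 and
    vanishes outside the layers.\<close>
  define w where "w z = 1 - sin (pi * z) / max (sin (pi * z)) \<delta>" for z
  have mx: "max s \<delta> \<noteq> 0" for s using \<delta> by (simp add: max_def)
  have "continuous_on slab f" unfolding f_def using mx by (auto intro!: continuous_intros h)
  moreover have "periodic_xy Lx Ly f" using h(2) by (simp add: periodic_xy_def f_def axis_def)
  ultimately obtain g where g: "g \<in> cos_poly Lx Ly" "\<And>x. x \<in> cell Lx Ly \<Longrightarrow> \<bar>f x - g x\<bar> < \<eta>"
    using cos_poly_dense[OF L _ _ \<eta>(1)] by blast
  obtain q where q: "tr_ok Lx Ly q" "tr_odd q" "\<And>x. sin (pi * x $ 3) * g x = trig q x"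
    using cos_poly_sin_mult[OF g(1)] by blast
  have s01: "0 \<le> sin (pi * z)" "sin (pi * z) \<le> 1" if "z \<in> {0..1}" for z
    using that by (auto intro!: sin_ge_zero mult_left_le)
  have w01: "0 \<le> w z" "w z \<le> 1" if "z \<in> {0..1}" for z
    using s01[OF that] \<delta> by (auto simp: w_def max_def divide_simps)
  have w0: "w z = 0" if z: "z \<in> {d..1 - d}" for z
  proof -
    have "\<delta> \<le> sin (pi * z)"
    proof (cases "z \<le> 1 / 2")
      case True
      have "sin (pi * d) \<le> sin (pi * z)"
        by (rule sin_monotone_2pi_le) (use True d z in \<open>auto simp: mult_left_le intro: order_trans[of _ 0]\<close>)
      then show ?thesis by (simp add: \<delta>_def)
    next
      case False
      have "sin (pi * d) \<le> sin (pi * (1 - z))"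
        by (rule sin_monotone_2pi_le) (use False d z in \<open>auto intro: order_trans[of _ 0]\<close>)
      also have "\<dots> = sin (pi * z)" by (simp add: algebra_simps sin_diff)
      finally show ?thesis by (simp add: \<delta>_def)
    qed
    then show ?thesis using \<delta> by (simp add: w_def max_def)
  qed
  have cw: "continuous_on S w" for S unfolding w_def using mx by (auto intro!: continuous_intros)
  have iw: "integral {0..1} (\<lambda>z. (w z)\<^sup>2) \<le> 2 * d"
  proof -
    have i: "(\<lambda>z. (w z)\<^sup>2) integrable_on {u..v}" for u v
      by (intro integrable_continuous_real continuous_intros cw)
    have "integral {0..1} (\<lambda>z. (w z)\<^sup>2) =
        integral {0..d} (\<lambda>z. (w z)\<^sup>2) + integral {d..1 - d} (\<lambda>z. (w z)\<^sup>2) + integral {1 - d..1} (\<lambda>z. (w z)\<^sup>2)"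
      using d by (simp add: Henstock_Kurzweil_Integration.integral_combine[OF _ _ i])
    also have "integral {d..1 - d} (\<lambda>z. (w z)\<^sup>2) = integral {d..1 - d} (\<lambda>z. 0)"
      by (rule integral_cong) (simp add: w0)
    also have "integral {0..d} (\<lambda>z. (w z)\<^sup>2) \<le> integral {0..d} (\<lambda>z. 1)"
      by (rule integral_le[OF i]) (use w01 d in \<open>auto simp: power_le_one\<close>)
    also have "integral {1 - d..1} (\<lambda>z. (w z)\<^sup>2) \<le> integral {1 - d..1} (\<lambda>z. 1)"
      by (rule integral_le[OF i]) (use w01 d in \<open>auto simp: power_le_one\<close>)
    finally show ?thesis using d by simp
  qed
  have cW: "continuous_on slab (\<lambda>x::real^3. 2 * M\<^sup>2 * (w (x $ 3))\<^sup>2 + 2 * \<eta>\<^sup>2)"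
    by (intro continuous_intros continuous_on_compose2[OF cw[of UNIV]]) auto
  have pt: "(h x - trig q x)\<^sup>2 \<le> 2 * M\<^sup>2 * (w (x $ 3))\<^sup>2 + 2 * \<eta>\<^sup>2" if x: "x \<in> cell Lx Ly" for x
  proof -
    define s where "s = sin (pi * x $ 3)"
    have s: "0 \<le> s" "s \<le> 1" using s01[of "x $ 3"] x by (auto simp: s_def mem_cell)
    have "h x - trig q x = h x * w (x $ 3) + s * (f x - g x)"
      using mx[of s] by (simp add: q(3)[symmetric] w_def f_def s_def algebra_simps)
    also have "(\<dots>)\<^sup>2 \<le> 2 * (h x * w (x $ 3))\<^sup>2 + 2 * (s * (f x - g x))\<^sup>2"
      using sum_squares_ge_zero[of "h x * w (x $ 3) - s * (f x - g x)" 0] by (simp add: power2_eq_square algebra_simps)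
    also have "\<dots> \<le> 2 * M\<^sup>2 * (w (x $ 3))\<^sup>2 + 2 * \<eta>\<^sup>2"
    proof -
      have "(h x)\<^sup>2 \<le> M\<^sup>2" using M[OF x] by (simp add: abs_le_square_iff[symmetric])
      then have "(h x * w (x $ 3))\<^sup>2 \<le> M\<^sup>2 * (w (x $ 3))\<^sup>2" by (simp add: power_mult_distrib mult_right_mono)
      moreover have "\<bar>s * (f x - g x)\<bar> \<le> 1 * \<eta>"
        unfolding abs_mult using s g(2)[OF x] by (intro mult_mono) auto
      then have "(s * (f x - g x))\<^sup>2 \<le> \<eta>\<^sup>2" using \<eta>(1) by (simp add: abs_le_square_iff[symmetric])
      ultimately show ?thesis by simp
    qed
    finally show ?thesis .
  qed
  have "integral (cell Lx Ly) (\<lambda>x. (h x - trig q x)\<^sup>2) \<le> integral (cell Lx Ly) (\<lambda>x. 2 * M\<^sup>2 * (w (x $ 3))\<^sup>2 + 2 * \<eta>\<^sup>2)"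
    by (intro integral_le cell_integrable cW continuous_intros h(1) trig_continuous[OF q(1)] pt)
  also have "\<dots> = integral {0..1} (\<lambda>z. a * (2 * M\<^sup>2 * (w z)\<^sup>2 + 2 * \<eta>\<^sup>2))"
    unfolding integral_cell_hsec(1)[OF cW] using L by (simp add: hsec_def split_def a_def content_Pair)
  also have "\<dots> = a * (2 * M\<^sup>2 * integral {0..1} (\<lambda>z. (w z)\<^sup>2) + 2 * \<eta>\<^sup>2)"
  proof (rule integral_unique)
    have "((\<lambda>z. (w z)\<^sup>2) has_integral integral {0..1} (\<lambda>z. (w z)\<^sup>2)) {0..1}"
      by (intro integrable_integral integrable_continuous_real continuous_intros cw)
    then show "((\<lambda>z. a * (2 * M\<^sup>2 * (w z)\<^sup>2 + 2 * \<eta>\<^sup>2)) has_integral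
        a * (2 * M\<^sup>2 * integral {0..1} (\<lambda>z. (w z)\<^sup>2) + 2 * \<eta>\<^sup>2)) {0..1}"
      by (intro has_integral_mult_right has_integral_add) (use has_integral_const_real[of "\<eta>\<^sup>2" 0 1] in simp_all)
  qed
  also have "\<dots> \<le> a * (2 * M\<^sup>2 * (2 * d) + 2 * \<eta>\<^sup>2)"
    using a iw by (intro mult_left_mono add_right_mono) auto
  also have "\<dots> < e"
  proof -
    have "0 < 16 * a * (M\<^sup>2 + 1)" using a M1 by simp
    then have "16 * a * (M\<^sup>2 + 1) * d \<le> e" using d(3) by (simp only: pos_le_divide_eq mult.commute)
    moreover have "16 * a * (M\<^sup>2 + 1) * d = 16 * (a * (M\<^sup>2 * d)) + 16 * (a * d)" by (simp add: algebra_simps)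
    moreover have "a * (2 * M\<^sup>2 * (2 * d) + 2 * \<eta>\<^sup>2) = 4 * (a * (M\<^sup>2 * d)) + e / 4" using a by (simp add: \<eta> field_simps)
    moreover have "0 < a * d" using a d by simp
    ultimately show ?thesis using e by linarith
  qed
  finally show ?thesis using that q by blast
qed

section \<open>Work of the Lorentz force\<close>

lemma cell_integral_sum:
  assumes "\<And>i. continuous_on slab (f i)"
  shows "integral (cell Lx Ly) (\<lambda>x. \<Sum>i\<in>UNIV. f i x) = (\<Sum>i\<in>(UNIV :: 'i::finite set). integral (cell Lx Ly) (f i :: _ \<Rightarrow> real))"
  by (rule integral_sum) (simp_all add: cell_integrable assms)

lemma green_identity:
  assumes L: "0 < Lx" "0 < Ly" and f: "C1_field Lx Ly f g" and g: "\<And>j. C1_field Lx Ly (g j) (h j)"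
    and b: "\<And>x. x $ 3 = 0 \<or> x $ 3 = 1 \<Longrightarrow> f x * g 3 x = 0"
  shows "integral (cell Lx Ly) (\<lambda>x. f x * (\<Sum>j\<in>UNIV. h j j x)) = - integral (cell Lx Ly) (\<lambda>x. \<Sum>j\<in>UNIV. (g j x)\<^sup>2)"
proof -
  note c = C1_field_continuous[OF f] C1_field_continuous[OF g]
  have "integral (cell Lx Ly) (\<lambda>x. f x * (\<Sum>j\<in>UNIV. h j j x)) = (\<Sum>j\<in>UNIV. integral (cell Lx Ly) (\<lambda>x. f x * h j j x))"
    unfolding sum_distrib_left by (intro cell_integral_sum continuous_intros c)
  also have "\<dots> = (\<Sum>j\<in>UNIV. - integral (cell Lx Ly) (\<lambda>x. (g j x)\<^sup>2))"
  proof (rule sum.cong[OF refl])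
    fix j
    show "integral (cell Lx Ly) (\<lambda>x. f x * h j j x) = - integral (cell Lx Ly) (\<lambda>x. (g j x)\<^sup>2)"
      unfolding power2_eq_square by (rule integral_by_parts_cell[OF L f g]) (use b in auto)
  qed
  also have "\<dots> = - integral (cell Lx Ly) (\<lambda>x. \<Sum>j\<in>UNIV. (g j x)\<^sup>2)"
    by (simp add: sum_negf cell_integral_sum continuous_intros c)
  finally show ?thesis .
qed

lemma green_identity_vector:
  fixes f :: "3 \<Rightarrow> real^3 \<Rightarrow> real"
  assumes L: "0 < Lx" "0 < Ly" and f: "\<And>i. C1_field Lx Ly (f i) (g i)"
    and g: "\<And>i j. C1_field Lx Ly (g i j) (h i j)"
    and b: "\<And>i x. x $ 3 = 0 \<or> x $ 3 = 1 \<Longrightarrow> f i x * g i 3 x = 0"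
  shows "integral (cell Lx Ly) (\<lambda>x. \<Sum>i\<in>UNIV. f i x * (\<Sum>j\<in>UNIV. h i j j x)) =
    - integral (cell Lx Ly) (\<lambda>x. \<Sum>i\<in>UNIV. \<Sum>j\<in>UNIV. (g i j x)\<^sup>2)"
proof -
  note c = C1_field_continuous[OF f] C1_field_continuous[OF g]
  have "integral (cell Lx Ly) (\<lambda>x. \<Sum>i\<in>UNIV. f i x * (\<Sum>j\<in>UNIV. h i j j x)) =
      (\<Sum>i\<in>UNIV. integral (cell Lx Ly) (\<lambda>x. f i x * (\<Sum>j\<in>UNIV. h i j j x)))"
    by (intro cell_integral_sum continuous_intros c)
  also have "\<dots> = (\<Sum>i\<in>UNIV. - integral (cell Lx Ly) (\<lambda>x. \<Sum>j\<in>UNIV. (g i j x)\<^sup>2))"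
    by (intro sum.cong refl green_identity[OF L f g b])
  also have "\<dots> = - (\<Sum>i\<in>UNIV. integral (cell Lx Ly) (\<lambda>x. \<Sum>j\<in>UNIV. (g i j x)\<^sup>2))"
    by (rule sum_negf)
  also have "(\<Sum>i\<in>UNIV. integral (cell Lx Ly) (\<lambda>x. \<Sum>j\<in>UNIV. (g i j x)\<^sup>2)) =
      integral (cell Lx Ly) (\<lambda>x. \<Sum>i\<in>UNIV. \<Sum>j\<in>UNIV. (g i j x)\<^sup>2)"
    by (rule cell_integral_sum[symmetric]) (intro continuous_intros c)
  finally show ?thesis .
qed

text \<open>Removes the pressure and every other gradient force from the energy balances.\<close>

lemma solenoidal_orthogonal_gradient:
  assumes L: "0 < Lx" "0 < Ly" and w: "\<And>i. C1_field Lx Ly (w i) (wG i)" and p: "C1_field Lx Ly p pG"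
    and div: "\<And>x. x \<in> slab \<Longrightarrow> (\<Sum>i\<in>UNIV. wG i i x) = 0"
    and b: "\<And>x. x $ 3 = 0 \<or> x $ 3 = 1 \<Longrightarrow> w 3 x = 0"
  shows "integral (cell Lx Ly) (\<lambda>x. \<Sum>i\<in>UNIV. w i x * pG i x) = 0"
proof -
  note c = C1_field_continuous[OF w] C1_field_continuous[OF p]
  have "integral (cell Lx Ly) (\<lambda>x. \<Sum>i\<in>UNIV. w i x * pG i x) = (\<Sum>i\<in>UNIV. integral (cell Lx Ly) (\<lambda>x. w i x * pG i x))"
    by (intro cell_integral_sum continuous_intros c)
  also have "\<dots> = (\<Sum>i\<in>UNIV. - integral (cell Lx Ly) (\<lambda>x. wG i i x * p x))"
    by (intro sum.cong refl integral_by_parts_cell[OF L w p]) (use b in auto)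
  also have "\<dots> = - integral (cell Lx Ly) (\<lambda>x. \<Sum>i\<in>UNIV. wG i i x * p x)"
    by (simp add: sum_negf cell_integral_sum continuous_intros c)
  also have "integral (cell Lx Ly) (\<lambda>x. \<Sum>i\<in>UNIV. wG i i x * p x) = integral (cell Lx Ly) (\<lambda>x. 0)"
    using cell_subset_slab div by (intro integral_cong) (auto simp flip: sum_distrib_right)
  finally show ?thesis by simp
qed

lemma cell_Cauchy_Schwarz:
  fixes f g :: "real^3 \<Rightarrow> real"
  assumes "continuous_on slab f" "continuous_on slab g"
  shows "(integral (cell Lx Ly) (\<lambda>x. f x * g x))\<^sup>2
           \<le> integral (cell Lx Ly) (\<lambda>x. (f x)\<^sup>2) * integral (cell Lx Ly) (\<lambda>x. (g x)\<^sup>2)"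
  using continuous_on_subset[OF assms(1) cell_subset_slab[of Lx Ly]]
    continuous_on_subset[OF assms(2) cell_subset_slab[of Lx Ly]]
  unfolding cell_def by (rule integral_Cauchy_Schwarz)

lemma cell_square_integral_nonneg:
  "continuous_on slab f \<Longrightarrow> 0 \<le> integral (cell Lx Ly) (\<lambda>x. (f x)\<^sup>2)" for f :: "real^3 \<Rightarrow> real"
  by (intro integral_nonneg cell_integrable continuous_intros) auto

text \<open>The squared norm of f is at most that of its gradient, which is minus the product of f
  with its Laplacian; Cauchy-Schwarz allows one norm of f to be cancelled. An error in the Laplacian
  of T thus becomes an error in T.\<close>

lemma dirichlet_laplacian_bound:
  assumes L: "0 < Lx" "0 < Ly" and f: "C1_field Lx Ly f g" and g: "\<And>j. C1_field Lx Ly (g j) (h j)"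
    and b: "\<And>x. x $ 3 = 0 \<or> x $ 3 = 1 \<Longrightarrow> f x = 0"
  shows "integral (cell Lx Ly) (\<lambda>x. (f x)\<^sup>2) \<le> integral (cell Lx Ly) (\<lambda>x. (\<Sum>j\<in>UNIV. h j j x)\<^sup>2)"
proof -
  note c = C1_field_continuous[OF f] C1_field_continuous[OF g]
  define N H where "N = integral (cell Lx Ly) (\<lambda>x. (f x)\<^sup>2)" and "H = integral (cell Lx Ly) (\<lambda>x. (\<Sum>j\<in>UNIV. h j j x)\<^sup>2)"
  have N0: "0 \<le> N" and H0: "0 \<le> H" unfolding N_def H_def by (intro cell_square_integral_nonneg continuous_intros c)+
  have "N \<le> integral (cell Lx Ly) (\<lambda>x. (g 3 x)\<^sup>2)"
    unfolding N_def by (rule dirichlet_Poincare[OF f]) (use b in blast)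
  also have "\<dots> \<le> integral (cell Lx Ly) (\<lambda>x. \<Sum>j\<in>UNIV. (g j x)\<^sup>2)"
    by (intro integral_le cell_integrable continuous_intros c) (simp add: sum_3)
  also have "\<dots> = - integral (cell Lx Ly) (\<lambda>x. f x * (\<Sum>j\<in>UNIV. h j j x))"
    using green_identity[OF L f g] b by simp
  finally have "N \<le> \<bar>integral (cell Lx Ly) (\<lambda>x. f x * (\<Sum>j\<in>UNIV. h j j x))\<bar>" by linarith
  then have "N\<^sup>2 \<le> (integral (cell Lx Ly) (\<lambda>x. f x * (\<Sum>j\<in>UNIV. h j j x)))\<^sup>2"
    using N0 by (simp flip: abs_le_square_iff)
  also have "\<dots> \<le> N * H"
    unfolding N_def H_def by (intro cell_Cauchy_Schwarz continuous_intros c)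
  finally show ?thesis using N0 H0 unfolding N_def[symmetric] H_def[symmetric]
    by (cases "N = 0") (auto simp: power2_eq_square)
qed

text \<open>The Lorentz force \<open>(\<nabla> \<times> B) \<times> B\<close> in terms of the gradient \<open>G i j = \<partial>\<^sub>j B\<^sub>i\<close>.\<close>

definition lorentz :: "(3 \<Rightarrow> real^3 \<Rightarrow> real) \<Rightarrow> (3 \<Rightarrow> 3 \<Rightarrow> real^3 \<Rightarrow> real) \<Rightarrow> 3 \<Rightarrow> real^3 \<Rightarrow> real" where
  "lorentz B G i x = (\<Sum>j\<in>UNIV. B j x * (G i j x - G j i x))"

text \<open>The Lorentz force is (B . grad) B minus the gradient of half the square of B, and a
  gradient does no work on a solenoidal field tangent to the walls.\<close>

lemma lorentz_work_solenoidal: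
  assumes L: "0 < Lx" "0 < Ly" and V: "\<And>i. C1_field Lx Ly (V i) (VG i)" and B: "\<And>i. C1_field Lx Ly (B i) (BG i)"
    and div: "\<And>x. x \<in> slab \<Longrightarrow> (\<Sum>i\<in>UNIV. VG i i x) = 0"
    and b: "\<And>x. x $ 3 = 0 \<or> x $ 3 = 1 \<Longrightarrow> V 3 x = 0"
  shows "integral (cell Lx Ly) (\<lambda>x. \<Sum>i\<in>UNIV. V i x * lorentz B BG i x) =
    integral (cell Lx Ly) (\<lambda>x. \<Sum>i\<in>UNIV. \<Sum>j\<in>UNIV. V i x * B j x * BG i j x)"
proof -
  note c = C1_field_continuous[OF V] C1_field_continuous[OF B]
  have sq: "C1_field Lx Ly (\<lambda>x. (1 / 2) * (B 1 x * B 1 x + B 2 x * B 2 x + B 3 x * B 3 x))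
    (\<lambda>i x. (1 / 2) * ((BG 1 i x * B 1 x + B 1 x * BG 1 i x) + (BG 2 i x * B 2 x + B 2 x * BG 2 i x) + (BG 3 i x * B 3 x + B 3 x * BG 3 i x)))"
    by (intro C1_field_cmul C1_field_add C1_field_mult B)
  have "integral (cell Lx Ly) (\<lambda>x. \<Sum>i\<in>UNIV. V i x * lorentz B BG i x) =
    integral (cell Lx Ly) (\<lambda>x. (\<Sum>i\<in>UNIV. \<Sum>j\<in>UNIV. V i x * B j x * BG i j x) -
      (\<Sum>i\<in>UNIV. V i x * ((1 / 2) * ((BG 1 i x * B 1 x + B 1 x * BG 1 i x) + (BG 2 i x * B 2 x + B 2 x * BG 2 i x) + (BG 3 i x * B 3 x + B 3 x * BG 3 i x)))))"
    by (rule integral_cong) (simp add: lorentz_def sum_3 algebra_simps)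
  also have "\<dots> = integral (cell Lx Ly) (\<lambda>x. \<Sum>i\<in>UNIV. \<Sum>j\<in>UNIV. V i x * B j x * BG i j x) -
      integral (cell Lx Ly) (\<lambda>x. \<Sum>i\<in>UNIV. V i x * ((1 / 2) * ((BG 1 i x * B 1 x + B 1 x * BG 1 i x) + (BG 2 i x * B 2 x + B 2 x * BG 2 i x) + (BG 3 i x * B 3 x + B 3 x * BG 3 i x))))"
    by (intro integral_diff cell_integrable continuous_intros c)
  also have "integral (cell Lx Ly) (\<lambda>x. \<Sum>i\<in>UNIV. V i x * ((1 / 2) * ((BG 1 i x * B 1 x + B 1 x * BG 1 i x) + (BG 2 i x * B 2 x + B 2 x * BG 2 i x) + (BG 3 i x * B 3 x + B 3 x * BG 3 i x)))) = 0"
    by (rule solenoidal_orthogonal_gradient[OF L V sq div b])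
  finally show ?thesis by simp
qed

text \<open>The z-derivative of the flux is minus the integral of a horizontal divergence, which
  vanishes by periodicity; exactness at the upper wall spreads to all heights.\<close>

lemma horizontal_flux_constant:
  assumes L: "0 < Lx" "0 < Ly" and B: "\<And>i. C1_field Lx Ly (B i) (BG i)"
    and div: "\<And>x. x \<in> slab \<Longrightarrow> (\<Sum>i\<in>UNIV. BG i i x) = 0"
    and flux: "integral (rect Lx Ly) (hsec (B 3) 1) = 0" and z: "z \<in> {0..1}"
  shows "integral (rect Lx Ly) (hsec (B 3) z) = 0"
proof -
  have d: "((\<lambda>z. integral (rect Lx Ly) (hsec (B 3) z)) has_real_derivative 0) (at z within {0..1})" if z: "z \<in> {0..1}" for z
  proof -
    note c = hsec_continuous[OF C1_field_continuous(2)[OF B] z]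
    have "integral (rect Lx Ly) (hsec (BG 3 3) z) = integral (rect Lx Ly) (\<lambda>p. - hsec (BG 1 1) z p - hsec (BG 2 2) z p)"
    proof (rule integral_cong)
      fix p :: "real \<times> real"
      have "(\<Sum>i\<in>UNIV. BG i i (point (fst p) (snd p) z)) = 0" using z by (intro div) auto
      then show "hsec (BG 3 3) z p = - hsec (BG 1 1) z p - hsec (BG 2 2) z p"
        by (simp add: hsec_def split_def sum_3)
    qed
    also have "\<dots> = integral (rect Lx Ly) (\<lambda>p. - hsec (BG 1 1) z p) - integral (rect Lx Ly) (hsec (BG 2 2) z)"
      by (intro integral_diff integrable_continuous continuous_intros c)
    also have "\<dots> = 0"
      using section_integral_partial_eq_0[OF L B _ z, of 1 1] section_integral_partial_eq_0[OF L B _ z, of 2 2] by simp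
    finally show ?thesis using horizontal_integral_deriv[OF B z, of 3] by simp
  qed
  have "integral (rect Lx Ly) (hsec (B 3) z) = integral (rect Lx Ly) (hsec (B 3) 1)"
    by (rule has_derivative_zero_unique[of "{0..1}" "\<lambda>z. integral (rect Lx Ly) (hsec (B 3) z)"])
      (use d z in \<open>auto simp: has_field_derivative_def lambda_zero\<close>)
  then show ?thesis using flux by simp
qed

text \<open>Excludes a nontrivial field with zero gradient. The wall conditions settle two
  components; a constant vertical field is compatible with them and is ruled out by the
  flux.\<close>

lemma magnetic_Poincare:
  fixes B :: "3 \<Rightarrow> real^3 \<Rightarrow> real"
  assumes L: "0 < Lx" "0 < Ly" and B: "\<And>i. C1_field Lx Ly (B i) (BG i)"
    and bdry: "\<And>i x. i \<noteq> 3 \<Longrightarrow> x $ 3 = 0 \<or> x $ 3 = 1 \<Longrightarrow> B i x = 0"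
    and flux: "\<And>z. z \<in> {0..1} \<Longrightarrow> integral (rect Lx Ly) (hsec (B 3) z) = 0"
    and G: "integral (cell Lx Ly) (\<lambda>x. \<Sum>i\<in>UNIV. \<Sum>j\<in>UNIV. (BG i j x)\<^sup>2) \<le> 0"
  shows "integral (cell Lx Ly) (\<lambda>x. (B i x)\<^sup>2) = 0"
proof -
  note c = C1_field_continuous[OF B]
  have nn: "0 \<le> integral (cell Lx Ly) (\<lambda>x. (BG i j x)\<^sup>2)" for i j
    by (intro cell_square_integral_nonneg c)
  have "integral (cell Lx Ly) (\<lambda>x. \<Sum>i\<in>UNIV. \<Sum>j\<in>UNIV. (BG i j x)\<^sup>2) =
      (\<Sum>i\<in>UNIV. integral (cell Lx Ly) (\<lambda>x. \<Sum>j\<in>UNIV. (BG i j x)\<^sup>2))"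
    by (intro cell_integral_sum continuous_intros c)
  also have "\<dots> = (\<Sum>i\<in>UNIV. \<Sum>j\<in>UNIV. integral (cell Lx Ly) (\<lambda>x. (BG i j x)\<^sup>2))"
    by (intro sum.cong refl cell_integral_sum continuous_intros c)
  finally have "(\<Sum>i\<in>UNIV. \<Sum>j\<in>UNIV. integral (cell Lx Ly) (\<lambda>x. (BG i j x)\<^sup>2)) \<le> 0"
    using G by simp
  then have "(\<Sum>i\<in>UNIV. \<Sum>j\<in>UNIV. integral (cell Lx Ly) (\<lambda>x. (BG i j x)\<^sup>2)) = 0"
    using nn by (intro antisym sum_nonneg)
  then have z: "integral (cell Lx Ly) (\<lambda>x. (BG i j x)\<^sup>2) = 0" for i j
    using nn by (simp add: sum_nonneg_eq_0_iff sum_nonneg)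
  have "integral (cell Lx Ly) (\<lambda>x. (B i x)\<^sup>2) \<le> 0"
  proof (cases "i = 3")
    case False
    then have "\<forall>x. x $ 3 = 0 \<or> x $ 3 = 1 \<longrightarrow> B i x = 0" using bdry[of i] by simp
    then have "integral (cell Lx Ly) (\<lambda>x. (B i x)\<^sup>2) \<le> integral (cell Lx Ly) (\<lambda>x. (BG i 3 x)\<^sup>2)"
      by (rule dirichlet_Poincare[OF B])
    then show ?thesis using z by simp
  next
    case True
    have cc: "continuous_on slab (\<lambda>x. (B 3 x)\<^sup>2)" "continuous_on slab (\<lambda>x. (BG 3 j x)\<^sup>2)" for j
      by (intro continuous_intros c)+
    have "integral (cell Lx Ly) (\<lambda>x. (B 3 x)\<^sup>2) = integral {0..1} (\<lambda>z. integral (rect Lx Ly) (hsec (\<lambda>x. (B 3 x)\<^sup>2) z))"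
      by (rule integral_cell_hsec(1)[OF cc(1)])
    also have "\<dots> \<le> integral {0..1} (\<lambda>z. Lx\<^sup>2 / 12 * integral (rect Lx Ly) (hsec (\<lambda>x. (BG 3 1 x)\<^sup>2) z) +
        Ly\<^sup>2 / 12 * integral (rect Lx Ly) (hsec (\<lambda>x. (BG 3 2 x)\<^sup>2) z))"
      by (intro integral_le integrable_continuous_real continuous_intros integral_cell_hsec(2)[OF cc(1)] integral_cell_hsec(2)[OF cc(2)])
        (use rect_Poincare[OF L C1_field_rect_C1[OF B] flux] in \<open>simp add: hsec_power\<close>)
    also have "\<dots> = Lx\<^sup>2 / 12 * integral (cell Lx Ly) (\<lambda>x. (BG 3 1 x)\<^sup>2) + Ly\<^sup>2 / 12 * integral (cell Lx Ly) (\<lambda>x. (BG 3 2 x)\<^sup>2)"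
      unfolding integral_cell_hsec(1)[OF cc(2)]
      by (subst integral_add) (auto intro!: integrable_continuous_real continuous_intros integral_cell_hsec(2)[OF cc(2)])
    finally show ?thesis using z True by simp
  qed
  then show ?thesis using cell_square_integral_nonneg[OF c(1)] by (intro antisym)
qed

text \<open>For the linear temperature profile and for the quadratic pressure that balances its
  buoyancy.\<close>

lemma C1_field_vertical:
  assumes "\<And>z. (f has_real_derivative f' z) (at z)" "continuous_on UNIV f'"
  shows "C1_field Lx Ly (\<lambda>x. f (x $ 3)) (\<lambda>i x. if i = 3 then f' (x $ 3) else 0)"
  unfolding C1_field_def
proof (intro conjI allI ballI)
  show "periodic_xy Lx Ly (\<lambda>x. f (x $ 3))" by (simp add: periodic_xy_def axis_def)
  show "continuous_on slab (\<lambda>x::real^3. if i = 3 then f' (x $ 3) else 0)" for i :: 3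
    by (cases "i = 3") (auto intro!: continuous_intros continuous_on_compose2[OF assms(2)])
  fix x :: "real^3"
  have "((\<lambda>x::real^3. x $ 3) has_derivative (\<lambda>h. h $ 3)) (at x within slab)"
    by (rule bounded_linear_imp_has_derivative[OF bounded_linear_vec_nth])
  from DERIV_compose_FDERIV[OF assms(1) this]
  show "((\<lambda>x. f (x $ 3)) has_derivative (\<lambda>h. \<Sum>i\<in>UNIV. (if i = 3 then f' (x $ 3) else 0) * h $ i)) (at x within slab)"
    by (simp add: sum_3 mult.commute)
qed

lemma cell_L2_triangle:
  fixes f g :: "real^3 \<Rightarrow> real"
  assumes "continuous_on slab f" "continuous_on slab g"
  shows "sqrt (integral (cell Lx Ly) (\<lambda>x. (f x - g x)\<^sup>2)) \<le>
    sqrt (integral (cell Lx Ly) (\<lambda>x. (f x)\<^sup>2)) + sqrt (integral (cell Lx Ly) (\<lambda>x. (g x)\<^sup>2))"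
proof -
  define a b c where "a = integral (cell Lx Ly) (\<lambda>x. (f x)\<^sup>2)" and "b = integral (cell Lx Ly) (\<lambda>x. (g x)\<^sup>2)"
    and "c = integral (cell Lx Ly) (\<lambda>x. f x * g x)"
  have ab: "0 \<le> a" "0 \<le> b" unfolding a_def b_def by (intro cell_square_integral_nonneg assms)+
  have H: "((\<lambda>x. (f x)\<^sup>2) has_integral a) (cell Lx Ly)" "((\<lambda>x. (g x)\<^sup>2) has_integral b) (cell Lx Ly)"
    "((\<lambda>x. f x * g x) has_integral c) (cell Lx Ly)"
    unfolding a_def b_def c_def by (intro integrable_integral cell_integrable continuous_intros assms)+
  have "((\<lambda>x. (f x)\<^sup>2 - 2 * (f x * g x) + (g x)\<^sup>2) has_integral (a - 2 * c + b)) (cell Lx Ly)"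
    by (intro has_integral_add has_integral_diff has_integral_mult_right H)
  then have "integral (cell Lx Ly) (\<lambda>x. (f x - g x)\<^sup>2) = a - 2 * c + b"
    by (intro integral_unique) (simp add: power2_diff algebra_simps)
  moreover have "\<bar>c\<bar> \<le> sqrt (a * b)"
    using cell_Cauchy_Schwarz[OF assms] by (intro real_le_rsqrt) (simp add: a_def b_def c_def)
  moreover have "(sqrt a + sqrt b)\<^sup>2 = a + 2 * sqrt (a * b) + b"
    using ab by (simp add: power2_sum real_sqrt_mult)
  ultimately have "integral (cell Lx Ly) (\<lambda>x. (f x - g x)\<^sup>2) \<le> (sqrt a + sqrt b)\<^sup>2" by linarith
  then have "sqrt (integral (cell Lx Ly) (\<lambda>x. (f x - g x)\<^sup>2)) \<le> sqrt ((sqrt a + sqrt b)\<^sup>2)"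
    by (rule real_sqrt_le_mono)
  then show ?thesis using ab by (simp add: a_def b_def)
qed

lemma le_if_le_quadratic_perturbation:
  fixes a b c d :: real
  assumes "\<And>\<epsilon>. 0 < \<epsilon> \<Longrightarrow> a \<le> b + c * \<epsilon>\<^sup>2 + d * \<epsilon>"
  shows "a \<le> b"
proof (rule tendsto_lowerbound)
  show "((\<lambda>\<epsilon>. b + c * \<epsilon>\<^sup>2 + d * \<epsilon>) \<longlongrightarrow> b) (at_right 0)"
    by (auto intro!: tendsto_eq_intros)
  show "\<forall>\<^sub>F \<epsilon> in at_right 0. a \<le> b + c * \<epsilon>\<^sup>2 + d * \<epsilon>"
    using assms by (auto simp: eventually_at_filter)
qed simp

text \<open>
  Linearity of the momentum equation splits \<open>U = V + W\<close>, where \<open>V\<close> is driven by (an approximation of)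
  the buoyancy and \<open>W\<close> by the Lorentz force. The Lorentz force does nonnegative work on \<open>W\<close> by viscous
  dissipation, and its work on \<open>V\<close> is controlled by the transport estimate.
\<close>

lemma lorentz_work_bound:
  fixes U B PG TG :: "3 \<Rightarrow> real^3 \<Rightarrow> real" and P T :: "real^3 \<Rightarrow> real"
    and UG BG TH :: "3 \<Rightarrow> 3 \<Rightarrow> real^3 \<Rightarrow> real" and UH :: "3 \<Rightarrow> 3 \<Rightarrow> 3 \<Rightarrow> real^3 \<Rightarrow> real"
  assumes L: "0 < Lx" "0 < Ly" and pos: "0 < Ek" "0 < \<Lambda>" "0 < Ra"
    and U: "\<And>i. C1_field Lx Ly (U i) (UG i)" "\<And>i j. C1_field Lx Ly (UG i j) (UH i j)"
    and B: "\<And>i. C1_field Lx Ly (B i) (BG i)" and P: "C1_field Lx Ly P PG"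
    and T: "C1_field Lx Ly T TG" "\<And>i. C1_field Lx Ly (TG i) (TH i)"
    and lapT: "periodic_xy Lx Ly (\<lambda>x. \<Sum>j\<in>UNIV. TH j j x)"
    and mom: "\<And>x i. x \<in> slab \<Longrightarrow> cross3 e_z (\<chi> i. U i x) $ i + PG i x - Ek * (\<Sum>j\<in>UNIV. UH i j j x) =
        \<Lambda> * lorentz B BG i x + Ra * T x * e_z $ i"
    and divU: "\<And>x. x \<in> slab \<Longrightarrow> (\<Sum>i\<in>UNIV. UG i i x) = 0"
    and bU: "\<And>x. x $ 3 = 0 \<or> x $ 3 = 1 \<Longrightarrow> U 3 x = 0"
      "\<And>i x. i \<noteq> 3 \<Longrightarrow> x $ 3 = 0 \<or> x $ 3 = 1 \<Longrightarrow> UG i 3 x = 0"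
    and bT: "\<And>x. x $ 3 = 0 \<Longrightarrow> T x = Tm" "\<And>x. x $ 3 = 1 \<Longrightarrow> T x = Tp"
    and bB: "\<And>i x. i \<noteq> 3 \<Longrightarrow> x $ 3 = 0 \<or> x $ 3 = 1 \<Longrightarrow> B i x = 0"
    and flux: "\<And>z. z \<in> {0..1} \<Longrightarrow> integral (rect Lx Ly) (hsec (B 3) z) = 0"
  shows "- integral (cell Lx Ly) (\<lambda>x. \<Sum>i\<in>UNIV. U i x * lorentz B BG i x) \<le>
    max Lx Ly * (max Lx Ly + 1 / 2) / (6 * sqrt (Lx * Ly)) * Ra *
      sqrt (integral (cell Lx Ly) (\<lambda>x. (\<Sum>j\<in>UNIV. TH j j x)\<^sup>2)) *
      integral (cell Lx Ly) (\<lambda>x. \<Sum>i\<in>UNIV. \<Sum>j\<in>UNIV. (BG i j x)\<^sup>2)"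
    (is "?I \<le> ?k * ?h * ?G")
proof (rule le_if_le_quadratic_perturbation)
  fix \<epsilon> :: real assume \<epsilon>: "0 < \<epsilon>"
  define h where "h x = (\<Sum>j\<in>UNIV. TH j j x)" for x
  define G where "G = integral (cell Lx Ly) (\<lambda>x. \<Sum>i\<in>UNIV. \<Sum>j\<in>UNIV. (BG i j x)\<^sup>2)"
  note cU = C1_field_continuous[OF U(1)] C1_field_continuous[OF U(2)]
    and cB = C1_field_continuous[OF B] and cT = C1_field_continuous[OF T(1)] C1_field_continuous[OF T(2)]
  have ch: "continuous_on slab h" unfolding h_def by (intro continuous_intros cT)
  have cF: "continuous_on slab (lorentz B BG i)" for i
    unfolding lorentz_def[abs_def] by (intro continuous_intros cB)
  have G0: "0 \<le> G" unfolding G_def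
    by (intro integral_nonneg cell_integrable continuous_intros cB) (auto intro!: sum_nonneg)
  have "0 < \<epsilon>\<^sup>2" using \<epsilon> by simp
  then obtain q where q: "tr_ok Lx Ly q" "tr_odd q" "integral (cell Lx Ly) (\<lambda>x. (h x - trig q x)\<^sup>2) < \<epsilon>\<^sup>2"
    using trig_dense_L2[OF L ch lapT[folded h_def]] by blast
  obtain v p \<theta> where
    ok: "\<And>i. tr_ok Lx Ly (v i)" "tr_ok Lx Ly p" "tr_ok Lx Ly \<theta>" and odd: "tr_odd \<theta>" "tr_odd (v 3)"
    and bv: "\<And>i x. i \<noteq> 3 \<Longrightarrow> x $ 3 = 0 \<or> x $ 3 = 1 \<Longrightarrow> trig (tr_d 3 (v i)) x = 0"
    and lap\<theta>: "\<And>x. (\<Sum>i\<in>UNIV. trig (tr_d i (tr_d i \<theta>)) x) = trig q x"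
    and divv: "\<And>x. (\<Sum>i\<in>UNIV. trig (tr_d i (v i)) x) = 0"
    and momv: "\<And>x. cross3 e_z (\<chi> i. trig (v i) x) + (\<chi> i. trig (tr_d i p) x) -
        Ek *\<^sub>R (\<chi> i. \<Sum>j\<in>UNIV. trig (tr_d j (tr_d j (v i))) x) = (Ra * trig \<theta> x) *\<^sub>R e_z"
    and mean: "\<And>i z. z \<in> {0..1} \<Longrightarrow> integral (rect Lx Ly) (hsec (trig (v i)) z) = 0"
    and sup: "\<And>z. z \<in> {0..1} \<Longrightarrow>
      (\<Sum>i\<in>UNIV. integral (rect Lx Ly) (\<lambda>y. (hsec (trig (tr_d 1 (v i))) z y)\<^sup>2) +
        integral (rect Lx Ly) (\<lambda>y. (hsec (trig (tr_d 2 (v i))) z y)\<^sup>2)) \<le> Ra\<^sup>2 / 3 * tr_ip Lx Ly q q"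
    by (rule rotating_stokes_solution[OF L pos(1) q(1,2), of Ra]) blast
  note V = trig_C1_field[OF ok(1)] and cV = trig_continuous[OF ok(1)]
  have bv3: "trig (v 3) x = 0" if "x $ 3 = 0 \<or> x $ 3 = 1" for x
    by (rule trig_odd_bdry[OF ok(1) odd(2) that])

  define W where "W i x = U i x - trig (v i) x" for i x
  define WG where "WG i j x = UG i j x - trig (tr_d j (v i)) x" for i j x
  define WH where "WH i j k x = UH i j k x - trig (tr_d k (tr_d j (v i))) x" for i j k x
  have W: "C1_field Lx Ly (W i) (WG i)" "C1_field Lx Ly (WG i j) (WH i j)" for i j
    unfolding W_def[abs_def] WG_def[abs_def] WH_def[abs_def]
    using ok(1) by (intro C1_field_diff U trig_C1_field; simp)+
  have bW: "W 3 x = 0" "i \<noteq> 3 \<Longrightarrow> WG i 3 x = 0" if "x $ 3 = 0 \<or> x $ 3 = 1" for i x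
    using that bU bv bv3 by (simp_all add: W_def WG_def)
  have divW: "(\<Sum>i\<in>UNIV. WG i i x) = 0" if "x \<in> slab" for x
    using divU[OF that] divv[of x] by (simp add: WG_def sum_subtractf)
  note cW = C1_field_continuous[OF W(1)] C1_field_continuous[OF W(2)]

  \<comment> \<open>The temperature left over once the linear profile with the wall values goes to
    the pressure and \<open>\<theta>\<close> goes to the flow \<open>v\<close>. It vanishes on the
    walls and has the small Laplacian \<open>h - trig q\<close>.\<close>
  define D where "D x = T x - (Tm + (Tp - Tm) * x $ 3) - trig \<theta> x" for x
  define DG where "DG i x = TG i x - (if i = 3 then Tp - Tm else 0) - trig (tr_d i \<theta>) x" for i x
  \<comment> \<open>The middle term is always zero and keeps the shape that
    \<open>C1_field_vertical\<close> delivers.\<close>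
  define DH where "DH i j x = TH i j x - (if j = 3 then 0 else 0) - trig (tr_d j (tr_d i \<theta>)) x" for i j x
  have D: "C1_field Lx Ly D DG"
    unfolding D_def[abs_def] DG_def[abs_def]
    by (intro C1_field_diff T trig_C1_field ok C1_field_vertical) (auto intro!: derivative_eq_intros)
  have DG: "C1_field Lx Ly (DG i) (DH i)" for i
    unfolding DG_def[abs_def] DH_def[abs_def] using ok(3)
    by (intro C1_field_diff T trig_C1_field C1_field_vertical[of "\<lambda>_. if i = 3 then Tp - Tm else 0"]) simp_all
  have bD: "D x = 0" if "x $ 3 = 0 \<or> x $ 3 = 1" for x
    using that bT[of x] trig_odd_bdry[OF ok(3) odd(1) that] by (auto simp: D_def)
  note cD = C1_field_continuous[OF D]
  have "integral (cell Lx Ly) (\<lambda>x. (D x)\<^sup>2) \<le> integral (cell Lx Ly) (\<lambda>x. (\<Sum>j\<in>UNIV. DH j j x)\<^sup>2)"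
    by (rule dirichlet_laplacian_bound[OF L D DG bD])
  also have "(\<lambda>x. \<Sum>j\<in>UNIV. DH j j x) = (\<lambda>x. h x - trig q x)"
    using lap\<theta> by (simp add: DH_def h_def sum_subtractf)
  finally have D\<epsilon>: "integral (cell Lx Ly) (\<lambda>x. (D x)\<^sup>2) \<le> \<epsilon>\<^sup>2" using q(3) by simp

  \<comment> \<open>Buoyancy that depends on z alone is a gradient, and \<open>\<pi>\<close> absorbs
    it.\<close>
  define \<pi> where "\<pi> x = P x - trig p x - Ra * (Tm * x $ 3 + (Tp - Tm) * (x $ 3)\<^sup>2 / 2)" for x
  define \<pi>G where "\<pi>G i x = PG i x - trig (tr_d i p) x - Ra * (if i = 3 then Tm + (Tp - Tm) * x $ 3 else 0)" for i x
  have \<pi>: "C1_field Lx Ly \<pi> \<pi>G"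
    unfolding \<pi>_def[abs_def] \<pi>G_def[abs_def]
    by (intro C1_field_diff P trig_C1_field ok C1_field_cmul C1_field_vertical[of "\<lambda>z. Tm * z + (Tp - Tm) * z\<^sup>2 / 2"])
      (auto intro!: derivative_eq_intros continuous_intros)
  note c\<pi> = C1_field_continuous[OF \<pi>]

  \<comment> \<open>Taking the product with \<open>W\<close> eliminates the Coriolis force.\<close>
  have momW: "(\<Sum>i\<in>UNIV. W i x * \<pi>G i x) - Ek * (\<Sum>i\<in>UNIV. W i x * (\<Sum>j\<in>UNIV. WH i j j x)) =
      \<Lambda> * (\<Sum>i\<in>UNIV. W i x * lorentz B BG i x) + Ra * (D x * W 3 x)" if x: "x \<in> slab" for x
  proof -
    define lU where "lU i = (\<Sum>j\<in>UNIV. UH i j j x)" for i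
    define lV where "lV i = (\<Sum>j\<in>UNIV. trig (tr_d j (tr_d j (v i))) x)" for i
    have lW: "(\<Sum>j\<in>UNIV. WH i j j x) = lU i - lV i" for i by (simp add: WH_def lU_def lV_def sum_subtractf)
    have u: "- U 2 x + PG 1 x - Ek * lU 1 = \<Lambda> * lorentz B BG 1 x"
      "U 1 x + PG 2 x - Ek * lU 2 = \<Lambda> * lorentz B BG 2 x"
      "PG 3 x - Ek * lU 3 = \<Lambda> * lorentz B BG 3 x + Ra * T x"
      using mom[OF x, of 1] mom[OF x, of 2] mom[OF x, of 3]
      by (simp_all add: cross3_def e_z_def axis_def lU_def)
    have w: "- trig (v 2) x + trig (tr_d 1 p) x - Ek * lV 1 = 0"
      "trig (v 1) x + trig (tr_d 2 p) x - Ek * lV 2 = 0"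
      "trig (tr_d 3 p) x - Ek * lV 3 = Ra * trig \<theta> x"
      using momv[of x] by (simp_all add: vec_eq_iff forall_3 cross3_def e_z_def axis_def lV_def)
    have e: "- W 2 x + \<pi>G 1 x - Ek * (lU 1 - lV 1) = \<Lambda> * lorentz B BG 1 x"
      "W 1 x + \<pi>G 2 x - Ek * (lU 2 - lV 2) = \<Lambda> * lorentz B BG 2 x"
      "\<pi>G 3 x - Ek * (lU 3 - lV 3) = \<Lambda> * lorentz B BG 3 x + Ra * D x"
      using u w by (simp_all add: W_def \<pi>G_def D_def algebra_simps)
    have "W 1 x * (- W 2 x + \<pi>G 1 x - Ek * (lU 1 - lV 1)) + W 2 x * (W 1 x + \<pi>G 2 x - Ek * (lU 2 - lV 2)) +
        W 3 x * (\<pi>G 3 x - Ek * (lU 3 - lV 3)) =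
        W 1 x * (\<Lambda> * lorentz B BG 1 x) + W 2 x * (\<Lambda> * lorentz B BG 2 x) + W 3 x * (\<Lambda> * lorentz B BG 3 x + Ra * D x)"
      unfolding e ..
    then show ?thesis unfolding lW sum_3 by (simp add: algebra_simps)
  qed
  define N where "N = integral (cell Lx Ly) (\<lambda>x. \<Sum>i\<in>UNIV. \<Sum>j\<in>UNIV. (WG i j x)\<^sup>2)"
  define w\<Lambda> where "w\<Lambda> = integral (cell Lx Ly) (\<lambda>x. \<Sum>i\<in>UNIV. W i x * lorentz B BG i x)"
  define DW where "DW = integral (cell Lx Ly) (\<lambda>x. D x * W 3 x)"
  have energy: "Ek * N = \<Lambda> * w\<Lambda> + Ra * DW"
  proof -
    have visc: "integral (cell Lx Ly) (\<lambda>x. \<Sum>i\<in>UNIV. W i x * (\<Sum>j\<in>UNIV. WH i j j x)) = - N"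
      unfolding N_def
    proof (rule green_identity_vector[OF L W])
      fix i :: 3 and x :: "real^3" assume "x $ 3 = 0 \<or> x $ 3 = 1"
      then show "W i x * WG i 3 x = 0" using bW(1)[of x] bW(2)[of x i] by (cases "i = 3") auto
    qed
    have "integral (cell Lx Ly) (\<lambda>x. \<Sum>i\<in>UNIV. W i x * \<pi>G i x) = 0"
      by (rule solenoidal_orthogonal_gradient[OF L W(1) \<pi> divW bW(1)])
    moreover have "(\<lambda>x. \<Sum>i\<in>UNIV. W i x * \<pi>G i x) integrable_on cell Lx Ly"
      by (intro cell_integrable continuous_intros cW c\<pi>)
    ultimately have I1: "((\<lambda>x. \<Sum>i\<in>UNIV. W i x * \<pi>G i x) has_integral 0) (cell Lx Ly)"
      by (simp add: has_integral_iff)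
    have I: "((\<lambda>x. \<Sum>i\<in>UNIV. W i x * (\<Sum>j\<in>UNIV. WH i j j x)) has_integral - N) (cell Lx Ly)"
      "((\<lambda>x. \<Sum>i\<in>UNIV. W i x * lorentz B BG i x) has_integral w\<Lambda>) (cell Lx Ly)"
      "((\<lambda>x. D x * W 3 x) has_integral DW) (cell Lx Ly)"
      unfolding visc[symmetric] w\<Lambda>_def DW_def
      by (intro integrable_integral cell_integrable continuous_intros cW cF cD)+
    have "((\<lambda>x. (\<Sum>i\<in>UNIV. W i x * \<pi>G i x) - Ek * (\<Sum>i\<in>UNIV. W i x * (\<Sum>j\<in>UNIV. WH i j j x))) has_integral 0 - Ek * - N) (cell Lx Ly)"
      by (intro has_integral_diff has_integral_mult_right I I1)
    moreover have "((\<lambda>x. \<Lambda> * (\<Sum>i\<in>UNIV. W i x * lorentz B BG i x) + Ra * (D x * W 3 x)) has_integral \<Lambda> * w\<Lambda> + Ra * DW) (cell Lx Ly)"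
      by (intro has_integral_add has_integral_mult_right I)
    then have "((\<lambda>x. (\<Sum>i\<in>UNIV. W i x * \<pi>G i x) - Ek * (\<Sum>i\<in>UNIV. W i x * (\<Sum>j\<in>UNIV. WH i j j x))) has_integral \<Lambda> * w\<Lambda> + Ra * DW) (cell Lx Ly)"
      by (rule has_integral_eq[rotated]) (simp add: momW subsetD[OF cell_subset_slab])
    ultimately have "0 - Ek * - N = \<Lambda> * w\<Lambda> + Ra * DW" by (rule has_integral_unique)
    then show ?thesis by simp
  qed
  have N0: "0 \<le> N" unfolding N_def
    by (intro integral_nonneg cell_integrable continuous_intros cW) (auto intro!: sum_nonneg)
  have "\<forall>x. x $ 3 = 0 \<or> x $ 3 = 1 \<longrightarrow> W 3 x = 0" using bW(1) by simp
  then have "integral (cell Lx Ly) (\<lambda>x. (W 3 x)\<^sup>2) \<le> integral (cell Lx Ly) (\<lambda>x. (WG 3 3 x)\<^sup>2)"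
    by (rule dirichlet_Poincare[OF W(1)])
  also have "\<dots> \<le> N"
    unfolding N_def by (intro integral_le cell_integrable continuous_intros cW) (simp add: sum_3)
  finally have W3: "integral (cell Lx Ly) (\<lambda>x. (W 3 x)\<^sup>2) \<le> N" .
  have "DW\<^sup>2 \<le> integral (cell Lx Ly) (\<lambda>x. (D x)\<^sup>2) * integral (cell Lx Ly) (\<lambda>x. (W 3 x)\<^sup>2)"
    unfolding DW_def by (intro cell_Cauchy_Schwarz cD cW)
  also have "\<dots> \<le> \<epsilon>\<^sup>2 * N"
    by (intro mult_mono D\<epsilon> W3) (auto intro!: cell_square_integral_nonneg cW)
  also have "\<dots> = (\<epsilon> * sqrt N)\<^sup>2" using N0 by (simp add: power_mult_distrib)
  finally have "\<bar>DW\<bar> \<le> \<epsilon> * sqrt N" using \<epsilon> N0 by (simp add: abs_le_square_iff[symmetric] abs_mult)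
  then have "Ra * DW \<le> Ra * (\<epsilon> * sqrt N)" using pos by (intro mult_left_mono) auto
  \<comment> \<open>Completing the square in \<open>sqrt N\<close>: viscous dissipation absorbs the
    temperature error up to a term of order \<epsilon>^2 / Ek.\<close>
  moreover have "Ra * (\<epsilon> * sqrt N) - Ek * N \<le> Ra\<^sup>2 * \<epsilon>\<^sup>2 / (4 * Ek)"
  proof -
    have "0 \<le> (Ra * \<epsilon> - 2 * Ek * sqrt N)\<^sup>2" by simp
    also have "\<dots> = Ra\<^sup>2 * \<epsilon>\<^sup>2 - 4 * Ek * (Ra * (\<epsilon> * sqrt N) - Ek * N)"
      using N0 by (simp add: power2_diff power_mult_distrib algebra_simps) (simp add: power2_eq_square)
    finally show ?thesis using pos by (simp add: field_simps)
  qed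
  ultimately have "\<Lambda> * (- w\<Lambda>) \<le> Ra\<^sup>2 * \<epsilon>\<^sup>2 / (4 * Ek)" using energy by linarith
  then have work_W: "- w\<Lambda> \<le> Ra\<^sup>2 * \<epsilon>\<^sup>2 / (4 * Ek * \<Lambda>)" using pos by (simp add: field_simps)

  define n where "n = sqrt (tr_ip Lx Ly q q)"
  have tq: "tr_ip Lx Ly q q = integral (cell Lx Ly) (\<lambda>x. (trig q x)\<^sup>2)" by (simp add: tr_ip_def power2_eq_square)
  have n0: "0 \<le> tr_ip Lx Ly q q" unfolding tq by (intro cell_square_integral_nonneg trig_continuous[OF q(1)])
  have "n = sqrt (integral (cell Lx Ly) (\<lambda>x. (h x - (h x - trig q x))\<^sup>2))" by (simp add: n_def tq)
  also have "\<dots> \<le> sqrt (integral (cell Lx Ly) (\<lambda>x. (h x)\<^sup>2)) + sqrt (integral (cell Lx Ly) (\<lambda>x. (h x - trig q x)\<^sup>2))"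
    by (intro cell_L2_triangle continuous_intros ch trig_continuous[OF q(1)])
  also have "sqrt (integral (cell Lx Ly) (\<lambda>x. (h x - trig q x)\<^sup>2)) \<le> \<epsilon>"
    using q(3) \<epsilon> by (intro real_le_lsqrt) auto
  finally have n: "n \<le> sqrt (integral (cell Lx Ly) (\<lambda>x. (h x)\<^sup>2)) + \<epsilon>" by simp
  \<comment> \<open>The root of the section bound that comes with \<open>v\<close>; its
    \<open>sqrt 3\<close> and the \<open>sqrt 12\<close> of the transport estimate make the 6 of the
    conclusion.\<close>
  define M where "M = Ra * n / sqrt 3"
  have M2: "M\<^sup>2 = Ra\<^sup>2 / 3 * tr_ip Lx Ly q q" using n0 by (simp add: M_def n_def power_mult_distrib power_divide)
  have M0: "0 \<le> M" using pos n0 by (simp add: M_def n_def)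
  have "\<bar>integral (cell Lx Ly) (\<lambda>x. \<Sum>i\<in>UNIV. \<Sum>j\<in>UNIV. trig (v i) x * B j x * BG i j x)\<bar> \<le>
      M * max Lx Ly * (max Lx Ly + 1 / 2) / sqrt (12 * (Lx * Ly)) * G"
    unfolding G_def
    by (rule transport_estimate[where V = "\<lambda>i. trig (v i)" and VG = "\<lambda>i j. trig (tr_d j (v i))" and B = B and BG = BG,
          OF L V B mean sup[folded M2] M0 flux bB])
  also have "M * max Lx Ly * (max Lx Ly + 1 / 2) / sqrt (12 * (Lx * Ly)) =
      max Lx Ly * (max Lx Ly + 1 / 2) / (6 * sqrt (Lx * Ly)) * Ra * n"
  proof -
    have "sqrt 3 * sqrt 12 = (6::real)" by (simp flip: real_sqrt_mult)
    then show ?thesis using L by (simp add: M_def real_sqrt_mult field_simps)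
  qed
  also have "\<dots> * G \<le> max Lx Ly * (max Lx Ly + 1 / 2) / (6 * sqrt (Lx * Ly)) * Ra *
      (sqrt (integral (cell Lx Ly) (\<lambda>x. (h x)\<^sup>2)) + \<epsilon>) * G"
    using G0 L pos n by (intro mult_right_mono mult_left_mono) auto
  also have "integral (cell Lx Ly) (\<lambda>x. \<Sum>i\<in>UNIV. \<Sum>j\<in>UNIV. trig (v i) x * B j x * BG i j x) =
      integral (cell Lx Ly) (\<lambda>x. \<Sum>i\<in>UNIV. trig (v i) x * lorentz B BG i x)"
    by (rule lorentz_work_solenoidal[where V = "\<lambda>i. trig (v i)" and VG = "\<lambda>i j. trig (tr_d j (v i))" and BG = BG,
          OF L V B, symmetric]) (simp_all add: divv bv3)
  finally have work_V: "- integral (cell Lx Ly) (\<lambda>x. \<Sum>i\<in>UNIV. trig (v i) x * lorentz B BG i x) \<le>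
      max Lx Ly * (max Lx Ly + 1 / 2) / (6 * sqrt (Lx * Ly)) * Ra *
      (sqrt (integral (cell Lx Ly) (\<lambda>x. (h x)\<^sup>2)) + \<epsilon>) * G"
    by linarith
  have "integral (cell Lx Ly) (\<lambda>x. \<Sum>i\<in>UNIV. U i x * lorentz B BG i x) =
    integral (cell Lx Ly) (\<lambda>x. (\<Sum>i\<in>UNIV. W i x * lorentz B BG i x) + (\<Sum>i\<in>UNIV. trig (v i) x * lorentz B BG i x))"
    by (simp add: W_def left_diff_distrib sum_subtractf)
  also have "\<dots> = w\<Lambda> + integral (cell Lx Ly) (\<lambda>x. \<Sum>i\<in>UNIV. trig (v i) x * lorentz B BG i x)"
    unfolding w\<Lambda>_def by (intro integral_add cell_integrable continuous_intros cW cF cV)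
  finally have "?I \<le> Ra\<^sup>2 * \<epsilon>\<^sup>2 / (4 * Ek * \<Lambda>) + ?k * (?h + \<epsilon>) * ?G"
    using work_W work_V unfolding h_def G_def by linarith
  moreover have "c * e\<^sup>2 / d + k * (h + e) * g = k * h * g + c / d * e\<^sup>2 + k * g * e" for c d e k h g :: real
    by (simp add: algebra_simps)
  ultimately show "?I \<le> ?k * ?h * ?G + Ra\<^sup>2 / (4 * Ek * \<Lambda>) * \<epsilon>\<^sup>2 + ?k * ?G * \<epsilon>"
    by (simp only:)
qed

section \<open>Smooth fields\<close>

lemma slab_has_derivative_unique:
  fixes f :: "real^3 \<Rightarrow> 'b::real_normed_vector"
  assumes "(f has_derivative f') (at x within slab)" "(f has_derivative f'') (at x within slab)" "x \<in> slab"
  shows "f' = f''"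
proof (rule frechet_derivative_unique_within[OF assms(1,2)])
  fix i :: "real^3" and e :: real assume i: "i \<in> Basis" and e: "0 < e"
  \<comment> \<open>The increment points towards the mid-plane and has length at most 1 / 2, so a
    vertical step stays in the slab even from a wall; for horizontal steps the sign is
    immaterial.\<close>
  define d where "d = (if x $ 3 \<le> 1 / 2 then min (e / 2) (1 / 2) else - min (e / 2) (1 / 2))"
  obtain k where "i = axis k 1" using i by (auto simp: Basis_vec_def)
  then have "(x + d *\<^sub>R i) $ 3 = x $ 3 \<or> (x + d *\<^sub>R i) $ 3 = x $ 3 + d"
    by (cases "k = 3") (auto simp: axis_def)
  then have "x + d *\<^sub>R i \<in> slab" using assms(3) e by (auto simp: slab_def d_def)
  moreover have "0 < \<bar>d\<bar>" "\<bar>d\<bar> < e" using e by (auto simp: d_def)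
  ultimately show "\<exists>d. 0 < \<bar>d\<bar> \<and> \<bar>d\<bar> < e \<and> x + d *\<^sub>R i \<in> slab" by blast
qed

lemma pderiv_at_eq:
  assumes "(f has_derivative f') (at x within slab)" "x \<in> slab"
  shows "pderiv_at i f x = f' (axis i 1)"
proof -
  have "(f has_derivative frechet_derivative f (at x within slab)) (at x within slab)"
    using assms(1) frechet_derivative_works by (auto simp: differentiable_def)
  then have "frechet_derivative f (at x within slab) = f'"
    using slab_has_derivative_unique assms by blast
  then show ?thesis by (simp add: pderiv_at_def)
qed

lemma C_k_on_cong:
  assumes "C_k_on k S f" "\<And>x. x \<in> S \<Longrightarrow> g x = f x"
  shows "C_k_on k S g"
  using assms by (cases k) (auto intro: continuous_on_eq has_derivative_transform)

lemma C_k_on_bounded_linear: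
  assumes "C_k_on k S f" "bounded_linear L"
  shows "C_k_on k S (\<lambda>x. L (f x))"
  using assms(1)
proof (induction k arbitrary: f)
  case 0
  then show ?case using assms(2) by (auto intro: bounded_linear.continuous_on)
next
  case (Suc k)
  then obtain f' where f': "\<And>x. x \<in> S \<Longrightarrow> (f has_derivative f' x) (at x within S)" "\<And>v. C_k_on k S (\<lambda>x. f' x v)" by auto
  then show ?case using Suc.IH
    by (auto intro!: exI[of _ "\<lambda>x v. L (f' x v)"] bounded_linear.has_derivative[OF assms(2)])
qed

text \<open>The derivative of a slice is the joint derivative applied to increments (0, v), which is
  a slice again, so the induction closes.\<close>

lemma C_k_on_slice:
  fixes F :: "real \<times> 'a::euclidean_space \<Rightarrow> 'b::real_normed_vector"
  assumes "C_k_on k (J \<times> S) F" "t \<in> J"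
  shows "C_k_on k S (\<lambda>x. F (t, x))"
  using assms(1)
proof (induction k arbitrary: F)
  case 0
  then show ?case using assms(2) by (auto intro!: continuous_on_compose2[of "J \<times> S" F] continuous_intros)
next
  case (Suc k)
  then obtain F' where F': "\<And>p. p \<in> J \<times> S \<Longrightarrow> (F has_derivative F' p) (at p within J \<times> S)"
    "\<And>v. C_k_on k (J \<times> S) (\<lambda>p. F' p v)" by auto
  have "((\<lambda>x. F (t, x)) has_derivative (\<lambda>v. F' (t, x) (0, v))) (at x within S)" if "x \<in> S" for x
  proof (rule has_derivative_in_compose[where f = "\<lambda>x. (t, x)"])
    show "(Pair t has_derivative Pair 0) (at x within S)"
      by (auto intro!: derivative_eq_intros)
    show "(F has_derivative F' (t, x)) (at (t, x) within Pair t ` S)"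
      by (rule has_derivative_subset[OF F'(1)]) (use that assms(2) in auto)
  qed
  moreover have "C_k_on k S (\<lambda>x. F' (t, x) (0, v))" for v
    by (rule Suc.IH[OF F'(2)])
  ultimately show ?case by (auto intro!: exI[of _ "\<lambda>x v. F' (t, x) (0, v)"])
qed

lemma C_k_on_pderiv_at:
  assumes "C_k_on (Suc k) slab f"
  shows "C_k_on k slab (pderiv_at i f)"
proof -
  obtain f' where f': "\<And>x. x \<in> slab \<Longrightarrow> (f has_derivative f' x) (at x within slab)" "\<And>v. C_k_on k slab (\<lambda>x. f' x v)"
    using assms by auto
  show ?thesis by (rule C_k_on_cong[OF f'(2)[of "axis i 1"]]) (rule pderiv_at_eq[OF f'(1)])
qed

lemma smooth_on_pderiv_at: "smooth_on slab f \<Longrightarrow> smooth_on slab (pderiv_at i f)"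
  unfolding smooth_on_def by (rule allI, rule C_k_on_pderiv_at, erule spec)

lemma smooth_on_component: "smooth_on S f \<Longrightarrow> smooth_on S (\<lambda>x. f x $ i)" for f :: "'a::euclidean_space \<Rightarrow> real^'n"
  unfolding smooth_on_def by (intro allI C_k_on_bounded_linear[OF _ bounded_linear_vec_nth]) (erule spec)

lemma smooth_on_slice:
  fixes F :: "real \<Rightarrow> 'a::euclidean_space \<Rightarrow> 'b::real_normed_vector"
  assumes "smooth_on (J \<times> S) (\<lambda>(t, x). F t x)" "t \<in> J"
  shows "smooth_on S (F t)"
  unfolding smooth_on_def
proof
  fix k
  have "C_k_on k (J \<times> S) (\<lambda>(t, x). F t x)" using assms(1) by (simp only: smooth_on_def)
  from C_k_on_slice[OF this assms(2)] show "C_k_on k S (F t)" by simp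
qed

lemma smooth_on_has_derivative:
  assumes "smooth_on S f"
  obtains f' where "\<And>x. x \<in> S \<Longrightarrow> (f has_derivative f' x) (at x within S)" "\<And>v. continuous_on S (\<lambda>x. f' x v)"
proof -
  have "C_k_on (Suc 0) S f" using assms unfolding smooth_on_def by blast
  then show ?thesis using that by auto
qed

text \<open>Horizontal translations map the slab to itself, so one-sided derivatives are compared
  with one-sided derivatives.\<close>

lemma periodic_xy_pderiv_at:
  fixes f :: "real^3 \<Rightarrow> 'b::real_normed_vector"
  assumes f: "smooth_on slab f" and per: "periodic_xy Lx Ly f"
  shows "periodic_xy Lx Ly (pderiv_at i f)"
proof -
  obtain f' where f': "\<And>x. x \<in> slab \<Longrightarrow> (f has_derivative f' x) (at x within slab)"
    by (rule smooth_on_has_derivative[OF f]) blast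
  have tr: "pderiv_at i f (x + a) = pderiv_at i f x"
    if a: "a $ 3 = 0" and p: "\<And>x. x \<in> slab \<Longrightarrow> f (x + a) = f x" and x: "x \<in> slab" for a x
  proof -
    have s: "y + a \<in> slab" if "y \<in> slab" for y using that a by (simp add: slab_def)
    have "((\<lambda>y. f (y + a)) has_derivative (\<lambda>v. f' (x + a) v)) (at x within slab)"
      by (rule has_derivative_in_compose[where f = "\<lambda>y. y + a"], auto intro!: derivative_eq_intros)
        (rule has_derivative_subset[OF f'], use s x in auto)
    then have "(f has_derivative f' (x + a)) (at x within slab)"
      by (rule has_derivative_transform[rotated 2]) (use p x in auto)
    then show ?thesis using pderiv_at_eq[OF f'[OF s[OF x]] s[OF x]] pderiv_at_eq[of f "f' (x + a)" x i] x by simp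
  qed
  show ?thesis using per unfolding periodic_xy_def
    by (intro ballI conjI tr) (auto simp: axis_def)
qed

lemma smooth_C1_field:
  assumes f: "smooth_on slab f" and per: "periodic_xy Lx Ly f"
  shows "C1_field Lx Ly f (\<lambda>i. pderiv_at i f)"
proof -
  obtain f' where f': "\<And>x. x \<in> slab \<Longrightarrow> (f has_derivative f' x) (at x within slab)"
    by (rule smooth_on_has_derivative[OF f]) blast
  have "(f has_derivative (\<lambda>h. \<Sum>i\<in>UNIV. pderiv_at i f x * h $ i)) (at x within slab)" if x: "x \<in> slab" for x
  proof (rule has_derivative_eq_rhs[OF f'[OF x]])
    interpret bounded_linear "f' x" by (rule has_derivative_bounded_linear[OF f'[OF x]])
    have "f' x h = (\<Sum>i\<in>UNIV. pderiv_at i f x * h $ i)" for h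
    proof -
      have "h = (\<Sum>i\<in>UNIV. h $ i *\<^sub>R axis i 1)" by (simp add: vec_eq_iff sum_3 forall_3 axis_def)
      then have "f' x h = f' x (\<Sum>i\<in>UNIV. h $ i *\<^sub>R axis i 1)" by (rule arg_cong)
      also have "\<dots> = (\<Sum>i\<in>UNIV. f' x (h $ i *\<^sub>R axis i 1))" by (rule sum)
      also have "\<dots> = (\<Sum>i\<in>UNIV. h $ i *\<^sub>R f' x (axis i 1))" by (simp add: scale)
      finally show ?thesis by (simp add: pderiv_at_eq[OF f'[OF x] x] mult.commute)
    qed
    then show "f' x = (\<lambda>h. \<Sum>i\<in>UNIV. pderiv_at i f x * h $ i)" by blast
  qed
  moreover have "continuous_on slab (pderiv_at i f)" for i
    using smooth_on_pderiv_at[OF f, unfolded smooth_on_def, THEN spec, of 0] by simp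
  ultimately show ?thesis using per by (simp add: C1_field_def)
qed

lemma C1_field_pderiv_at:
  assumes "C1_field Lx Ly f g" "x \<in> slab"
  shows "pderiv_at i f x = g i x"
proof -
  have "(f has_derivative (\<lambda>h. \<Sum>i\<in>UNIV. g i x * h $ i)) (at x within slab)"
    using assms by (simp add: C1_field_def)
  from pderiv_at_eq[OF this assms(2), of i] show ?thesis
    using exhaust_3[of i] by (auto simp: sum_3 axis_def)
qed

lemma pderiv_at_cong:
  assumes f: "smooth_on slab f" and eq: "\<And>y. y \<in> slab \<Longrightarrow> g y = f y" and x: "x \<in> slab"
  shows "pderiv_at i g x = pderiv_at i f x"
proof -
  obtain f' where f': "(f has_derivative f') (at x within slab)"
    by (rule smooth_on_has_derivative[OF f]) (use x in blast)
  then have "(g has_derivative f') (at x within slab)"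
    by (rule has_derivative_transform[rotated 2]) (use eq x in auto)
  then show ?thesis using pderiv_at_eq f' x by metis
qed

lemma pderiv_at_component:
  fixes f :: "real^3 \<Rightarrow> real^'n"
  assumes f: "smooth_on slab f" and x: "x \<in> slab"
  shows "pderiv_at i f x $ k = pderiv_at i (\<lambda>y. f y $ k) x"
proof -
  obtain f' where f': "(f has_derivative f') (at x within slab)"
    by (rule smooth_on_has_derivative[OF f]) (use x in blast)
  then have "((\<lambda>y. f y $ k) has_derivative (\<lambda>h. f' h $ k)) (at x within slab)"
    by (rule bounded_linear.has_derivative[OF bounded_linear_vec_nth])
  then show ?thesis using pderiv_at_eq f' x by metis
qed

lemma laplacian_component:
  fixes f :: "real^3 \<Rightarrow> real^'n"
  assumes f: "smooth_on slab f" and x: "x \<in> slab"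
  shows "laplacian f x $ k = (\<Sum>j\<in>UNIV. pderiv_at j (pderiv_at j (\<lambda>y. f y $ k)) x)"
proof -
  have "pderiv_at j (pderiv_at j f) x $ k = pderiv_at j (pderiv_at j (\<lambda>y. f y $ k)) x" for j
  proof -
    have "pderiv_at j (pderiv_at j f) x $ k = pderiv_at j (\<lambda>y. pderiv_at j f y $ k) x"
      by (rule pderiv_at_component[OF smooth_on_pderiv_at[OF f] x])
    also have "\<dots> = pderiv_at j (pderiv_at j (\<lambda>y. f y $ k)) x"
      by (rule pderiv_at_cong[OF smooth_on_pderiv_at[OF smooth_on_component[OF f]] _ x])
        (rule pderiv_at_component[OF f])
    finally show ?thesis .
  qed
  then show ?thesis by (simp add: laplacian_def sum_component)
qed

text \<open>The equations are imposed for 0 < z < 1 only. Continuity carries them to the walls,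
  where the solenoidal condition on B supplies a further boundary value.\<close>

lemma slab_eq_extend:
  fixes f g :: "real^3 \<Rightarrow> real"
  assumes c: "continuous_on slab f" "continuous_on slab g"
    and fg: "\<And>x. 0 < x $ 3 \<Longrightarrow> x $ 3 < 1 \<Longrightarrow> f x = g x" and x: "x \<in> slab"
  shows "f x = g x"
proof -
  define I where "I = {x :: real^3. 0 < x $ 3 \<and> x $ 3 < 1}"
  have cl: "closure I \<subseteq> slab"
  proof (rule closure_minimal)
    show "I \<subseteq> slab" by (auto simp: I_def slab_def)
    have eq: "slab = {x :: real^3. 0 \<le> x $ 3} \<inter> {x. x $ 3 \<le> 1}" by (auto simp: slab_def)
    show "closed slab" unfolding eq by (intro closed_Int closed_Collect_le continuous_intros)
  qed
  have "x \<in> closure I"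
    unfolding closure_approachable
  proof (intro allI impI)
    fix e :: real assume e: "0 < e"
    define d where "d = min (e / 2) (1 / 2)"
    \<comment> \<open>A small shift of x towards the mid-plane lies strictly inside.\<close>
    define y where "y = x + (d * (1 / 2 - x $ 3)) *\<^sub>R axis 3 1"
    have d: "0 < d" "d < e" "d \<le> 1 / 2" using e by (auto simp: d_def)
    have x3: "0 \<le> x $ 3" "x $ 3 \<le> 1" using x by (auto simp: slab_def)
    have "y $ 3 = (1 - d) * x $ 3 + d * (1 / 2)" by (simp add: y_def algebra_simps)
    moreover have "0 \<le> (1 - d) * x $ 3" using d x3 by auto
    moreover have "(1 - d) * x $ 3 \<le> 1 - d" using mult_left_mono[of "x $ 3" 1 "1 - d"] d x3 by simp
    ultimately have "0 < y $ 3" "y $ 3 < 1" using d by linarith+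
    then have "y \<in> I" by (simp add: I_def)
    moreover have "dist y x < e"
    proof -
      have "dist y x = d * \<bar>1 / 2 - x $ 3\<bar>" using d by (simp add: y_def dist_norm abs_mult norm_axis_1)
      also have "\<dots> \<le> d * 1" using d x3 by (intro mult_left_mono) auto
      finally show ?thesis using d by simp
    qed
    ultimately show "\<exists>y\<in>I. dist y x < e" by blast
  qed
  moreover have "continuous_on (closure I) (\<lambda>x. f x - g x)"
    by (intro continuous_on_diff continuous_on_subset[OF c(1) cl] continuous_on_subset[OF c(2) cl])
  ultimately have "f x - g x = 0"
    by (rule continuous_constant_on_closure[where S = I and f = "\<lambda>x. f x - g x" and a = 0, rotated 2])
      (simp_all add: I_def fg)
  then show ?thesis by simp
qed

lemma C1_field_bdry_partial:
  assumes f: "C1_field Lx Ly f g" and c: "x $ 3 = c" "c \<in> {0..1}" and i: "i \<noteq> 3"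
    and z: "\<And>y. y $ 3 = c \<Longrightarrow> f y = 0"
  shows "g i x = 0"
proof -
  have "((\<lambda>s. f (point s (x $ 2) c)) has_real_derivative g 1 (point (x $ 1) (x $ 2) c)) (at (x $ 1))"
    "((\<lambda>s. f (point (x $ 1) s c)) has_real_derivative g 2 (point (x $ 1) (x $ 2) c)) (at (x $ 2))"
    by (rule C1_field_partial[OF f c(2)])+
  moreover have "(\<lambda>s. f (point s (x $ 2) c)) = (\<lambda>s. 0)" "(\<lambda>s. f (point (x $ 1) s c)) = (\<lambda>s. 0)"
    using z by auto
  ultimately have "g 1 (point (x $ 1) (x $ 2) c) = 0" "g 2 (point (x $ 1) (x $ 2) c) = 0"
    using DERIV_unique DERIV_const by metis+
  then show ?thesis using i exhaust_3[of i] c(1) point_eq[of x] by auto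
qed

text \<open>Differentiation under the integral sign. As \<open>time_deriv\<close> is defined point
  by point, its continuity in space comes from identifying it with the joint derivative in the
  direction (1, 0).\<close>

lemma magnetic_energy_derivative:
  fixes B :: "real \<Rightarrow> real^3 \<Rightarrow> real^3"
  assumes J: "is_interval J" "interior J \<noteq> {}" and B: "smooth_on (J \<times> slab) (\<lambda>(t, x). B t x)" and t: "t \<in> J"
  shows "vector_derivative (\<lambda>s. magnetic_energy Lx Ly (B s)) (at t within J) =
      integral (cell Lx Ly) (\<lambda>x. B t x \<bullet> time_deriv J B t x)"
    and "continuous_on slab (time_deriv J B t)"
proof -
  obtain F' where F': "\<And>p. p \<in> J \<times> slab \<Longrightarrow> ((\<lambda>(t, x). B t x) has_derivative F' p) (at p within J \<times> slab)"
    "\<And>v. continuous_on (J \<times> slab) (\<lambda>p. F' p v)"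
    by (rule smooth_on_has_derivative[OF B]) blast
  have cB: "continuous_on (J \<times> slab) (\<lambda>(t, x). B t x)"
    using F'(1) by (rule has_derivative_continuous_on)
  \<comment> \<open>An interval with nonempty interior has no isolated points, so derivatives within
    \<open>J\<close> are unique, also at an end point.\<close>
  have nontriv: "at s within J \<noteq> bot" if "s \<in> J" for s
  proof -
    have "J \<noteq> {x}" for x using J(2) by auto
    then have "s islimpt J"
      using connected_imp_perfect[OF is_interval_connected[OF J(1)] that] by blast
    then show ?thesis by (simp add: trivial_limit_within)
  qed
  define Bt where "Bt s x = F' (s, x) (1, 0)" for s x
  have d: "((\<lambda>s. B s x) has_vector_derivative Bt s x) (at s within J)" if "s \<in> J" "x \<in> slab" for s x
  proof -
    have D: "((\<lambda>s. (case (s, x) of (t, x) \<Rightarrow> B t x)) has_derivative (\<lambda>h. F' (s, x) (h, 0))) (at s within J)"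
    proof (rule has_derivative_in_compose[where f = "\<lambda>s. (s, x)"])
      show "((\<lambda>s. (s, x)) has_derivative (\<lambda>h. (h, 0))) (at s within J)" by (auto intro!: derivative_eq_intros)
      show "((\<lambda>(t, x). B t x) has_derivative F' (s, x)) (at (s, x) within (\<lambda>s. (s, x)) ` J)"
        by (rule has_derivative_subset[OF F'(1)]) (use that in auto)
    qed
    have E: "F' (s, x) (h, 0) = h *\<^sub>R F' (s, x) (1, 0)" for h
    proof -
      interpret bounded_linear "F' (s, x)" by (rule has_derivative_bounded_linear[OF F'(1)]) (use that in auto)
      show ?thesis using scale[of h "(1, 0)"] by simp
    qed
    show ?thesis unfolding has_vector_derivative_def Bt_def
      by (rule has_derivative_eq_rhs[OF D[unfolded split_conv]]) (rule ext, rule E)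
  qed
  have td: "time_deriv J B s x = Bt s x" if "s \<in> J" "x \<in> slab" for s x
    unfolding time_deriv_def by (rule vector_derivative_within[OF nontriv[OF that(1)] d[OF that]])
  have cBt: "continuous_on (J \<times> slab) (\<lambda>(t, x). Bt t x)"
    using F'(2)[of "(1, 0)"] by (simp add: Bt_def split_def)
  have pair: "continuous_on S (Pair s)" for S :: "(real^3) set" and s :: real
    by (intro continuous_on_Pair continuous_on_const continuous_on_id)
  have "continuous_on slab (\<lambda>x. (\<lambda>(s, x). Bt s x) (t, x))"
    by (rule continuous_on_compose2[OF cBt pair]) (use t in auto)
  then have "continuous_on slab (Bt t)" by simp
  then show "continuous_on slab (time_deriv J B t)"
    by (rule continuous_on_eq) (simp add: td t)
  have "((\<lambda>s. integral (cbox 0 (vector [Lx, Ly, 1])) (\<lambda>x. B s x \<bullet> B s x)) has_vector_derivative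
      integral (cbox 0 (vector [Lx, Ly, 1])) (\<lambda>x. 2 * (B t x \<bullet> Bt t x))) (at t within J)"
  proof (rule leibniz_rule_vector_derivative)
    have sub: "x \<in> cbox 0 (vector [Lx, Ly, 1]) \<Longrightarrow> x \<in> slab" for x
      using cell_subset_slab[of Lx Ly] by (auto simp: cell_def)
    show "((\<lambda>s. B s x \<bullet> B s x) has_vector_derivative 2 * (B s x \<bullet> Bt s x)) (at s within J)"
      if "s \<in> J" "x \<in> cbox 0 (vector [Lx, Ly, 1])" for s x
      using bounded_bilinear.has_vector_derivative[OF bounded_bilinear_inner d[OF that(1) sub[OF that(2)]] d[OF that(1) sub[OF that(2)]]]
      by (simp add: inner_commute)
    show "continuous_on (J \<times> cbox 0 (vector [Lx, Ly, 1])) (\<lambda>(s, x). 2 * (B s x \<bullet> Bt s x))"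
    proof -
      have "continuous_on (J \<times> cbox 0 (vector [Lx, Ly, 1])) (\<lambda>p. B (fst p) (snd p))"
        "continuous_on (J \<times> cbox 0 (vector [Lx, Ly, 1])) (\<lambda>p. Bt (fst p) (snd p))"
        using continuous_on_subset[OF cB, of "J \<times> cbox 0 (vector [Lx, Ly, 1])"]
          continuous_on_subset[OF cBt, of "J \<times> cbox 0 (vector [Lx, Ly, 1])"] sub
        by (auto simp: split_def)
      then show ?thesis unfolding split_def by (intro continuous_on_mult continuous_on_const continuous_on_inner)
    qed
    show "(\<lambda>x. B s x \<bullet> B s x) integrable_on cbox 0 (vector [Lx, Ly, 1])" if s: "s \<in> J" for s
    proof (rule integrable_continuous)
      have "continuous_on (cbox 0 (vector [Lx, Ly, 1])) (\<lambda>x. (\<lambda>(s, x). B s x) (s, x))"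
        by (rule continuous_on_compose2[OF cB pair]) (use s sub in auto)
      then show "continuous_on (cbox 0 (vector [Lx, Ly, 1])) (\<lambda>x. B s x \<bullet> B s x)"
        by (simp add: continuous_on_inner)
    qed
    show "t \<in> J" by (rule t)
    show "convex J" using J(1) by (simp add: is_interval_convex_1)
  qed
  then have "((\<lambda>s. (1 / 2) *\<^sub>R integral (cell Lx Ly) (\<lambda>x. B s x \<bullet> B s x)) has_vector_derivative
      (1 / 2) *\<^sub>R integral (cell Lx Ly) (\<lambda>x. 2 * (B t x \<bullet> Bt t x))) (at t within J)"
    unfolding cell_def by (rule bounded_linear.has_vector_derivative[OF bounded_linear_scaleR_right])
  then have "((\<lambda>s. magnetic_energy Lx Ly (B s)) has_vector_derivative integral (cell Lx Ly) (\<lambda>x. B t x \<bullet> Bt t x)) (at t within J)"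
    by (simp add: magnetic_energy_def[abs_def] power2_norm_eq_inner)
  then have "vector_derivative (\<lambda>s. magnetic_energy Lx Ly (B s)) (at t within J) = integral (cell Lx Ly) (\<lambda>x. B t x \<bullet> Bt t x)"
    by (rule vector_derivative_within[OF nontriv[OF t]])
  also have "\<dots> = integral (cell Lx Ly) (\<lambda>x. B t x \<bullet> time_deriv J B t x)"
    by (rule integral_cong) (simp add: td t subsetD[OF cell_subset_slab])
  finally show "vector_derivative (\<lambda>s. magnetic_energy Lx Ly (B s)) (at t within J) =
      integral (cell Lx Ly) (\<lambda>x. B t x \<bullet> time_deriv J B t x)" .
qed

section \<open>The energy balance\<close>

text \<open>Here \<open>E\<close> is the electromotive field \<open>u \<times> B\<close>; its tangential boundary terms vanish because \<open>B\<close> is vertical there.\<close>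

lemma induction_work:
  fixes U B E :: "3 \<Rightarrow> real^3 \<Rightarrow> real"
  assumes L: "0 < Lx" "0 < Ly" and U: "\<And>i. continuous_on slab (U i)"
    and B: "\<And>i. C1_field Lx Ly (B i) (BG i)" and E: "\<And>i. C1_field Lx Ly (E i) (EG i)"
    and E_eq: "\<And>x. E 1 x = U 2 x * B 3 x - U 3 x * B 2 x" "\<And>x. E 2 x = U 3 x * B 1 x - U 1 x * B 3 x"
      "\<And>x. E 3 x = U 1 x * B 2 x - U 2 x * B 1 x"
    and bB: "\<And>i x. i \<noteq> 3 \<Longrightarrow> x $ 3 = 0 \<or> x $ 3 = 1 \<Longrightarrow> B i x = 0"
  shows "integral (cell Lx Ly) (\<lambda>x. B 1 x * (EG 3 2 x - EG 2 3 x) + B 2 x * (EG 1 3 x - EG 3 1 x) + B 3 x * (EG 2 1 x - EG 1 2 x)) =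
    - integral (cell Lx Ly) (\<lambda>x. \<Sum>i\<in>UNIV. U i x * lorentz B BG i x)"
proof -
  note c = U C1_field_continuous[OF B] C1_field_continuous[OF E]
  have ib: "((\<lambda>x. B i x * EG k j x + BG i j x * E k x) has_integral 0) (cell Lx Ly)" if "i \<noteq> 3 \<or> j \<noteq> 3" for i j k
  proof -
    have "integral (cell Lx Ly) (\<lambda>x. B i x * EG k j x) = - integral (cell Lx Ly) (\<lambda>x. BG i j x * E k x)"
      by (rule integral_by_parts_cell[OF L B E]) (use that bB in auto)
    moreover have "((\<lambda>x. B i x * EG k j x + BG i j x * E k x) has_integral
        (integral (cell Lx Ly) (\<lambda>x. B i x * EG k j x) + integral (cell Lx Ly) (\<lambda>x. BG i j x * E k x))) (cell Lx Ly)"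
      by (intro has_integral_add integrable_integral cell_integrable continuous_intros c)
    ultimately show ?thesis by simp
  qed
  have cF: "continuous_on slab (lorentz B BG i)" for i
    unfolding lorentz_def[abs_def] by (intro continuous_intros c)
  \<comment> \<open>The six integrations by parts behind B . curl E. Pointwise, the terms with the
    gradient of B add up to - (curl B) . (U x B), which equals U . ((curl B) x B).\<close>
  have "((\<lambda>x. (B 1 x * EG 3 2 x + BG 1 2 x * E 3 x) - (B 1 x * EG 2 3 x + BG 1 3 x * E 2 x) +
      ((B 2 x * EG 1 3 x + BG 2 3 x * E 1 x) - (B 2 x * EG 3 1 x + BG 2 1 x * E 3 x)) +
      ((B 3 x * EG 2 1 x + BG 3 1 x * E 2 x) - (B 3 x * EG 1 2 x + BG 3 2 x * E 1 x))) has_integral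
      (0 - 0 + (0 - 0) + (0 - 0))) (cell Lx Ly)"
    by (intro has_integral_add has_integral_diff ib) auto
  moreover have "(\<lambda>x. (B 1 x * EG 3 2 x + BG 1 2 x * E 3 x) - (B 1 x * EG 2 3 x + BG 1 3 x * E 2 x) +
      ((B 2 x * EG 1 3 x + BG 2 3 x * E 1 x) - (B 2 x * EG 3 1 x + BG 2 1 x * E 3 x)) +
      ((B 3 x * EG 2 1 x + BG 3 1 x * E 2 x) - (B 3 x * EG 1 2 x + BG 3 2 x * E 1 x))) =
      (\<lambda>x. (B 1 x * (EG 3 2 x - EG 2 3 x) + B 2 x * (EG 1 3 x - EG 3 1 x) + B 3 x * (EG 2 1 x - EG 1 2 x)) +
        (\<Sum>i\<in>UNIV. U i x * lorentz B BG i x))"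
    by (rule ext) (simp add: E_eq sum_3 lorentz_def algebra_simps)
  ultimately have "integral (cell Lx Ly) (\<lambda>x. (B 1 x * (EG 3 2 x - EG 2 3 x) + B 2 x * (EG 1 3 x - EG 3 1 x) + B 3 x * (EG 2 1 x - EG 1 2 x)) +
        (\<Sum>i\<in>UNIV. U i x * lorentz B BG i x)) = 0"
    by (simp add: integral_unique)
  moreover have "integral (cell Lx Ly) (\<lambda>x. (B 1 x * (EG 3 2 x - EG 2 3 x) + B 2 x * (EG 1 3 x - EG 3 1 x) + B 3 x * (EG 2 1 x - EG 1 2 x)) +
        (\<Sum>i\<in>UNIV. U i x * lorentz B BG i x)) =
      integral (cell Lx Ly) (\<lambda>x. B 1 x * (EG 3 2 x - EG 2 3 x) + B 2 x * (EG 1 3 x - EG 3 1 x) + B 3 x * (EG 2 1 x - EG 1 2 x)) +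
      integral (cell Lx Ly) (\<lambda>x. \<Sum>i\<in>UNIV. U i x * lorentz B BG i x)"
    by (intro integral_add cell_integrable continuous_intros c cF)
  ultimately show ?thesis by simp
qed

text \<open>With l the larger period, \<open>C_P\<close> is at least l / (2 pi) and at least 1 / pi;
  the first pays for l and the second for the summand 1 / 2, while the maximum in \<open>A_2\<close>
  contributes its 3.\<close>

lemma A_2_lower_bound:
  assumes L: "0 < Lx" "0 < Ly"
  shows "max Lx Ly * (max Lx Ly + 1 / 2) / (6 * sqrt (Lx * Ly)) \<le> A_2 Lx Ly"
proof -
  define l s where "l = max Lx Ly" and "s = sqrt (Lx * Ly)"
  have l: "0 < l" using L by (auto simp: l_def)
  have s: "0 < s" "s\<^sup>2 = Lx * Ly" using L by (simp_all add: s_def)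
  have r: "max (Lx / Ly) (Ly / Lx) = (l / s)\<^sup>2"
  proof (cases "Lx \<le> Ly")
    case True
    then have "Lx / Ly \<le> 1" "1 \<le> Ly / Lx" using L by simp_all
    then have "max (Lx / Ly) (Ly / Lx) = Ly / Lx" by simp
    then show ?thesis using True L by (simp add: l_def power_divide s(2)) (simp add: power2_eq_square)
  next
    case False
    then have "1 \<le> Lx / Ly" "Ly / Lx \<le> 1" using L by simp_all
    then have "max (Lx / Ly) (Ly / Lx) = Lx / Ly" by simp
    then show ?thesis using False L by (simp add: l_def power_divide s(2)) (simp add: power2_eq_square)
  qed
  have "(C_L Lx Ly)\<^sup>2 = sqrt (3 * pi / 32 * max (Lx / Ly) (Ly / Lx))"
    unfolding C_L_def r using l s by (simp add: powr_half_sqrt powr_powr flip: powr_numeral)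
  also have "\<dots> = sqrt (3 * pi / 32) * (l / s)"
    unfolding r using l s by (simp only: real_sqrt_mult real_sqrt_abs abs_of_pos divide_pos_pos)
  finally have CL: "(C_L Lx Ly)\<^sup>2 = sqrt (3 * pi / 32) * (l / s)" .
  have lam: "0 < lambda_1 Lx Ly" "lambda_1 Lx Ly \<le> pi" "lambda_1 Lx Ly \<le> 2 * pi / l"
    using L by (auto simp: lambda_1_def l_def max_def)
  have CP: "1 / pi \<le> C_P Lx Ly" "l / (2 * pi) \<le> C_P Lx Ly"
    using lam l by (auto simp: C_P_def field_simps)
  \<comment> \<open>The number 5 / 36 is tuned to 3 * 5 / 36 = 1 / 3 + 1 / 12: the two shares cover
    l / 6 and 1 / 12 below.\<close>
  have "5 * pi / 36 \<le> sqrt (3 * pi / 32)"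
  proof (rule real_le_rsqrt)
    have "pi * pi \<le> 4 * pi" using pi_less_4 pi_gt_zero by (intro mult_right_mono) auto
    then show "(5 * pi / 36)\<^sup>2 \<le> 3 * pi / 32" using pi_gt_zero by (simp add: power2_eq_square)
  qed
  then have "3 * (5 * pi / 36) * C_P Lx Ly \<le> 3 * sqrt (3 * pi / 32) * C_P Lx Ly"
    using CP(1) pi_gt_zero by (intro mult_right_mono) (auto intro: order_trans[rotated])
  moreover have "l / 6 + 1 / 12 \<le> 3 * (5 * pi / 36) * C_P Lx Ly"
  proof -
    have "pi * (1 / pi) \<le> pi * C_P Lx Ly" "2 * pi * (l / (2 * pi)) \<le> 2 * pi * C_P Lx Ly"
      using CP by (intro mult_left_mono; simp)+
    then have "1 \<le> pi * C_P Lx Ly" "l \<le> 2 * (pi * C_P Lx Ly)" by simp_all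
    then show ?thesis by simp
  qed
  ultimately have "(l + 1 / 2) / 6 \<le> 3 * (sqrt (3 * pi / 32) * C_P Lx Ly)" by (simp add: field_simps)
  then have "l / s * ((l + 1 / 2) / 6) \<le> l / s * (3 * (sqrt (3 * pi / 32) * C_P Lx Ly))"
    using l s by (intro mult_left_mono) auto
  also have "\<dots> = C_1 Lx Ly * 3" by (simp add: C_1_def CL)
  also have "\<dots> \<le> A_2 Lx Ly"
    unfolding A_2_def using lam by (intro mult_left_mono) (auto simp: C_1_def C_P_def)
  finally show ?thesis by (simp add: l_def s_def mult.commute)
qed

text \<open>The left side is the nonnegative root of c^2 y^2 + a y = d, and the quadratic increases
  for nonnegative y.\<close>

lemma quadratic_root_bound:
  fixes a c y d :: real
  assumes "0 < a" "0 < c" "0 \<le> y" "0 \<le> d" "d \<le> c\<^sup>2 * y\<^sup>2 + a * y"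
  shows "a / (2 * c\<^sup>2) * (- 1 + sqrt (1 + 4 * c\<^sup>2 * d / a\<^sup>2)) \<le> y"
proof -
  have "1 + 4 * c\<^sup>2 * d / a\<^sup>2 \<le> (1 + 2 * c\<^sup>2 * y / a)\<^sup>2"
  proof -
    have "4 * c\<^sup>2 * d / a\<^sup>2 \<le> 4 * c\<^sup>2 * (c\<^sup>2 * y\<^sup>2 + a * y) / a\<^sup>2"
      using assms by (intro divide_right_mono mult_left_mono) auto
    also have "\<dots> = (1 + 2 * c\<^sup>2 * y / a)\<^sup>2 - 1"
      using assms(1) by (simp add: power2_eq_square field_simps)
    finally show ?thesis by simp
  qed
  then have "sqrt (1 + 4 * c\<^sup>2 * d / a\<^sup>2) \<le> 1 + 2 * c\<^sup>2 * y / a"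
    using assms by (intro real_le_lsqrt) auto
  then have "a / (2 * c\<^sup>2) * (- 1 + sqrt (1 + 4 * c\<^sup>2 * d / a\<^sup>2)) \<le> a / (2 * c\<^sup>2) * (2 * c\<^sup>2 * y / a)"
    using assms by (intro mult_left_mono) auto
  also have "\<dots> = y" using assms by simp
  finally show ?thesis .
qed

lemma lorentz_eq_cross3:
  "cross3 (curl b x) (b x) $ i = lorentz (\<lambda>i y. b y $ i) (\<lambda>i j. pderiv_at j (\<lambda>y. b y $ i)) i x"
  using exhaust_3[of i] by (auto simp: cross3_def curl_def lorentz_def sum_3 algebra_simps)

theorem theorem4p7:
  fixes Lx Ly Ek \<Lambda> Ra Rm Pe Ra\<nu> Tminus Tplus \<gamma> t :: real
    and Q :: "real^3 \<Rightarrow> real"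
    and J :: "real set"
    and u B :: "real \<Rightarrow> real^3 \<Rightarrow> real^3"
    and P T :: "real \<Rightarrow> real^3 \<Rightarrow> real"
  assumes "Lx > 0" and "Ly > 0"
    and "Ek > 0" and "\<Lambda> > 0" and "Ra > 0" and "Rm > 0" and "Pe > 0"
    and "Ra\<nu> * Ek = Ra * Pe"
    and "viscous_inertialess_solution Lx Ly Ek \<Lambda> Ra Rm Pe Q Tminus Tplus J u B P T"
    and "\<forall>s\<in>J. exact_flux Lx Ly (B s)"
    and "0 < \<gamma>" and "\<gamma> < 1"
    and "t \<in> J"
    and "\<exists>x\<in>cell Lx Ly. B t x \<noteq> 0"
    and "vector_derivative (\<lambda>s. magnetic_energy Lx Ly (B s)) (at t within J) \<ge> 0"
  shows "Ra\<nu> * L2_norm_cell Lx Ly (laplacian (T t)) \<ge>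
    A_2 Lx Ly / (2 * (C_P2 Lx Ly)\<^sup>2) * Pe * Ek powr (- 2 + \<gamma>) *
      (- 1 + sqrt (1 + 4 * (C_P2 Lx Ly)\<^sup>2 * Ek powr (1 - \<gamma>) / ((A_2 Lx Ly)\<^sup>2 * Rm)))"
proof -
  note L = assms(1,2) and sol = assms(9)[unfolded viscous_inertialess_solution_def]
  have sm: "smooth_on (J \<times> slab) (\<lambda>(t, x). u t x)" "smooth_on (J \<times> slab) (\<lambda>(t, x). B t x)"
    "smooth_on (J \<times> slab) (\<lambda>(t, x). P t x)" "smooth_on (J \<times> slab) (\<lambda>(t, x). T t x)"
    and J: "is_interval J" "interior J \<noteq> {}" using sol by simp_all
  note s = smooth_on_slice[OF sm(1) assms(13)] smooth_on_slice[OF sm(2) assms(13)]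
    smooth_on_slice[OF sm(3) assms(13)] smooth_on_slice[OF sm(4) assms(13)]
  have per: "periodic_xy Lx Ly (u t)" "periodic_xy Lx Ly (B t)" "periodic_xy Lx Ly (P t)" "periodic_xy Lx Ly (T t)"
    and bc: "boundary_conditions Tminus Tplus (u t) (B t) (T t)"
    using sol assms(13) by blast+
  have eqs: "cross3 e_z (u t x) + gradient (P t) x - Ek *\<^sub>R laplacian (u t) x =
             \<Lambda> *\<^sub>R cross3 (curl (B t) x) (B t x) + (Ra * T t x) *\<^sub>R e_z"
    "divergence (u t) x = 0"
    "time_deriv J B t x - curl (\<lambda>y. cross3 (u t y) (B t y)) x = (1 / Rm) *\<^sub>R laplacian (B t) x"
    "divergence (B t) x = 0" if "0 < x $ 3" "x $ 3 < 1" for x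
    using sol assms(13) that by blast+

  define U Bf where "U i x = u t x $ i" and "Bf i x = B t x $ i" for i x
  define UG BG where "UG i j = pderiv_at j (U i)" and "BG i j = pderiv_at j (Bf i)" for i j
  define UH BH where "UH i j k = pderiv_at k (UG i j)" and "BH i j k = pderiv_at k (BG i j)" for i j k
  define TG where "TG i = pderiv_at i (T t)" for i
  define TH where "TH i j = pderiv_at j (TG i)" for i j
  have sU: "smooth_on slab (U i)" "smooth_on slab (UG i j)" and sB: "smooth_on slab (Bf i)" "smooth_on slab (BG i j)" for i j
    unfolding UG_def BG_def U_def[abs_def] Bf_def[abs_def]
    by (intro smooth_on_pderiv_at smooth_on_component s)+
  have pU: "periodic_xy Lx Ly (U i)" and pB: "periodic_xy Lx Ly (Bf i)" for i
    using per by (simp_all add: periodic_xy_def U_def Bf_def)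
  have U: "C1_field Lx Ly (U i) (UG i)" "C1_field Lx Ly (UG i j) (UH i j)" for i j
    unfolding UG_def UH_def
    by (intro smooth_C1_field smooth_on_pderiv_at periodic_xy_pderiv_at sU pU)+
  have Bc: "C1_field Lx Ly (Bf i) (BG i)" "C1_field Lx Ly (BG i j) (BH i j)" for i j
    unfolding BG_def BH_def
    by (intro smooth_C1_field smooth_on_pderiv_at periodic_xy_pderiv_at sB pB)+
  have Pc: "C1_field Lx Ly (P t) (\<lambda>i. pderiv_at i (P t))" by (rule smooth_C1_field[OF s(3) per(3)])
  have sT: "smooth_on slab (TG i)" "periodic_xy Lx Ly (TG i)" for i
    unfolding TG_def by (intro smooth_on_pderiv_at periodic_xy_pderiv_at s(4) per(4))+
  have Tc: "C1_field Lx Ly (T t) TG" "C1_field Lx Ly (TG i) (TH i)" for i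
    unfolding TH_def using smooth_C1_field[OF s(4) per(4)] smooth_C1_field[OF sT]
    by (simp_all add: TG_def[abs_def])
  have lapT: "periodic_xy Lx Ly (\<lambda>x. \<Sum>j\<in>UNIV. TH j j x)"
    using periodic_xy_pderiv_at[OF sT] by (simp add: periodic_xy_def TH_def)
  note c = C1_field_continuous[OF U(1)] C1_field_continuous[OF U(2)] C1_field_continuous[OF Bc(1)]
    C1_field_continuous[OF Bc(2)] C1_field_continuous[OF Pc] C1_field_continuous[OF Tc(1)]
  have lapU: "laplacian (u t) x $ i = (\<Sum>j\<in>UNIV. UH i j j x)" if "x \<in> slab" for x i
    using laplacian_component[OF s(1) that, of i] by (simp add: UH_def UG_def U_def[abs_def])
  have lapB: "laplacian (B t) x $ i = (\<Sum>j\<in>UNIV. BH i j j x)" if "x \<in> slab" for x i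
    using laplacian_component[OF s(2) that, of i] by (simp add: BH_def BG_def Bf_def[abs_def])
  have lor: "cross3 (curl (B t) x) (B t x) $ i = lorentz Bf BG i x" for x i
    using lorentz_eq_cross3[of "B t" x i] by (simp add: BG_def[abs_def] Bf_def[abs_def])
  have cF: "continuous_on slab (lorentz Bf BG i)" for i
    unfolding lorentz_def[abs_def] by (intro continuous_intros c)
  have interior_slab: "x \<in> slab" if "0 < x $ 3" "x $ 3 < 1" for x :: "real^3"
    using that by (simp add: slab_def)

  have divU: "(\<Sum>i\<in>UNIV. UG i i x) = 0" if "x \<in> slab" for x
    by (rule slab_eq_extend[OF _ _ _ that])
      (use eqs(2) in \<open>auto simp: divergence_def UG_def U_def[abs_def] intro!: continuous_intros c[unfolded UG_def U_def[abs_def]]\<close>)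
  have divB: "(\<Sum>i\<in>UNIV. BG i i x) = 0" if "x \<in> slab" for x
    by (rule slab_eq_extend[OF _ _ _ that])
      (use eqs(4) in \<open>auto simp: divergence_def BG_def Bf_def[abs_def] intro!: continuous_intros c[unfolded BG_def Bf_def[abs_def]]\<close>)
  have mom: "cross3 e_z (\<chi> i. U i x) $ i + pderiv_at i (P t) x - Ek * (\<Sum>j\<in>UNIV. UH i j j x) =
        \<Lambda> * lorentz Bf BG i x + Ra * T t x * e_z $ i" if "x \<in> slab" for x i
  proof (rule slab_eq_extend[OF _ _ _ that])
    have "cross3 e_z (\<chi> i. U i x) $ i = (if i = 1 then - U 2 x else if i = 2 then U 1 x else 0)" for x
      using exhaust_3[of i] by (auto simp: cross3_def e_z_def axis_def)
    then have cz: "continuous_on slab (\<lambda>x. cross3 e_z (\<chi> i. U i x) $ i)"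
      by (cases "i = 1"; cases "i = 2") (simp_all add: c continuous_intros)
    show "continuous_on slab (\<lambda>x. cross3 e_z (\<chi> i. U i x) $ i + pderiv_at i (P t) x - Ek * (\<Sum>j\<in>UNIV. UH i j j x))"
      by (intro continuous_on_diff continuous_on_add continuous_on_mult continuous_on_sum continuous_on_const cz c)
    show "continuous_on slab (\<lambda>x. \<Lambda> * lorentz Bf BG i x + Ra * T t x * e_z $ i)"
      by (intro continuous_intros c cF)
    fix x :: "real^3" assume x: "0 < x $ 3" "x $ 3 < 1"
    have "(\<chi> i. U i x) = u t x" by (simp add: U_def vec_eq_iff)
    then show "cross3 e_z (\<chi> i. U i x) $ i + pderiv_at i (P t) x - Ek * (\<Sum>j\<in>UNIV. UH i j j x) =
        \<Lambda> * lorentz Bf BG i x + Ra * T t x * e_z $ i"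
      using arg_cong[OF eqs(1)[OF x], of "\<lambda>v. v $ i"] lapU[OF interior_slab[OF x]] lor[of x i]
      by (simp add: gradient_def)
  qed

  have bcs: "u t x $ 3 = 0" "curl (u t) x $ 1 = 0" "curl (u t) x $ 2 = 0" "B t x $ 1 = 0" "B t x $ 2 = 0"
    if "x $ 3 = 0 \<or> x $ 3 = 1" for x
    using bc that unfolding boundary_conditions_def
    by (auto simp: e_z_def cross3_def vec_eq_iff forall_3 axis_def inner_vec_def sum_3)
  have bT: "x $ 3 = 0 \<Longrightarrow> T t x = Tminus" "x $ 3 = 1 \<Longrightarrow> T t x = Tplus" for x
    using bc unfolding boundary_conditions_def by auto
  have bB: "Bf i x = 0" if "i \<noteq> 3" "x $ 3 = 0 \<or> x $ 3 = 1" for i x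
    using bcs[OF that(2)] that(1) exhaust_3[of i] by (auto simp: Bf_def)
  have bU3: "U 3 x = 0" if "x $ 3 = 0 \<or> x $ 3 = 1" for x using bcs[OF that] by (simp add: U_def)
  have tang: "g i x = 0"
    if "C1_field Lx Ly f g" "x $ 3 = 0 \<or> x $ 3 = 1" "i \<noteq> 3" "\<And>y. y $ 3 = 0 \<or> y $ 3 = 1 \<Longrightarrow> f y = 0" for f g x i
    by (rule C1_field_bdry_partial[OF that(1) refl _ that(3)]) (use that in auto)
  \<comment> \<open>Horizontal derivatives of \<open>U 3\<close> vanish on the walls along with
    \<open>U 3\<close>, so the stress-free condition reduces to vanishing z-derivatives of the
    horizontal velocity.\<close>
  have bUG: "UG i 3 x = 0" if "i \<noteq> 3" "x $ 3 = 0 \<or> x $ 3 = 1" for i x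
  proof -
    have "UG 3 1 x = 0" "UG 3 2 x = 0" by (rule tang[OF U(1) that(2) _ bU3]; simp)+
    moreover have "UG 3 2 x - UG 2 3 x = 0" "UG 1 3 x - UG 3 1 x = 0"
      using bcs(2,3)[OF that(2)] by (simp_all add: curl_def UG_def U_def[abs_def])
    ultimately show ?thesis using that(1) exhaust_3[of i] by auto
  qed
  \<comment> \<open>On the walls the horizontal part of the divergence of B vanishes, hence so does
    the vertical part. This removes the wall term of magnetic diffusion for the component of B that
    need not vanish there.\<close>
  have bBG3: "BG 3 3 x = 0" if "x $ 3 = 0 \<or> x $ 3 = 1" for x
  proof -
    have "BG 1 1 x = 0" by (rule tang[OF Bc(1) that _ bB]) simp_all
    moreover have "BG 2 2 x = 0" by (rule tang[OF Bc(1) that _ bB]) simp_all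
    moreover have "x \<in> slab" using that by (auto simp: slab_def)
    ultimately show ?thesis using divB[of x] by (simp add: sum_3)
  qed

  have flux1: "integral (rect Lx Ly) (hsec (Bf 3) 1) = 0"
    using assms(10,13)
    by (auto simp: exact_flux_def e_z_def inner_axis' hsec_def Bf_def point_def)
  have flux: "integral (rect Lx Ly) (hsec (Bf 3) z) = 0" if "z \<in> {0..1}" for z
    by (rule horizontal_flux_constant[where B = Bf and BG = BG, OF L Bc(1) divB flux1 that])

  define G where "G = integral (cell Lx Ly) (\<lambda>x. \<Sum>i\<in>UNIV. \<Sum>j\<in>UNIV. (BG i j x)\<^sup>2)"
  define h where "h = L2_norm_cell Lx Ly (laplacian (T t))"
  define FU where "FU = integral (cell Lx Ly) (\<lambda>x. \<Sum>i\<in>UNIV. U i x * lorentz Bf BG i x)"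
  have h_eq: "h = sqrt (integral (cell Lx Ly) (\<lambda>x. (\<Sum>j\<in>UNIV. TH j j x)\<^sup>2))"
    by (simp add: h_def L2_norm_cell_def laplacian_def TH_def TG_def)
  have h0: "0 \<le> h" unfolding h_eq
    by (intro real_sqrt_ge_zero cell_square_integral_nonneg continuous_intros C1_field_continuous[OF Tc(2)])
  \<comment> \<open>Nontriviality of the field enters here; \<open>G\<close> is later cancelled from
    both sides.\<close>
  have G_pos: "0 < G"
  proof (rule ccontr)
    assume "\<not> 0 < G"
    then have z: "integral (cell Lx Ly) (\<lambda>x. (Bf i x)\<^sup>2) = 0" for i
      by (intro magnetic_Poincare[where B = Bf and BG = BG, OF L Bc(1) bB flux]) (simp_all add: G_def)
    have "B t x = 0" if x: "x \<in> cell Lx Ly" for x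
    proof -
      have "(Bf i x)\<^sup>2 = 0" for i
      proof -
        have "continuous_on (cell Lx Ly) (\<lambda>x. (Bf i x)\<^sup>2)"
          by (rule continuous_on_subset[OF _ cell_subset_slab]) (intro continuous_intros c)
        moreover have "box 0 (vector [Lx, Ly, 1] :: real^3) \<noteq> {}"
        proof -
          have "vector [Lx / 2, Ly / 2, 1 / 2] \<in> box 0 (vector [Lx, Ly, 1] :: real^3)"
            using L by (simp add: mem_box_cart forall_3)
          then show ?thesis by blast
        qed
        ultimately show ?thesis
          using z[of i] x unfolding cell_def by (subst (asm) integral_cbox_eq_0_iff) auto
      qed
      then show ?thesis by (simp add: Bf_def vec_eq_iff)
    qed
    then show False using assms(14) by blast
  qed
  have work: "- FU \<le> A_2 Lx Ly * Ra * h * G"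
  proof -
    have "- FU \<le> max Lx Ly * (max Lx Ly + 1 / 2) / (6 * sqrt (Lx * Ly)) * Ra * h * G"
      unfolding FU_def h_eq G_def
      by (rule lorentz_work_bound[where U = U and UG = UG and UH = UH and B = Bf and BG = BG and TH = TH,
            OF L assms(3-5) U Bc(1) Pc Tc lapT mom divU bU3 bUG bT bB flux])
    also have "\<dots> \<le> A_2 Lx Ly * Ra * h * G"
      using A_2_lower_bound[OF L] assms(5) h0 G_pos by (intro mult_right_mono) auto
    finally show ?thesis .
  qed

  define E where "E i x = cross3 (u t x) (B t x) $ i" for i x
  have E_eq: "E 1 x = U 2 x * Bf 3 x - U 3 x * Bf 2 x" "E 2 x = U 3 x * Bf 1 x - U 1 x * Bf 3 x"
    "E 3 x = U 1 x * Bf 2 x - U 2 x * Bf 1 x" for x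
    by (simp_all add: E_def cross3_def U_def Bf_def)
  define EG where "EG k i = pderiv_at i (E k)" for k i
  have Ec: "C1_field Lx Ly (E k) (EG k)" for k
  proof -
    have e: "E 1 = (\<lambda>x. U 2 x * Bf 3 x - U 3 x * Bf 2 x)" "E 2 = (\<lambda>x. U 3 x * Bf 1 x - U 1 x * Bf 3 x)"
      "E 3 = (\<lambda>x. U 1 x * Bf 2 x - U 2 x * Bf 1 x)"
      by (rule ext, rule E_eq)+
    have "\<exists>g. C1_field Lx Ly (\<lambda>x. U i x * Bf j x - U j x * Bf i x) g" for i j
      using C1_field_diff[OF C1_field_mult[OF U(1) Bc(1)] C1_field_mult[OF U(1) Bc(1)]] by blast
    then have "\<exists>g. C1_field Lx Ly (E k) g"
      using exhaust_3[of k] e by metis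
    then obtain g where g: "C1_field Lx Ly (E k) g" by blast
    then show ?thesis
      by (rule C1_field_cong) (simp_all add: EG_def C1_field_pderiv_at[OF g])
  qed
  note cE = C1_field_continuous[OF Ec]
  define cE where "cE i x = curl (\<lambda>y. cross3 (u t y) (B t y)) x $ i" for i x
  have curlE: "cE 1 x = EG 3 2 x - EG 2 3 x" "cE 2 x = EG 1 3 x - EG 3 1 x" "cE 3 x = EG 2 1 x - EG 1 2 x" for x
    by (simp_all add: cE_def curl_def EG_def E_def[abs_def])
  have ccE: "continuous_on slab (cE i)" for i
    using exhaust_3[of i] by (auto simp: curlE[abs_def] intro!: continuous_intros cE)
  note en = magnetic_energy_derivative[OF J sm(2) assms(13)]
  have induction: "time_deriv J B t x $ i = cE i x + 1 / Rm * (\<Sum>j\<in>UNIV. BH i j j x)" if "x \<in> slab" for x i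
  proof (rule slab_eq_extend[OF _ _ _ that])
    show "continuous_on slab (\<lambda>x. time_deriv J B t x $ i)" by (intro continuous_intros en)
    show "continuous_on slab (\<lambda>x. cE i x + 1 / Rm * (\<Sum>j\<in>UNIV. BH i j j x))" by (intro continuous_intros ccE c)
    fix x :: "real^3" assume x: "0 < x $ 3" "x $ 3 < 1"
    show "time_deriv J B t x $ i = cE i x + 1 / Rm * (\<Sum>j\<in>UNIV. BH i j j x)"
      using arg_cong[OF eqs(3)[OF x], of "\<lambda>v. v $ i"] lapB[OF interior_slab[OF x], of i]
      by (simp add: cE_def)
  qed
  have balance: "integral (cell Lx Ly) (\<lambda>x. B t x \<bullet> time_deriv J B t x) = - FU - G / Rm"
  proof -
    have visc: "integral (cell Lx Ly) (\<lambda>x. \<Sum>i\<in>UNIV. Bf i x * (\<Sum>j\<in>UNIV. BH i j j x)) = - G"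
      unfolding G_def
    proof (rule green_identity_vector[OF L Bc])
      fix i :: 3 and x :: "real^3" assume "x $ 3 = 0 \<or> x $ 3 = 1"
      then show "Bf i x * BG i 3 x = 0" using bB[of i x] bBG3[of x] by (cases "i = 3") auto
    qed
    have ind: "integral (cell Lx Ly) (\<lambda>x. Bf 1 x * cE 1 x + Bf 2 x * cE 2 x + Bf 3 x * cE 3 x) = - FU"
      unfolding FU_def curlE by (rule induction_work[where U = U and B = Bf and E = E, OF L c(1) Bc(1) Ec E_eq bB])
    have "integral (cell Lx Ly) (\<lambda>x. B t x \<bullet> time_deriv J B t x) =
        integral (cell Lx Ly) (\<lambda>x. (Bf 1 x * cE 1 x + Bf 2 x * cE 2 x + Bf 3 x * cE 3 x) +
          1 / Rm * (\<Sum>i\<in>UNIV. Bf i x * (\<Sum>j\<in>UNIV. BH i j j x)))"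
    proof (rule integral_cong)
      fix x assume "x \<in> cell Lx Ly"
      then have "x \<in> slab" using cell_subset_slab by blast
      then show "B t x \<bullet> time_deriv J B t x = (Bf 1 x * cE 1 x + Bf 2 x * cE 2 x + Bf 3 x * cE 3 x) +
          1 / Rm * (\<Sum>i\<in>UNIV. Bf i x * (\<Sum>j\<in>UNIV. BH i j j x))"
        by (simp only: inner_vec_def induction) (simp add: Bf_def sum_3 algebra_simps)
    qed
    also have "\<dots> = - FU + 1 / Rm * - G"
      unfolding ind[symmetric] visc[symmetric] integral_mult_right[symmetric]
      by (intro integral_add cell_integrable continuous_intros c ccE)
    finally show ?thesis by simp
  qed
  \<comment> \<open>Dynamo action makes the energy balance nonnegative.\<close>
  have "G / Rm \<le> A_2 Lx Ly * Ra * h * G"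
    using assms(15) work unfolding en(1) balance by linarith
  then have "G * (1 / Rm) \<le> G * (A_2 Lx Ly * (Ra * h))" by (simp add: mult_ac)
  then have key: "1 / Rm \<le> A_2 Lx Ly * (Ra * h)"
    using G_pos by (simp only: mult_le_cancel_left_pos)

  define e where "e = Ek powr (1 - \<gamma>)"
  \<comment> \<open>The unknown of the quadratic inequality. Multiplied by
    \<open>Pe * Ek powr (- 2 + \<gamma>)\<close> it becomes \<open>Ra\<nu> * h\<close>, because the
    powers of \<open>Ek\<close> combine to 1 / Ek.\<close>
  define y where "y = Ra * e * h"
  have e: "0 < e" using assms(3) by (simp add: e_def)
  have "0 < A_2 Lx Ly"
  proof -
    have "0 < max Lx Ly * (max Lx Ly + 1 / 2) / (6 * sqrt (Lx * Ly))"
      using L by (auto simp: max_def)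
    then show ?thesis using A_2_lower_bound[OF L] by linarith
  qed
  moreover have "0 < C_P2 Lx Ly"
    using L by (auto simp: C_P2_def C_P_def b_2_def lambda_1_def intro!: add_pos_pos divide_pos_pos)
  moreover have "0 \<le> y" using e h0 assms(5) by (simp add: y_def)
  \<comment> \<open>The linear bound \<open>key\<close> times \<open>e\<close>, with the nonnegative
    quadratic term added to match the claimed root.\<close>
  moreover have "e / Rm \<le> (C_P2 Lx Ly)\<^sup>2 * y\<^sup>2 + A_2 Lx Ly * y"
  proof -
    have "e * (1 / Rm) \<le> e * (A_2 Lx Ly * (Ra * h))" using key e by (intro mult_left_mono) auto
    also have "\<dots> = A_2 Lx Ly * y" by (simp add: y_def)
    finally show ?thesis by (simp add: add_increasing)
  qed
  ultimately have "A_2 Lx Ly / (2 * (C_P2 Lx Ly)\<^sup>2) *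
      (- 1 + sqrt (1 + 4 * (C_P2 Lx Ly)\<^sup>2 * (e / Rm) / (A_2 Lx Ly)\<^sup>2)) \<le> y"
    using e assms(6) by (intro quadratic_root_bound) auto
  then have "Pe * Ek powr (- 2 + \<gamma>) * (A_2 Lx Ly / (2 * (C_P2 Lx Ly)\<^sup>2) *
      (- 1 + sqrt (1 + 4 * (C_P2 Lx Ly)\<^sup>2 * (e / Rm) / (A_2 Lx Ly)\<^sup>2))) \<le> Pe * Ek powr (- 2 + \<gamma>) * y"
    using assms(7) by (intro mult_left_mono) auto
  also have "Pe * Ek powr (- 2 + \<gamma>) * y = Ra\<nu> * h"
  proof -
    have "Ek powr (- 2 + \<gamma>) * e = Ek powr (- 1)" by (simp add: e_def flip: powr_add)
    also have "\<dots> = 1 / Ek" using assms(3) by (simp add: powr_minus_divide)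
    finally have *: "Ek powr (- 2 + \<gamma>) * e = 1 / Ek" .
    have "Pe * Ek powr (- 2 + \<gamma>) * y = (Ra * Pe) * h * (Ek powr (- 2 + \<gamma>) * e)" by (simp add: y_def mult_ac)
    also have "\<dots> = Ra\<nu> * h" unfolding * assms(8)[symmetric] using assms(3) by simp
    finally show ?thesis .
  qed
  finally show ?thesis by (simp add: h_def e_def mult_ac)
qed

end
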